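(* For all $n\geqslant1$ and all $1\leqslant p<\infty$, $$\ell_p\left(\frac{Y_n}{n},X\right)\leqslant\kappa_p\,n^{-1/2},\qquad \kappa_p:=\frac{2p+3}{2p-1}\,(7+\tau_p),$$ where $$\tau_p:=\left(\frac12+\frac{\Gamma(p/2+1)}{2^{p/2+1}}\right)^{1/p}.$$ Here $Y_n$ is the number of key exchanges of Hoare's Quickselect on a uniformly random permutation of size $n$ with an independent uniform rank, and $X$ has the distribution that is the unique solution of $X\stackrel{d}{=}\sqrt{U}X+\sqrt{U}(1-\sqrt{U})$.
   Context: Partitioning procedure (Hoare's version as in Cormen, Leiserson and Rivest). Input: a list $A[1..n]$ of $n\geqslant 2$ distinct elements of an ordered set. Set $p:=A[1]$ (the pivot), $i:=0$, $j:=n+1$. Repeat: decrease $j$ in steps of $1$ (at least one step) until $A[j]\leqslant p$; increase $i$ in steps of $1$ (at least one step) until $A[i]\geqslant p$; if $i<j$, exchange $A[i]$ and $A[j]$ (this counts as one key exchange) and continue; otherwise stop and return $I_n:=j$. The left sub-list is $A[1..I_n]$ (size $I_n$), the right sub-list is $A[I_n+1..n]$ (size $n-I_n$). (The pivot $p$ here is unrelated to the exponent $p$ in the claim.) Quickselect with rank $r\in\{1,\ldots,n\}$: if $n=1$, stop (no exchanges). If $n\geqslant2$, apply the partitioning procedure; if $r\leqslant I_n$, recurse on the left sub-list with rank $r$; otherwise recurse on the right sub-list with rank $r-I_n$. $Y_n$ is the total number of key exchanges over all calls to the partitioning procedure, when the input list is a uniformly random permutation of $n$ distinct elements and the rank is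 uniformly distributed on $\{1,\ldots,n\}$ and independent of the permutation. The law of $X$ is the unique probability distribution on $\mathbb{R}$ such that $X\stackrel{d}{=}\sqrt{U}X+\sqrt{U}(1-\sqrt{U})$, with $X$ and $U$ independent on the right-hand side and $U$ uniform on $[0,1]$. For real random variables $W,Z$ with finite $p$-th absolute moments, $\ell_p(W,Z):=\inf\{\|W'-Z'\|_p : W'\stackrel{d}{=}W,\ Z'\stackrel{d}{=}Z\}$, the infimum being over all pairs $(W',Z')$ on a common probability space with these marginals, and $\|W\|_p=(\mathbb{E}|W|^p)^{1/p}$. $\Gamma$ is Euler's gamma function. *)

theory Defs
  imports "HOL-Probability.Probability"
begin

text \<open>Positions in a list are numbered from 1, as in the usual presentation of the procedure.\<close>

definition key_at :: "'a list \<Rightarrow> nat \<Rightarrow> 'a" where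
  "key_at A i = A ! (i - 1)"

definition exchange :: "'a list \<Rightarrow> nat \<Rightarrow> nat \<Rightarrow> 'a list" where
  "exchange A i j = A[i - 1 := key_at A j, j - 1 := key_at A i]"

text \<open>
  The two scans move by at least one position. When called from \<open>partition_list\<close> they always stop
  at a key satisfying the comparison; stopping at \<open>0\<close> or \<open>length A + 1\<close> only makes them total.
\<close>

fun scan_down :: "'a::linorder \<Rightarrow> 'a list \<Rightarrow> nat \<Rightarrow> nat" where
  "scan_down p A 0 = 0"
| "scan_down p A (Suc j) = (if j = 0 \<or> key_at A j \<le> p then j else scan_down p A j)"

function scan_up :: "'a::linorder \<Rightarrow> 'a list \<Rightarrow> nat \<Rightarrow> nat" where
  "scan_up p A i =
     (if i \<ge> length A \<or> key_at A (i + 1) \<ge> p then i + 1 else scan_up p A (i + 1))"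
  by pat_completeness auto
termination by (relation "Wellfounded.measure (\<lambda>(p, A, i). length A - i)") auto

declare scan_up.simps [simp del]

lemma scan_down_le: "scan_down p A j \<le> j - 1"
  by (induction p A j rule: scan_down.induct) auto

lemma scan_up_gt: "scan_up p A i > i"
  by (induction p A i rule: scan_up.induct) (subst scan_up.simps, auto)

text \<open>
  The result is the rearranged list, the final value of \<open>j\<close>, and the number of key exchanges.
\<close>

function partition_loop ::
  "'a::linorder \<Rightarrow> 'a list \<Rightarrow> nat \<Rightarrow> nat \<Rightarrow> 'a list \<times> nat \<times> nat" where
  "partition_loop p A i j =
     (let j' = scan_down p A j; i' = scan_up p A i in
      if i' < j'
      then (case partition_loop p (exchange A i' j') i' j' of (B, m, k) \<Rightarrow> (B, m, k + 1))
      else (A, j', 0))"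
  by pat_completeness auto
termination
proof (relation "Wellfounded.measure (\<lambda>(p, A, i, j). j)", goal_cases)
  case (2 p A i j x y)
  then show ?case using scan_down_le[of p A j] by simp
qed simp

declare partition_loop.simps [simp del]

definition partition_list :: "'a::linorder list \<Rightarrow> 'a list \<times> nat \<times> nat" where
  "partition_list A = partition_loop (key_at A 1) A 0 (length A + 1)"

lemma scan_down_stops:
  assumes "1 \<le> m" "m < j" "key_at A m \<le> p"
  shows "m \<le> scan_down p A j \<and> key_at A (scan_down p A j) \<le> p"
  using assms by (induction p A j rule: scan_down.induct) (auto simp: less_Suc_eq)

lemma length_exchange [simp]: "length (exchange A i j) = length A"
  by (simp add: exchange_def)

lemma key_at_exchange_left:
  assumes "1 \<le> i" "i < j" "j \<le> length A"
  shows "key_at (exchange A i j) i = key_at A j"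
proof -
  have "j - 1 \<noteq> i - 1" "i - 1 < length A"
    using assms by auto
  then show ?thesis by (simp add: exchange_def key_at_def)
qed

lemma partition_loop_bounds:
  assumes "1 \<le> m" "m < j" "key_at A m \<le> p" "j \<le> length A + 1"
    and "partition_loop p A i j = (B, l, k)"
  shows "1 \<le> l \<and> l < j \<and> length B = length A"
  using assms
proof (induction p A i j arbitrary: m B l k rule: partition_loop.induct)
  case (1 p A i j)
  define j' i' where "j' = scan_down p A j" and "i' = scan_up p A i"
  have j': "m \<le> j'" "key_at A j' \<le> p" "j' < j"
    using scan_down_stops[of m j A p] scan_down_le[of p A j] 1(2-4) by (auto simp: j'_def)
  have i': "1 \<le> i'"
    using scan_up_gt[of i p A] by (simp add: i'_def)
  show ?case
  proof (cases "i' < j'")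
    case True
    obtain B' l' k' where r: "partition_loop p (exchange A i' j') i' j' = (B', l', k')"
      by (metis prod_cases3)
    have "(B, l, k) = (B', l', k' + 1)"
      using 1(6) True r by (subst (asm) partition_loop.simps) (simp add: j'_def i'_def Let_def)
    moreover have "1 \<le> l' \<and> l' < j' \<and> length B' = length (exchange A i' j')"
      by (rule 1(1)[of j' i' i', OF _ _ True _ _ _ _ r])
        (use True i' j' 1(5) key_at_exchange_left[of i' j' A] in \<open>auto simp: j'_def i'_def\<close>)
    ultimately show ?thesis using j' by auto
  next
    case False
    then have "(B, l, k) = (A, j', 0)"
      using 1(6) by (subst (asm) partition_loop.simps) (auto simp add: j'_def i'_def Let_def)
    then show ?thesis using j' 1(2) by auto
  qed
qed

lemma partition_list_bounds:
  assumes "length A \<ge> 2" "partition_list A = (B, l, k)"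
  shows "1 \<le> l \<and> l < length A \<and> length B = length A"
proof -
  let ?p = "key_at A 1" and ?n = "length A"
  define j' where "j' = scan_down ?p A (?n + 1)"
  have i': "scan_up ?p A 0 = 1"
    using assms(1) by (subst scan_up.simps) simp
  have j': "1 \<le> j'" "j' \<le> ?n" "key_at A j' \<le> ?p"
    using scan_down_stops[of 1 "?n + 1" A ?p] scan_down_le[of ?p A "?n + 1"] assms(1)
    by (auto simp: j'_def)
  show ?thesis
  proof (cases "1 < j'")
    case True
    obtain B' l' k' where r: "partition_loop ?p (exchange A 1 j') 1 j' = (B', l', k')"
      by (metis prod_cases3)
    have "partition_list A = (B', l', k' + 1)"
      unfolding partition_list_def
      by (subst partition_loop.simps) (use True r i' in \<open>simp add: j'_def Let_def\<close>)
    moreover have "1 \<le> l' \<and> l' < j' \<and> length B' = length (exchange A 1 j')"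
      by (rule partition_loop_bounds[OF _ True _ _ r])
        (use j' True key_at_exchange_left[of 1 j' A] in auto)
    ultimately show ?thesis using assms(2) j' by auto
  next
    case False
    then have "partition_list A = (A, j', 0)"
      unfolding partition_list_def
      by (subst partition_loop.simps) (use i' in \<open>simp add: j'_def Let_def\<close>)
    then show ?thesis using assms j' False by auto
  qed
qed

function key_exchanges :: "'a::linorder list \<Rightarrow> nat \<Rightarrow> nat" where
  "key_exchanges A r =
     (if length A \<le> 1 then 0
      else (case partition_list A of (B, l, k) \<Rightarrow>
        if r \<le> l then k + key_exchanges (take l B) r
        else k + key_exchanges (drop l B) (r - l)))"
  by pat_completeness auto
termination
  by (relation "Wellfounded.measure (\<lambda>(A, r). length A)")
    (auto dest!: partition_list_bounds[rotated, OF sym])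

declare key_exchanges.simps [simp del]

text \<open>
  The law of \<open>Y\<^sub>n / n\<close>, where the list is a uniformly random arrangement of the \<open>n\<close> elements of \<open>S\<close>
  and the rank is uniform on \<open>{1..n}\<close> and independent of it.
\<close>

definition scaled_exchanges_law :: "'a::linorder set \<Rightarrow> real measure" where
  "scaled_exchanges_law S =
     distr (measure_pmf (pair_pmf (pmf_of_set (permutations_of_set S)) (pmf_of_set {1..card S})))
       borel (\<lambda>(A, r). real (key_exchanges A r) / real (card S))"

definition solves_fixed_point :: "real measure \<Rightarrow> bool" where
  "solves_fixed_point \<mu> \<longleftrightarrow>
     real_distribution \<mu> \<and>
     \<mu> = distr (\<mu> \<Otimes>\<^sub>M uniform_measure lborel {0..1}) borel
           (\<lambda>(x, u). sqrt u * x + sqrt u * (1 - sqrt u))"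

definition limit_law :: "real measure" where
  "limit_law = (THE \<mu>. solves_fixed_point \<mu>)"

text \<open>
  Values are taken in \<open>ennreal\<close> so that an infinite \<open>p\<close>-th moment yields \<open>\<infinity>\<close> instead of the
  default value \<open>0\<close> of the Bochner integral.
\<close>

definition Lp_norm :: "real \<Rightarrow> 'a measure \<Rightarrow> ('a \<Rightarrow> real) \<Rightarrow> ennreal" where
  "Lp_norm p M f =
     (let I = (\<integral>\<^sup>+ x. ennreal (\<bar>f x\<bar> powr p) \<partial>M)
      in if I = \<infinity> then \<infinity> else ennreal (enn2real I powr (1 / p)))"

text \<open>
  A pair of random variables on a common probability space enters only through its joint law,
  so the infimum is taken over the joint laws with the given marginals.
\<close>

definition couplings :: "real measure \<Rightarrow> real measure \<Rightarrow> (real \<times> real) measure set" where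
  "couplings \<mu> \<nu> =
     {\<gamma>. prob_space \<gamma> \<and> sets \<gamma> = sets (borel \<Otimes>\<^sub>M borel) \<and>
          distr \<gamma> borel fst = \<mu> \<and> distr \<gamma> borel snd = \<nu>}"

definition ell :: "real \<Rightarrow> real measure \<Rightarrow> real measure \<Rightarrow> ennreal" where
  "ell p \<mu> \<nu> = (INF \<gamma>\<in>couplings \<mu> \<nu>. Lp_norm p \<gamma> (\<lambda>(w, z). w - z))"

definition tau :: "real \<Rightarrow> real" where
  "tau p = (1 / 2 + Gamma (p / 2 + 1) / 2 powr (p / 2 + 1)) powr (1 / p)"

definition kappa :: "real \<Rightarrow> real" where
  "kappa p = (2 * p + 3) / (2 * p - 1) * (7 + tau p)"

end

theory Submission
  imports Defs
begin

text \<open>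
  The right sub-list of a partitioning step keeps the old pivot, its minimum, at a distinguished
  place, so sub-lists are not uniformly random. They are uniform among the arrangements with the
  minimum at a given position \<open>q\<close>, and all assertions are proved for every \<open>q\<close> simultaneously.

  The coupling follows the algorithm: given the list and the rank, the uniform variable of the fixed
  point equation is confined to a cell determined by the size of the sub-list containing the rank,
  and the perpetuity is continued along the recursive call. As the cells have the lengths of the
  probabilities of these sizes, the perpetuity averages to the limit law. The map \<open>step\<close> is such
  that the exchanges expected in a partitioning step agree with the corresponding part of \<open>n X\<close> up to
  \<open>1 + 21/10 (sqrt n - sqrt k)\<close>, where \<open>k\<close> is the new size, and the fluctuations of
  the exchanges are controlled by Hoeffding's bound for sampling without replacement. This gives, by
  induction on \<open>n\<close> and for \<open>|s| \<le> 4\<close>, the bound \<open>exp (s\<^sup>2 n / 8 + 69/10 |s| sqrt n)\<close> for the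
  exponential moment of \<open>Y - n X\<close>. Since \<open>|Y / n - X| \<le> 1\<close>, optimising over \<open>s\<close> turns it into an
  \<open>L\<^sup>p\<close> bound \<open>(69/10 + 2\<^sup>1\<^sup>/\<^sup>p sqrt (p / (4 e))) / sqrt n\<close>, and Stirling's lower bound for the Gamma
  function compares the constant with \<open>kappa p\<close>.
\<close>

section \<open>The partitioning procedure\<close>

text \<open>The induction closes because both terms of the exponent telescope. Given the first key,
  the exchanges of a step are a sampling count, whose centred exponential moment costs at most s^2 /
  8 per sampled point and, equally, per point left out; so a surviving size k can always be charged
  s^2 (n - k) / 8. The linear term does not close pathwise: the drift error contains a constant 1,
  which the decrease 69/10 (sqrt n - sqrt k) does not outweigh for k near n. It does so on average
  over k, which has probability 2 k / (n (n - 1)): for n >= 48 the mean of the exponential at s = 4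
  is below 1, and convexity covers smaller s. The range |s| <= 4 is enough because |Y / n - X| <= 1.
  For n < 48 the trivial bound n is at most 69/10 sqrt n, and 69/10 < 7 leaves room in the
  comparison with \<open>kappa p\<close>. The other obstacle is a minimum in front: all ranks but
  one then pass to a list shorter by a single key, which one uniform variable cannot imitate; hence
  the merging of two steps.\<close>

lemma key_at_exchange:
  assumes "1 \<le> i" "i < j" "j \<le> length A" "1 \<le> m"
  shows "key_at (exchange A i j) m =
           (if m = i then key_at A j else if m = j then key_at A i else key_at A m)"
proof -
  have "m - 1 = i - 1 \<longleftrightarrow> m = i" "m - 1 = j - 1 \<longleftrightarrow> m = j"
    "i - 1 < length A" "j - 1 < length A" "i \<noteq> j"
    using assms by linarith+
  then show ?thesis
    unfolding exchange_def key_at_def nth_list_update_eq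
    by (metis length_list_update nth_list_update_eq nth_list_update_neq)
qed

lemma mset_exchange:
  assumes "1 \<le> i" "i < j" "j \<le> length A"
  shows "mset (exchange A i j) = mset A"
proof -
  have "exchange A i j = A[j - 1 := A ! (i - 1), i - 1 := A ! (j - 1)]"
    using assms by (subst list_update_swap) (auto simp: exchange_def key_at_def)
  moreover have "i - 1 < length A" "j - 1 < length A"
    using assms by auto
  ultimately show ?thesis by (simp add: mset_swap)
qed

lemma scan_down_skips:
  "scan_down p A j < m \<Longrightarrow> m < j \<Longrightarrow> p < key_at A m"
  by (induction p A j rule: scan_down.induct) (auto split: if_splits simp: less_Suc_eq)

lemma scan_up_stops:
  assumes "i < m" "m \<le> length A" "p \<le> key_at A m"
  shows "scan_up p A i \<le> m \<and> p \<le> key_at A (scan_up p A i)"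
  using assms
proof (induction p A i rule: scan_up.induct)
  case (1 p A i)
  show ?case
  proof (cases "i \<ge> length A \<or> key_at A (i + 1) \<ge> p")
    case True
    then show ?thesis using 1(2-) scan_up.simps[of p A i] by auto
  next
    case False
    then have "i + 1 < m" using 1(2-) by (metis Suc_eq_plus1 Suc_lessI)
    then show ?thesis using 1 False scan_up.simps[of p A i] by auto
  qed
qed

lemma scan_up_skips:
  "i < m \<Longrightarrow> m < scan_up p A i \<Longrightarrow> key_at A m < p"
proof (induction p A i rule: scan_up.induct)
  case (1 p A i)
  show ?case
  proof (cases "i \<ge> length A \<or> key_at A (i + 1) \<ge> p")
    case True
    then show ?thesis using 1(2-) scan_up.simps[of p A i] by auto
  next
    case False
    then show ?thesis using 1 scan_up.simps[of p A i] by (cases "m = i + 1") auto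
  qed
qed

text \<open>Loop invariant after the first exchange. Place \<open>i\<close> is a sentinel for the
  downward scan and place \<open>j\<close> for the upward one; as no key in the gap equals the
  pivot, the scans cannot stop at the same place, so \<open>l\<close> separates the keys strictly
  below the pivot from the others. The number of exchanges can be read off the list before the call,
  since each exchange repairs one misplaced key among the first \<open>l\<close> places.\<close>

lemma partition_loop_result:
  assumes "1 \<le> i" "i < j" "j \<le> length A"
    and "\<And>m. 1 \<le> m \<Longrightarrow> m \<le> i \<Longrightarrow> key_at A m < p"
    and "\<And>m. j \<le> m \<Longrightarrow> m \<le> length A \<Longrightarrow> p \<le> key_at A m"
    and "\<And>m. i < m \<Longrightarrow> m < j \<Longrightarrow> key_at A m \<noteq> p"
    and "partition_loop p A i j = (B, l, k)"
  shows "mset B = mset A \<and> i \<le> l \<and> l < j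
    \<and> (\<forall>m. 1 \<le> m \<longrightarrow> m \<le> l \<longrightarrow> key_at B m < p)
    \<and> (\<forall>m. l < m \<longrightarrow> m \<le> length A \<longrightarrow> p \<le> key_at B m)
    \<and> k = card {m \<in> {1..l}. p \<le> key_at A m}"
  using assms
proof (induction p A i j arbitrary: B l k rule: partition_loop.induct)
  case (1 p A i j)
  note low = 1(5) and high = 1(6) and mid = 1(7)
  define j' i' where "j' = scan_down p A j" and "i' = scan_up p A i"
  have "key_at A i \<le> p" using low[of i] 1(2) by simp
  then have j': "i \<le> j'" "key_at A j' \<le> p" "j' < j"
    using scan_down_stops[of i j A p] scan_down_le[of p A j] 1(2,3) by (auto simp: j'_def)
  have i': "i < i'" "i' \<le> j" "p \<le> key_at A i'"
    using scan_up_stops[of i j A p] scan_up_gt[of i p A] 1(3,4) high[of j] by (auto simp: i'_def)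
  have j'_less: "key_at A j' < p"
    using j' mid[of j'] low[of i] 1(2) by (cases "j' = i") auto
  \<comment> \<open>A common stopping place would hold a key both below the pivot and not below
    it.\<close>
  have ne: "i' \<noteq> j'" using j'_less i'(3) by auto
  have up: "key_at A m < p" if "1 \<le> m" "m < i'" for m
    using that low[of m] scan_up_skips[of i m p A] by (cases "m \<le> i") (auto simp: i'_def)
  have down: "p \<le> key_at A m" if "j' < m" "m \<le> length A" for m
    using that high[of m] scan_down_skips[of p A j m] by (cases "j \<le> m") (auto simp: j'_def)
  show ?case
  proof (cases "i' < j'")
    case True
    obtain B' l' k' where r: "partition_loop p (exchange A i' j') i' j' = (B', l', k')"
      by (metis prod_cases3)
    have eq: "(B, l, k) = (B', l', k' + 1)"
      using 1(8) True r by (subst (asm) partition_loop.simps) (simp add: j'_def i'_def Let_def)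
    have b: "1 \<le> i'" "j' \<le> length A" using i' j' 1(2,4) by auto
    note key = key_at_exchange[OF b(1) True b(2)]
    have IH: "mset B' = mset (exchange A i' j') \<and> i' \<le> l' \<and> l' < j'
      \<and> (\<forall>m. 1 \<le> m \<longrightarrow> m \<le> l' \<longrightarrow> key_at B' m < p)
      \<and> (\<forall>m. l' < m \<longrightarrow> m \<le> length (exchange A i' j') \<longrightarrow> p \<le> key_at B' m)
      \<and> k' = card {m \<in> {1..l'}. p \<le> key_at (exchange A i' j') m}"
    proof (rule 1(1)[OF j'_def i'_def True _ _ _ _ _ _ r])
      show "1 \<le> i'" "i' < j'" "j' \<le> length (exchange A i' j')" using b True by auto
      show "key_at (exchange A i' j') m < p" if "1 \<le> m" "m \<le> i'" for m
        using that key[of m] j'_less up[of m] True by auto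
      show "p \<le> key_at (exchange A i' j') m" if "j' \<le> m" "m \<le> length (exchange A i' j')" for m
        using that key[of m] i' down[of m] True b by auto
      show "key_at (exchange A i' j') m \<noteq> p" if "i' < m" "m < j'" for m
        using that key[of m] mid[of m] b i' j' by auto
    qed
    \<comment> \<open>The exchange alters only the places \<open>i'\<close> and \<open>j'\<close>,
      and \<open>j'\<close> lies beyond \<open>l'\<close>; so it accounts for exactly the place
      \<open>i'\<close>.\<close>
    have "{m \<in> {1..l'}. p \<le> key_at A m}
        = insert i' {m \<in> {1..l'}. p \<le> key_at (exchange A i' j') m}"
    proof (intro set_eqI)
      fix x
      show "x \<in> {m \<in> {1..l'}. p \<le> key_at A m}
          \<longleftrightarrow> x \<in> insert i' {m \<in> {1..l'}. p \<le> key_at (exchange A i' j') m}"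
        using IH key[of x] b i' True by (auto split: if_splits)
    qed
    moreover have "i' \<notin> {m \<in> {1..l'}. p \<le> key_at (exchange A i' j') m}"
      using key[of i'] j'_less b by auto
    ultimately have "card {m \<in> {1..l'}. p \<le> key_at A m} = k' + 1"
      using IH by simp
    then show ?thesis
      using eq IH i' j' mset_exchange[OF b(1) True b(2)] by auto
  next
    case False
    then have eq: "(B, l, k) = (A, j', 0)"
      using 1(8) by (subst (asm) partition_loop.simps) (auto simp add: j'_def i'_def Let_def)
    have "{m \<in> {1..j'}. p \<le> key_at A m} = {}"
    proof -
      have "\<not> p \<le> key_at A m" if "m \<in> {1..j'}" for m
        using up[of m] that False ne by auto
      then show ?thesis by blast
    qed
    then have "0 = card {m \<in> {1..j'}. p \<le> key_at A m}" by (metis card.empty)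
    then show ?thesis using eq up down False ne j' by auto
  qed
qed

text \<open>A key below the pivot makes the first downward scan stop beyond place 1, so the first
  exchange carries the pivot into the right block, and from then on the loop invariant holds. In the
  count this exchange is represented by place 1, which holds the pivot itself.\<close>

lemma partition_list_result:
  assumes "length A \<ge> 2" "distinct A" "x \<in> set A" "x < A ! 0"
    and "partition_list A = (B, l, k)"
  shows "mset B = mset A \<and> (\<forall>m. 1 \<le> m \<longrightarrow> m \<le> l \<longrightarrow> key_at B m < A ! 0)
    \<and> (\<forall>m. l < m \<longrightarrow> m \<le> length A \<longrightarrow> A ! 0 \<le> key_at B m)
    \<and> k = card {m \<in> {1..l}. A ! 0 \<le> key_at A m}"
proof -
  let ?p = "key_at A 1" and ?n = "length A"
  have p: "?p = A ! 0" by (simp add: key_at_def)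
  define j' where "j' = scan_down ?p A (?n + 1)"
  have i': "scan_up ?p A 0 = 1"
    using assms(1) by (subst scan_up.simps) simp
  obtain y where y: "y < ?n" "A ! y = x" using assms(3) by (auto simp: in_set_conv_nth)
  then have y0: "y \<noteq> 0" using assms(4) by (metis less_irrefl)
  have "y + 1 \<le> j' \<and> key_at A j' \<le> ?p"
    unfolding j'_def using scan_down_stops[of "y + 1" "?n + 1" A ?p] y assms(4)
    by (auto simp: key_at_def)
  then have j': "1 < j'" "j' \<le> ?n" "key_at A j' \<le> ?p"
    using scan_down_le[of ?p A "?n + 1"] y0 by (auto simp: j'_def)
  have dist: "key_at A m \<noteq> ?p" if "1 < m" "m \<le> ?n" for m
  proof
    assume "key_at A m = ?p"
    moreover have "m - 1 < ?n" "0 < ?n" using that by linarith+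
    ultimately have "m - 1 = 0"
      using nth_eq_iff_index_eq[OF assms(2), of "m - 1" 0] by (simp add: key_at_def)
    then show False using that by simp
  qed
  obtain B' l' k' where r: "partition_loop ?p (exchange A 1 j') 1 j' = (B', l', k')"
    by (metis prod_cases3)
  have "partition_list A = (B', l', k' + 1)"
    unfolding partition_list_def
    by (subst partition_loop.simps) (use j' r i' in \<open>simp add: j'_def Let_def\<close>)
  then have eq: "B = B'" "l = l'" "k = k' + 1" using assms(5) by auto
  note key = key_at_exchange[OF order_refl j'(1,2)]
  have R: "mset B' = mset (exchange A 1 j') \<and> 1 \<le> l' \<and> l' < j'
      \<and> (\<forall>m. 1 \<le> m \<longrightarrow> m \<le> l' \<longrightarrow> key_at B' m < ?p)
      \<and> (\<forall>m. l' < m \<longrightarrow> m \<le> length (exchange A 1 j') \<longrightarrow> ?p \<le> key_at B' m)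
      \<and> k' = card {m \<in> {1..l'}. ?p \<le> key_at (exchange A 1 j') m}"
  proof (rule partition_loop_result[OF _ _ _ _ _ _ r])
    show "key_at (exchange A 1 j') m < ?p" if "1 \<le> m" "m \<le> 1" for m
      using that key[of m] j' dist[of j'] by (auto simp: less_le)
    show "?p \<le> key_at (exchange A 1 j') m" if "j' \<le> m" "m \<le> length (exchange A 1 j')" for m
      using that key[of m] j' scan_down_skips[of ?p A "?n + 1" m] by (auto simp: j'_def)
    show "key_at (exchange A 1 j') m \<noteq> ?p" if "1 < m" "m < j'" for m
      using that key[of m] dist[of m] j' by auto
  qed (use j' in auto)
  have "{m \<in> {1..l'}. ?p \<le> key_at A m} = insert 1 {m \<in> {1..l'}. ?p \<le> key_at (exchange A 1 j') m}"
  proof (intro set_eqI)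
    fix x
    show "x \<in> {m \<in> {1..l'}. ?p \<le> key_at A m}
        \<longleftrightarrow> x \<in> insert 1 {m \<in> {1..l'}. ?p \<le> key_at (exchange A 1 j') m}"
      using R key[of x] by (auto split: if_splits)
  qed
  moreover have "1 \<notin> {m \<in> {1..l'}. ?p \<le> key_at (exchange A 1 j') m}"
    using key[of 1] j' dist[of j'] by auto
  ultimately have "card {m \<in> {1..l'}. ?p \<le> key_at A m} = k' + 1"
    using R by simp
  then have card: "k' + 1 = card {m \<in> {1..l'}. ?p \<le> key_at A m}" by (rule sym)
  show ?thesis
    unfolding p[symmetric] eq
  proof (intro conjI)
    show "mset B' = mset A"
      by (rule trans[OF conjunct1[OF R] mset_exchange[OF order_refl j'(1,2)]])
    show "\<forall>m. 1 \<le> m \<longrightarrow> m \<le> l' \<longrightarrow> key_at B' m < ?p"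
      using R by (elim conjE)
    show "\<forall>m. l' < m \<longrightarrow> m \<le> length A \<longrightarrow> ?p \<le> key_at B' m"
      using R unfolding length_exchange by (elim conjE)
  qed (rule card)
qed

text \<open>The downward scan passes all larger keys and is stopped only by the pivot; both scans
  then stand at place 1.\<close>

lemma partition_list_min:
  assumes "length A \<ge> 2" "distinct A" "\<And>x. x \<in> set A \<Longrightarrow> A ! 0 \<le> x"
  shows "partition_list A = (A, 1, 0)"
proof -
  let ?p = "key_at A 1" and ?n = "length A"
  have p: "?p = A ! 0" by (simp add: key_at_def)
  have i': "scan_up ?p A 0 = 1"
    using assms(1) by (subst scan_up.simps) simp
  have j': "1 \<le> scan_down ?p A (?n + 1)" "scan_down ?p A (?n + 1) \<le> ?n"
    "key_at A (scan_down ?p A (?n + 1)) \<le> ?p"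
    using scan_down_stops[of 1 "?n + 1" A ?p] scan_down_le[of ?p A "?n + 1"] assms(1) by auto
  have sd: "scan_down ?p A (?n + 1) = 1"
  proof (rule ccontr)
    assume ne: "scan_down ?p A (?n + 1) \<noteq> 1"
    let ?m = "scan_down ?p A (?n + 1) - 1"
    have "?m < ?n" "?m \<noteq> 0" using j' ne by auto
    moreover have "A ! ?m \<le> A ! 0" using j' by (simp add: key_at_def)
    ultimately have "A ! ?m = A ! 0" using assms(3)[of "A ! ?m"] by auto
    moreover have "0 < ?n" using assms(1) by linarith
    ultimately have "?m = 0"
      using nth_eq_iff_index_eq[OF assms(2) \<open>?m < ?n\<close>] by blast
    then show False using \<open>?m \<noteq> 0\<close> by blast
  qed
  show ?thesis
    unfolding partition_list_def
    by (subst partition_loop.simps) (simp only: i' sd Let_def less_irrefl if_False)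
qed

text \<open>The scans look at keys only through comparisons with the pivot, so a relabelling that
  preserves these comparisons commutes with the whole step.\<close>

definition same_side :: "('a::linorder \<Rightarrow> 'a) \<Rightarrow> 'a \<Rightarrow> 'a set \<Rightarrow> bool" where
  "same_side f p S \<longleftrightarrow> (\<forall>x\<in>S. (f x \<le> p \<longleftrightarrow> x \<le> p) \<and> (p \<le> f x \<longleftrightarrow> p \<le> x))"

lemma key_at_map: "1 \<le> m \<Longrightarrow> m \<le> length A \<Longrightarrow> key_at (map f A) m = f (key_at A m)"
  by (auto simp: key_at_def)

lemma key_at_in_set: "1 \<le> m \<Longrightarrow> m \<le> length A \<Longrightarrow> key_at A m \<in> set A"
  by (auto simp: key_at_def)

lemma scan_down_map:
  "same_side f p (set A) \<Longrightarrow> j \<le> length A + 1 \<Longrightarrow> scan_down p (map f A) j = scan_down p A j"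
proof (induction j)
  case (Suc j)
  then show ?case
    by (cases "j = 0") (auto simp: same_side_def key_at_map key_at_in_set)
qed simp

lemma scan_up_map:
  "same_side f p (set A) \<Longrightarrow> scan_up p (map f A) i = scan_up p A i"
proof (induction p A i rule: scan_up.induct)
  case (1 p A i)
  show ?case
  proof (cases "i \<ge> length A \<or> key_at A (i + 1) \<ge> p")
    case True
    then show ?thesis
      using 1(2) key_at_map[of "i + 1" A f] key_at_in_set[of "i + 1" A]
        scan_up.simps[of p "map f A" i] scan_up.simps[of p A i]
      by (auto simp: same_side_def)
  next
    case False
    then show ?thesis
      using 1 key_at_map[of "i + 1" A f] key_at_in_set[of "i + 1" A]
        scan_up.simps[of p "map f A" i] scan_up.simps[of p A i]
      by (auto simp: same_side_def)
  qed
qed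

lemma exchange_map:
  assumes "1 \<le> i" "i < j" "j \<le> length A"
  shows "exchange (map f A) i j = map f (exchange A i j)"
  using assms by (simp add: exchange_def key_at_map map_update)

lemma partition_loop_map:
  assumes "same_side f p (set A)" "j \<le> length A + 1"
  shows "partition_loop p (map f A) i j = map_prod (map f) id (partition_loop p A i j)"
  using assms
proof (induction p A i j rule: partition_loop.induct)
  case (1 p A i j)
  define j' i' where "j' = scan_down p A j" and "i' = scan_up p A i"
  have m: "scan_down p (map f A) j = j'" "scan_up p (map f A) i = i'"
    using scan_down_map[of f p A j] scan_up_map[of f p A i] 1(2,3) by (auto simp: j'_def i'_def)
  have b: "j' \<le> length A" "1 \<le> i'"
    using scan_down_le[of p A j] 1(3) scan_up_gt[of i p A] by (auto simp: j'_def i'_def)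
  show ?case
  proof (cases "i' < j'")
    case True
    have "set (exchange A i' j') = set A"
      using mset_exchange[OF b(2) True b(1)] by (metis set_mset_mset)
    then have "partition_loop p (map f (exchange A i' j')) i' j'
        = map_prod (map f) id (partition_loop p (exchange A i' j') i' j')"
      using 1(1)[OF j'_def i'_def True] 1(2,3) b by (simp add: id_def)
    then show ?thesis
      unfolding partition_loop.simps[of p "map f A" i j] partition_loop.simps[of p A i j] m
        j'_def[symmetric] i'_def[symmetric] Let_def exchange_map[OF b(2) True b(1)]
      using True by (simp split: prod.splits)
  next
    case False
    then show ?thesis
      unfolding partition_loop.simps[of p "map f A" i j] partition_loop.simps[of p A i j] m
        j'_def[symmetric] i'_def[symmetric] Let_def by simp
  qed
qed

lemma partition_list_map:
  assumes "same_side f (A ! 0) (set A)" "f (A ! 0) = A ! 0" "A \<noteq> []"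
  shows "partition_list (map f A) = map_prod (map f) id (partition_list A)"
proof -
  have "key_at (map f A) 1 = A ! 0" "key_at A 1 = A ! 0"
    using assms by (auto simp: key_at_def)
  then show ?thesis
    using partition_loop_map[OF assms(1), of "length A + 1" 0] by (simp add: partition_list_def)
qed

section \<open>One partitioning step: its exchanges and its two sub-lists\<close>

definition cut :: "'a::linorder list \<Rightarrow> nat" where
  "cut A = fst (snd (partition_list A))"

definition swaps :: "'a::linorder list \<Rightarrow> nat" where
  "swaps A = snd (snd (partition_list A))"

definition left_part :: "'a::linorder list \<Rightarrow> 'a list" where
  "left_part A = take (cut A) (fst (partition_list A))"

definition right_part :: "'a::linorder list \<Rightarrow> 'a list" where
  "right_part A = drop (cut A) (fst (partition_list A))"

lemma partition_list_eq: "partition_list A = (fst (partition_list A), cut A, swaps A)"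
  by (simp add: cut_def swaps_def)

lemma key_exchanges_rec:
  assumes "length A \<ge> 2"
  shows "key_exchanges A r = swaps A +
    (if r \<le> cut A then key_exchanges (left_part A) r else key_exchanges (right_part A) (r - cut A))"
  using assms by (subst key_exchanges.simps)
    (simp add: cut_def swaps_def left_part_def right_part_def split: prod.split)

lemma cut_bounds:
  assumes "length A \<ge> 2"
  shows "1 \<le> cut A" "cut A < length A" "length (left_part A) = cut A"
    "length (right_part A) = length A - cut A"
  using partition_list_bounds[OF assms partition_list_eq[of A]]
  by (auto simp: left_part_def right_part_def)

text \<open>All that the probabilistic part uses of the procedure for a non-minimal pivot: the sizes
  depend only on the rank of the first key, the pivot becomes the minimum of the right part, and the
  exchanges depend only on which keys occupy the first \<open>cut A\<close> places. Places count
  from 0 in the last formula, and place 0, the pivot's own, is among those counted.\<close>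

lemma parts_of_pivot:
  assumes "distinct A" "x \<in> set A" "x < A ! 0"
  shows "set (left_part A) = {y \<in> set A. y < A ! 0}" "distinct (left_part A)"
    "set (right_part A) = {y \<in> set A. A ! 0 \<le> y}" "distinct (right_part A)"
    "cut A = card {y \<in> set A. y < A ! 0}"
    "length A - cut A = card {y \<in> set A. A ! 0 \<le> y}"
    "swaps A = card {i \<in> {..<cut A}. A ! 0 \<le> A ! i}"
proof -
  have "length A \<ge> 2"
  proof (rule ccontr)
    assume "\<not> length A \<ge> 2"
    then have "A = [] \<or> (\<exists>y. A = [y])"
      by (cases A; cases "tl A") auto
    then show False using assms by auto
  qed
  note len = this
  let ?B = "fst (partition_list A)" and ?l = "cut A"
  note R = partition_list_result[OF len assms partition_list_eq]
  note bounds = partition_list_bounds[OF len partition_list_eq]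
  have msetB: "mset ?B = mset A" using R by blast
  then have dB: "distinct ?B" "set ?B = set A" "length ?B = length A"
    using assms(1) by (metis mset_eq_imp_distinct_iff, metis mset_eq_setD, metis mset_eq_length)
  show dl: "distinct (left_part A)" and dr: "distinct (right_part A)"
    using dB by (auto simp: left_part_def right_part_def)
  have less: "y < A ! 0" if "y \<in> set (left_part A)" for y
  proof -
    obtain i where i: "i < length (left_part A)" "y = left_part A ! i"
      using \<open>y \<in> set (left_part A)\<close> by (metis in_set_conv_nth)
    then have "i < ?l" "y = key_at ?B (Suc i)"
      using cut_bounds[OF len] by (auto simp: left_part_def key_at_def)
    then show ?thesis using R by auto
  qed
  have ge: "A ! 0 \<le> y" if "y \<in> set (right_part A)" for y
  proof -
    obtain i where i: "i < length (right_part A)" "y = right_part A ! i"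
      using \<open>y \<in> set (right_part A)\<close> by (metis in_set_conv_nth)
    then have "?l < Suc (?l + i)" "Suc (?l + i) \<le> length A" "y = key_at ?B (Suc (?l + i))"
      using cut_bounds[OF len] dB(3) by (auto simp: right_part_def key_at_def)
    then show ?thesis using R by blast
  qed
  have "set (left_part A) \<union> set (right_part A) = set A"
    unfolding left_part_def right_part_def using dB(2) by (metis append_take_drop_id set_append)
  then show L: "set (left_part A) = {y \<in> set A. y < A ! 0}"
    and R': "set (right_part A) = {y \<in> set A. A ! 0 \<le> y}"
    using less ge by fastforce+
  show "cut A = card {y \<in> set A. y < A ! 0}"
    using distinct_card[OF dl] cut_bounds(3)[OF len] L by simp
  show "length A - cut A = card {y \<in> set A. A ! 0 \<le> y}"
    using distinct_card[OF dr] cut_bounds(4)[OF len] R' by simp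
  have "swaps A = card {m \<in> {1..?l}. A ! 0 \<le> key_at A m}" using R by blast
  also have "{m \<in> {1..?l}. A ! 0 \<le> key_at A m} = Suc ` {i \<in> {..<?l}. A ! 0 \<le> A ! i}"
  proof (intro set_eqI iffI)
    fix m assume "m \<in> {m \<in> {1..?l}. A ! 0 \<le> key_at A m}"
    then show "m \<in> Suc ` {i \<in> {..<?l}. A ! 0 \<le> A ! i}"
      by (intro image_eqI[of _ _ "m - 1"]) (auto simp: key_at_def)
  qed (auto simp: key_at_def)
  also have "card \<dots> = card {i \<in> {..<?l}. A ! 0 \<le> A ! i}"
    by (rule card_image) simp
  finally show "swaps A = card {i \<in> {..<?l}. A ! 0 \<le> A ! i}" .
qed

lemma parts_of_min:
  assumes "length A \<ge> 2" "distinct A" "\<And>x. x \<in> set A \<Longrightarrow> A ! 0 \<le> x"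
  shows "cut A = 1" "swaps A = 0" "length (left_part A) = 1" "right_part A = tl A"
  using partition_list_min[OF assms] cut_bounds[OF assms(1)]
  by (auto simp: cut_def swaps_def right_part_def drop_Suc)

lemma parts_map:
  assumes "same_side f (A ! 0) (set A)" "f (A ! 0) = A ! 0" "A \<noteq> []"
  shows "cut (map f A) = cut A" "swaps (map f A) = swaps A"
    "left_part (map f A) = map f (left_part A)" "right_part (map f A) = map f (right_part A)"
  using partition_list_map[OF assms]
  by (auto simp: cut_def swaps_def left_part_def right_part_def take_map drop_map)

text \<open>Each exchange belongs to a place of the left block that holds a key not below the pivot;
  counting the places gives the first bound, counting the keys the second.\<close>

lemma swaps_le:
  assumes "length A \<ge> 2" "distinct A"
  shows "swaps A \<le> cut A" "swaps A \<le> length A - cut A"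
proof -
  have "swaps A \<le> cut A \<and> swaps A \<le> length A - cut A"
  proof (cases "\<exists>x\<in>set A. x < A ! 0")
    case True
    then obtain x where x: "x \<in> set A" "x < A ! 0" by blast
    note P = parts_of_pivot[OF assms(2) x]
    have "swaps A \<le> card {..<cut A}"
      unfolding P(7) by (intro card_mono) auto
    moreover have "swaps A \<le> card {y \<in> set A. A ! 0 \<le> y}"
      unfolding P(7)
    proof (rule card_inj_on_le[of "\<lambda>i. A ! i"])
      show "inj_on (\<lambda>i. A ! i) {i \<in> {..<cut A}. A ! 0 \<le> A ! i}"
        using cut_bounds(2)[OF assms(1)] by (intro inj_on_nth[OF assms(2)]) auto
      show "(\<lambda>i. A ! i) ` {i \<in> {..<cut A}. A ! 0 \<le> A ! i} \<subseteq> {y \<in> set A. A ! 0 \<le> y}"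
        using cut_bounds(2)[OF assms(1)] by auto
    qed simp
    ultimately show ?thesis using P(6) by simp
  next
    case False
    then show ?thesis using parts_of_min(2)[OF assms] by (simp add: not_less)
  qed
  then show "swaps A \<le> cut A" "swaps A \<le> length A - cut A" by auto
qed

lemma distinct_parts:
  assumes "length A \<ge> 2" "distinct A"
  shows "distinct (left_part A)" "distinct (right_part A)"
proof -
  have "distinct (left_part A) \<and> distinct (right_part A)"
  proof (cases "\<exists>x\<in>set A. x < A ! 0")
    case True
    then show ?thesis using parts_of_pivot(2,4)[OF assms(2)] by blast
  next
    case False
    then have "\<And>x. x \<in> set A \<Longrightarrow> A ! 0 \<le> x" by (simp add: not_less)
    note P = parts_of_min[OF assms this]
    show ?thesis using P assms(2) by (metis card_distinct distinct_tl length_0_conv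
        length_Suc_conv One_nat_def distinct_singleton)
  qed
  then show "distinct (left_part A)" "distinct (right_part A)" by auto
qed

text \<open>The exchanges of a step are at most the size of the discarded part, so the total
  telescopes to the length.\<close>

lemma key_exchanges_le: "distinct A \<Longrightarrow> key_exchanges A r \<le> length A"
proof (induction "length A" arbitrary: A r rule: less_induct)
  case less
  show ?case
  proof (cases "length A \<ge> 2")
    case True
    note b = cut_bounds[OF True] and s = swaps_le[OF True less.prems]
      and d = distinct_parts[OF True less.prems]
    have "key_exchanges (left_part A) r \<le> cut A"
      "key_exchanges (right_part A) (r - cut A) \<le> length A - cut A"
      using less.hyps[OF _ d(1), of r] less.hyps[OF _ d(2), of "r - cut A"] b by auto
    then show ?thesis
      using s b by (auto simp: key_exchanges_rec[OF True])
  next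
    case False
    then show ?thesis by (subst key_exchanges.simps) simp
  qed
qed

section \<open>Random arrangements and concentration of one step\<close>

text \<open>The permutations of the other keys act simply transitively on the lists with
  \<open>m\<close> at place \<open>q\<close>; \<open>B\<close> is the base point.\<close>

lemma bij_betw_map_permutes:
  assumes "finite S" "m \<in> S" "B \<in> permutations_of_set S" "q < card S" "B ! q = m"
  shows "bij_betw (\<lambda>\<sigma>. map \<sigma> B) {\<sigma>. \<sigma> permutes (S - {m})}
           {A \<in> permutations_of_set S. A ! q = m}"
proof (rule bij_betw_imageI)
  have B: "set B = S" "distinct B" "length B = card S"
    using assms(3) permutations_of_setD distinct_card by fastforce+
  show "inj_on (\<lambda>\<sigma>. map \<sigma> B) {\<sigma>. \<sigma> permutes (S - {m})}"
  proof (intro inj_onI ext)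
    fix \<sigma> \<tau> x
    assume "\<sigma> \<in> {\<sigma>. \<sigma> permutes (S - {m})}" "\<tau> \<in> {\<sigma>. \<sigma> permutes (S - {m})}"
      and "map \<sigma> B = map \<tau> B"
    then show "\<sigma> x = \<tau> x"
      using B(1) by (cases "x \<in> S") (auto simp: permutes_def)
  qed
  show "(\<lambda>\<sigma>. map \<sigma> B) ` {\<sigma>. \<sigma> permutes (S - {m})} = {A \<in> permutations_of_set S. A ! q = m}"
  proof (intro subset_antisym subsetI)
    fix A assume "A \<in> (\<lambda>\<sigma>. map \<sigma> B) ` {\<sigma>. \<sigma> permutes (S - {m})}"
    then obtain \<sigma> where \<sigma>: "\<sigma> permutes (S - {m})" "A = map \<sigma> B" by blast
    then have "\<sigma> permutes S" using permutes_subset[OF \<sigma>(1)] by blast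
    then have "set A = S" "distinct A"
      using \<sigma>(2) B by (auto simp: permutes_image distinct_map permutes_inj_on)
    moreover have "A ! q = m"
      using \<sigma> assms(4,5) B(3) by (simp add: permutes_def)
    ultimately show "A \<in> {A \<in> permutations_of_set S. A ! q = m}"
      by (simp add: permutations_of_setI)
  next
    fix A assume "A \<in> {A \<in> permutations_of_set S. A ! q = m}"
    then have A: "set A = S" "distinct A" "length A = card S" "A ! q = m"
      using permutations_of_setD distinct_card by fastforce+
    have bB: "bij_betw (\<lambda>i. B ! i) {..<card S} S" and bA: "bij_betw (\<lambda>i. A ! i) {..<card S} S"
      using A B bij_betw_nth by (metis lessThan_atLeast0)+
    define g where "g = inv_into {..<card S} (\<lambda>i. B ! i)"
    have g: "g (B ! i) = i" if "i < card S" for i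
      unfolding g_def using that bB by (simp add: bij_betw_def inv_into_f_f)
    define \<sigma> where "\<sigma> = (\<lambda>x. if x \<in> S then A ! g x else x)"
    have \<sigma>B: "\<sigma> (B ! i) = A ! i" if "i < card S" for i
      using that g B by (auto simp: \<sigma>_def)
    have "bij_betw ((\<lambda>i. A ! i) \<circ> g) S S"
      unfolding g_def by (rule bij_betw_trans[OF bij_betw_inv_into[OF bB] bA])
    then have "bij_betw \<sigma> S S"
      by (rule bij_betw_cong[THEN iffD1, rotated]) (simp add: \<sigma>_def)
    then have "\<sigma> permutes S"
      by (rule bij_imp_permutes) (simp add: \<sigma>_def)
    then have "\<sigma> permutes (S - {m})"
    proof (rule permutes_superset)
      show "\<sigma> x = x" if "x \<in> S - (S - {m})" for x
        using that \<sigma>B[OF assms(4)] A(4) assms(5) by auto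
    qed
    moreover have "A = map \<sigma> B"
      using \<sigma>B A(3) B(3) by (intro nth_equalityI) auto
    ultimately show "A \<in> (\<lambda>\<sigma>. map \<sigma> B) ` {\<sigma>. \<sigma> permutes (S - {m})}" by blast
  qed
qed

text \<open>For finite nonempty \<open>S\<close> these sets, over \<open>q < card S\<close>,
  partition the permutations of \<open>S\<close>; the uniform input is therefore a mixture of them.
  Places count from 0.\<close>

definition arrangements :: "'a::linorder set \<Rightarrow> nat \<Rightarrow> 'a list set" where
  "arrangements S q = {A \<in> permutations_of_set S. A ! q = Min S}"

lemma arrangements_nonempty:
  assumes "finite S" "q < card S"
  shows "arrangements S q \<noteq> {}"
proof -
  obtain B where B: "set B = S" "distinct B"
    using finite_distinct_list[OF assms(1)] by blast
  have S: "S \<noteq> {}" using assms(2) by auto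
  then obtain i where i: "i < length B" "B ! i = Min S"
    using B(1) Min_in[OF assms(1)] by (metis in_set_conv_nth)
  have len: "length B = card S" using B distinct_card[of B] by simp
  have "map (Transposition.transpose (B ! i) (B ! q)) B \<in> arrangements S q"
  proof -
    have p: "Transposition.transpose (B ! i) (B ! q) permutes S"
      using B i assms(2) len Min_in[OF assms(1) S] by (intro permutes_swap_id) auto
    then show ?thesis
      using B i assms(2) len
      by (auto simp: arrangements_def permutes_image distinct_map permutes_inj_on
          intro!: permutations_of_setI)
  qed
  then show ?thesis by blast
qed

lemma card_arrangements:
  assumes "finite S" "q < card S"
  shows "card (arrangements S q) = fact (card S - 1)"
proof -
  obtain B where "B \<in> arrangements S q" using arrangements_nonempty[OF assms] by blast
  moreover have "S \<noteq> {}" using assms(2) by auto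
  ultimately have "bij_betw (\<lambda>\<sigma>. map \<sigma> B) {\<sigma>. \<sigma> permutes (S - {Min S})} (arrangements S q)"
    unfolding arrangements_def
    using assms by (intro bij_betw_map_permutes) (auto simp: arrangements_def)
  then have "card (arrangements S q) = card {\<sigma>. \<sigma> permutes (S - {Min S})}"
    by (simp add: bij_betw_same_card)
  also have "\<dots> = fact (card (S - {Min S}))"
    by (rule card_permutations) (use assms in auto)
  finally show ?thesis using assms \<open>S \<noteq> {}\<close> by simp
qed

lemma bij_betw_map_invariant:
  assumes "finite \<A>" "\<A> \<subseteq> permutations_of_set S" "\<sigma> permutes V"
    and "\<And>A. A \<in> \<A> \<Longrightarrow> map \<sigma> A \<in> \<A>"
  shows "bij_betw (map \<sigma>) \<A> \<A>"
proof -
  have "inj (map \<sigma>)" using permutes_inj[OF assms(3)] by simp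
  then have inj: "inj_on (map \<sigma>) \<A>" by (rule inj_on_subset) simp
  then show ?thesis
    using assms(1,4) by (intro bij_betw_imageI endo_inj_surj) auto
qed

text \<open>
  Averaging over the permutations of the values of a part of the list turns that part into a
  uniformly random arrangement, whose minimum however keeps its position.
\<close>

lemma sum_over_part:
  fixes restr :: "'a::linorder list \<Rightarrow> 'a list" and F w :: "'a::linorder list \<Rightarrow> 'b::comm_semiring_1"
  assumes "finite \<A>" "\<A> \<subseteq> permutations_of_set S" "finite P" "P \<noteq> {}"
    and closed: "\<And>\<sigma> A. \<sigma> permutes (P - {Min P}) \<Longrightarrow> A \<in> \<A> \<Longrightarrow> map \<sigma> A \<in> \<A>"
    and part: "\<And>\<sigma> A. \<sigma> permutes (P - {Min P}) \<Longrightarrow> A \<in> \<A> \<Longrightarrow> restr (map \<sigma> A) = map \<sigma> (restr A)"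
    and weight: "\<And>\<sigma> A. \<sigma> permutes (P - {Min P}) \<Longrightarrow> A \<in> \<A> \<Longrightarrow> w (map \<sigma> A) = w A"
    and perm: "\<And>A. A \<in> \<A> \<Longrightarrow> restr A \<in> permutations_of_set P"
  obtains pos where "\<And>A. A \<in> \<A> \<Longrightarrow> pos A < card P"
    and "of_nat (fact (card P - 1)) * (\<Sum>A\<in>\<A>. w A * F (restr A))
        = (\<Sum>A\<in>\<A>. w A * (\<Sum>B\<in>arrangements P (pos A). F B))"
proof -
  let ?G = "{\<sigma>. \<sigma> permutes (P - {Min P})}"
  have ex: "\<exists>q < card P. restr A ! q = Min P" if "A \<in> \<A>" for A
  proof -
    have "set (restr A) = P" "distinct (restr A)"
      using perm[OF that] by (auto dest: permutations_of_setD)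
    moreover have "Min P \<in> P" using assms(3,4) by simp
    ultimately show ?thesis by (metis distinct_card in_set_conv_nth)
  qed
  \<comment> \<open>The place of the minimum inside the part may vary with \<open>A\<close>, which
    is why estimates for all places are needed at once.\<close>
  then obtain pos where pos: "\<And>A. A \<in> \<A> \<Longrightarrow> pos A < card P \<and> restr A ! pos A = Min P"
    by metis
  have cardG: "card ?G = fact (card P - 1)"
    using assms(3,4) by (subst card_permutations[of _ "card P - 1"]) auto
  have "of_nat (fact (card P - 1)) * (\<Sum>A\<in>\<A>. w A * F (restr A))
      = (\<Sum>\<sigma>\<in>?G. \<Sum>A\<in>\<A>. w A * F (restr A))"
    by (simp add: cardG)
  also have "\<dots> = (\<Sum>\<sigma>\<in>?G. \<Sum>A\<in>\<A>. w (map \<sigma> A) * F (restr (map \<sigma> A)))"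
  proof (rule sum.cong[OF refl])
    fix \<sigma> assume "\<sigma> \<in> ?G"
    then have "bij_betw (map \<sigma>) \<A> \<A>"
      using closed by (intro bij_betw_map_invariant[OF assms(1,2)]) auto
    from sum.reindex_bij_betw[OF this, of "\<lambda>A. w A * F (restr A)"]
    show "(\<Sum>A\<in>\<A>. w A * F (restr A)) = (\<Sum>A\<in>\<A>. w (map \<sigma> A) * F (restr (map \<sigma> A)))" by simp
  qed
  also have "\<dots> = (\<Sum>A\<in>\<A>. \<Sum>\<sigma>\<in>?G. w A * F (map \<sigma> (restr A)))"
    by (subst sum.swap) (intro sum.cong refl, simp add: weight part)
  also have "\<dots> = (\<Sum>A\<in>\<A>. w A * (\<Sum>B\<in>arrangements P (pos A). F B))"
  proof (rule sum.cong[OF refl])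
    fix A assume A: "A \<in> \<A>"
    have "bij_betw (\<lambda>\<sigma>. map \<sigma> (restr A)) ?G (arrangements P (pos A))"
      unfolding arrangements_def using pos[OF A] perm[OF A] assms(3,4)
      by (intro bij_betw_map_permutes) auto
    from sum.reindex_bij_betw[OF this, of F]
    show "(\<Sum>\<sigma>\<in>?G. w A * F (map \<sigma> (restr A))) = w A * (\<Sum>B\<in>arrangements P (pos A). F B)"
      by (simp add: sum_distrib_left[symmetric])
  qed
  finally show ?thesis using that pos by blast
qed

text \<open>Hoeffding's lemma for a centred Bernoulli variable with parameter \<open>p\<close>.
  Negative \<open>h\<close> is reduced to positive \<open>h\<close> by interchanging the two values,
  that is, \<open>p\<close> and \<open>1 - p\<close>.\<close>

lemma two_point_mgf:
  fixes h p :: real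
  assumes "0 \<le> p" "p \<le> 1"
  shows "p * exp (h * (1 - p)) + (1 - p) * exp (- h * p) \<le> exp (h\<^sup>2 / 8)"
proof -
  have pos: "p * exp (h * (1 - p)) + (1 - p) * exp (- h * p) \<le> exp (h\<^sup>2 / 8)"
    if "0 \<le> h" "0 \<le> p" "p \<le> 1" for h p :: real
  proof -
    have ge: "0 < 1 + p * (exp h - 1)"
      using that by (intro add_pos_nonneg) auto
    have "p * exp (h * (1 - p)) + (1 - p) * exp (- h * p) = exp (- h * p) * (1 + p * (exp h - 1))"
      by (simp add: algebra_simps exp_add[symmetric] exp_diff exp_minus field_simps)
    also have "\<dots> = exp (- h * p + ln (1 + p * (exp h - 1)))"
      unfolding exp_add using ge by simp
    also have "\<dots> \<le> exp (h\<^sup>2 / 8)"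
      using Hoeffdings_lemma_aux[OF that(1,2)] by simp
    finally show ?thesis .
  qed
  show ?thesis
  proof (cases "0 \<le> h")
    case False
    then show ?thesis using pos[of "- h" "1 - p"] assms by (simp add: algebra_simps)
  qed (use pos assms in auto)
qed

text \<open>Hoeffding's bound for sampling without replacement: expose the image of one point at a time.\<close>

lemma permutation_count_mgf:
  fixes s :: real
  assumes "finite V" "D \<subseteq> V" "B \<subseteq> V"
  shows "(\<Sum>\<sigma> | \<sigma> permutes V.
      exp (s * (real (card {x \<in> D. \<sigma> x \<in> B}) - real (card D) * real (card B) / real (card V))))
    \<le> fact (card V) * exp (s\<^sup>2 * real (card D) / 8)"
proof -
  have "finite D" using assms finite_subset by blast
  then show ?thesis
    using assms
  proof (induction D arbitrary: V B rule: finite_induct)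
    case empty
    then show ?case by (simp add: card_permutations)
  next
    case (insert a D)
    define V0 N K d where "V0 = V - {a}" and "N = real (card V)" and "K = real (card B)"
      and "d = real (card D)"
    have V: "V = insert a V0" "a \<notin> V0" "finite V0" and DV: "D \<subseteq> V0" "a \<in> V"
      using insert by (auto simp: V0_def)
    have N: "N = real (card V0) + 1" "N \<ge> 1" using V by (auto simp: N_def)
    have KN: "K \<le> N" "0 \<le> K" using insert.prems by (auto simp: K_def N_def card_mono)
    have dN: "d \<le> N - 1" "0 \<le> d"
      using card_mono[OF V(3) DV(1)] N by (auto simp: d_def)
    \<comment> \<open>Once the image of \<open>a\<close> is known, the other \<open>d\<close> points
      hit \<open>B\<close> on average d (K - o) / (N - 1) times, where o is 1 if \<open>a\<close>
      was sent into \<open>B\<close> and 0 otherwise. This partly compensates the revealed hit: the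
      martingale difference is \<rho> (o - K / N), and 0 \<le> \<rho> \<le> 1 keeps its cost at s^2
      / 8.\<close>
    define \<rho> where "\<rho> = 1 - d / (N - 1)"
    have \<rho>: "0 \<le> \<rho>" "\<rho> \<le> 1"
      using dN N by (auto simp: \<rho>_def divide_le_eq_1 divide_nonneg_nonneg)
    let ?f = "\<lambda>V D B \<sigma>. exp (s * (real (card {x \<in> D. \<sigma> x \<in> B})
        - real (card D) * real (card B) / real (card V)))"
    have inner: "(\<Sum>\<sigma> | \<sigma> permutes V0. ?f V (insert a D) B (Transposition.transpose a b \<circ> \<sigma>))
        \<le> exp (s * \<rho> * (of_bool (b \<in> B) - K / N)) * (fact (card V0) * exp (s\<^sup>2 * d / 8))"
      if b: "b \<in> V" for b
    proof -
      \<comment> \<open>With \<open>a\<close> sent to \<open>b\<close>, the remaining points land in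
        \<open>B\<close> exactly if \<open>\<sigma>\<close> sends them into \<open>B'\<close>, a set
        of size \<open>K\<close> or \<open>K - 1\<close>.\<close>
      define B' where "B' = {y \<in> V0. Transposition.transpose a b y \<in> B}"
      have tV: "Transposition.transpose a b permutes V" using b DV by (intro permutes_swap_id) auto
      have "{y \<in> V. Transposition.transpose a b y \<in> B} = Transposition.transpose a b ` B"
      proof (intro set_eqI iffI)
        fix y assume "y \<in> {y \<in> V. Transposition.transpose a b y \<in> B}"
        then show "y \<in> Transposition.transpose a b ` B"
          by (intro image_eqI[of _ _ "Transposition.transpose a b y"]) auto
      qed (use insert.prems tV in \<open>auto simp: permutes_in_image\<close>)
      then have "card {y \<in> V. Transposition.transpose a b y \<in> B} = card B"
        by (simp add: card_image)
      moreover have "{y \<in> V. Transposition.transpose a b y \<in> B} = B' \<union> (if b \<in> B then {a} else {})"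
        using V DV by (auto simp: B'_def)
      moreover have "finite B'" "a \<notin> B'" using V by (auto simp: B'_def)
      ultimately have cardB': "real (card B') = K - of_bool (b \<in> B)"
        by (auto simp: K_def)
      have cnt: "real (card {x \<in> insert a D. (Transposition.transpose a b \<circ> \<sigma>) x \<in> B})
          = of_bool (b \<in> B) + real (card {x \<in> D. \<sigma> x \<in> B'})" if \<sigma>: "\<sigma> permutes V0" for \<sigma>
      proof -
        have "\<sigma> a = a" using \<sigma> V by (simp add: permutes_def)
        moreover have "\<sigma> x \<in> V0" if "x \<in> D" for x
          using that DV \<sigma> by (auto simp: permutes_in_image)
        ultimately have "{x \<in> insert a D. (Transposition.transpose a b \<circ> \<sigma>) x \<in> B}
            = {x \<in> D. \<sigma> x \<in> B'} \<union> (if b \<in> B then {a} else {})"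
          using insert.hyps by (auto simp: B'_def)
        then show ?thesis using insert.hyps by simp
      qed
      have expo: "of_bool (b \<in> B) + c - real (card (insert a D)) * real (card B) / real (card V)
          = \<rho> * (of_bool (b \<in> B) - K / N) + (c - d * real (card B') / real (card V0))" for c
      proof -
        have c: "real (card (insert a D)) = d + 1" "real (card B) = K" "real (card V) = N"
          "real (card V0) = N - 1"
          using insert.hyps N by (auto simp: d_def K_def N_def)
        show ?thesis
        proof (cases "N = 1")
          \<comment> \<open>Division by \<open>N - 1 = 0\<close> yields 0 here, and
            \<open>d = 0\<close>, so the identity survives.\<close>
          case True
          then have "d = 0" using dN by simp
          then show ?thesis unfolding c cardB' \<rho>_def using True by simp
        next
          case False
          then have nz: "N - 1 \<noteq> 0" "N \<noteq> 0" using N by auto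
          define t where "t = d / (N - 1)"
          have d: "d = t * (N - 1)" using nz by (simp add: t_def)
          have e1: "o1 + c - (t * (N - 1) + 1) * K / N
              = (1 - t) * (o1 - K / N) + (c - t * (K - o1))" for o1
            using nz by (simp add: field_simps)
          have e2: "d * (K - o1) / (N - 1) = t * (K - o1)" for o1 by (simp add: t_def)
          show ?thesis unfolding c cardB' \<rho>_def t_def[symmetric] e2 e1[symmetric] d[symmetric] ..
        qed
      qed
      have "(\<Sum>\<sigma> | \<sigma> permutes V0. ?f V (insert a D) B (Transposition.transpose a b \<circ> \<sigma>))
          = (\<Sum>\<sigma> | \<sigma> permutes V0. exp (s * \<rho> * (of_bool (b \<in> B) - K / N)) * ?f V0 D B' \<sigma>)"
      proof (rule sum.cong[OF refl])
        fix \<sigma> assume "\<sigma> \<in> {\<sigma>. \<sigma> permutes V0}"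
        then have \<sigma>: "\<sigma> permutes V0" by simp
        show "?f V (insert a D) B (Transposition.transpose a b \<circ> \<sigma>)
            = exp (s * \<rho> * (of_bool (b \<in> B) - K / N)) * ?f V0 D B' \<sigma>"
          unfolding cnt[OF \<sigma>] expo exp_add[symmetric] d_def by (simp add: algebra_simps)
      qed
      also have "\<dots> = exp (s * \<rho> * (of_bool (b \<in> B) - K / N)) * (\<Sum>\<sigma> | \<sigma> permutes V0. ?f V0 D B' \<sigma>)"
        by (simp add: sum_distrib_left)
      also have "\<dots> \<le> exp (s * \<rho> * (of_bool (b \<in> B) - K / N)) * (fact (card V0) * exp (s\<^sup>2 * d / 8))"
        unfolding d_def by (intro mult_left_mono insert.IH) (use V DV in \<open>auto simp: B'_def\<close>)
      finally show ?thesis .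
    qed
    have "(\<Sum>\<sigma> | \<sigma> permutes V. ?f V (insert a D) B \<sigma>)
        = (\<Sum>b\<in>V. \<Sum>\<sigma> | \<sigma> permutes V0. ?f V (insert a D) B (Transposition.transpose a b \<circ> \<sigma>))"
      using sum_over_permutations_insert[OF V(3,2), of "?f V (insert a D) B"] V(1) by simp
    also have "\<dots> \<le> (\<Sum>b\<in>V. exp (s * \<rho> * (of_bool (b \<in> B) - K / N)) * (fact (card V0) * exp (s\<^sup>2 * d / 8)))"
      by (rule sum_mono[OF inner])
    also have "\<dots> = (\<Sum>b\<in>V. exp (s * \<rho> * (of_bool (b \<in> B) - K / N))) * (fact (card V0) * exp (s\<^sup>2 * d / 8))"
      by (simp add: sum_distrib_right)
    also have "(\<Sum>b\<in>V. exp (s * \<rho> * (of_bool (b \<in> B) - K / N)))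
        = N * (K / N * exp (s * \<rho> * (1 - K / N)) + (1 - K / N) * exp (- (s * \<rho>) * (K / N)))"
    proof -
      have "(\<Sum>b\<in>V. exp (s * \<rho> * (of_bool (b \<in> B) - K / N)))
          = (\<Sum>b\<in>B. exp (s * \<rho> * (of_bool (b \<in> B) - K / N)))
          + (\<Sum>b\<in>V - B. exp (s * \<rho> * (of_bool (b \<in> B) - K / N)))"
        by (subst sum.subset_diff[OF insert.prems(3,1)]) (rule add.commute)
      also have "\<dots> = K * exp (s * \<rho> * (1 - K / N)) + (N - K) * exp (- (s * \<rho>) * (K / N))"
      proof -
        have "real (card (V - B)) = N - K"
          using insert.prems finite_subset[OF insert.prems(3,1)]
          by (simp add: N_def K_def card_Diff_subset of_nat_diff card_mono)
        then show ?thesis by (simp add: K_def)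
      qed
      also have "\<dots> = N * (K / N * exp (s * \<rho> * (1 - K / N)) + (1 - K / N) * exp (- (s * \<rho>) * (K / N)))"
      proof -
        have "K * x + (N - K) * y = N * (K / N * x + (1 - K / N) * y)" for x y
          using N(2) by (simp add: field_simps)
        then show ?thesis .
      qed
      finally show ?thesis .
    qed
    also have "\<dots> * (fact (card V0) * exp (s\<^sup>2 * d / 8))
        \<le> N * exp ((s * \<rho>)\<^sup>2 / 8) * (fact (card V0) * exp (s\<^sup>2 * d / 8))"
      using KN N by (intro mult_right_mono mult_left_mono two_point_mgf) auto
    also have "\<dots> \<le> N * exp (s\<^sup>2 / 8) * (fact (card V0) * exp (s\<^sup>2 * d / 8))"
    proof -
      have "(s * \<rho>)\<^sup>2 \<le> s\<^sup>2 * 1"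
        unfolding power_mult_distrib using \<rho> by (intro mult_left_mono power_le_one) auto
      then show ?thesis using N by (intro mult_right_mono mult_left_mono) auto
    qed
    also have "\<dots> = fact (card V) * exp (s\<^sup>2 * real (card (insert a D)) / 8)"
      using V insert.hyps N by (simp add: d_def exp_add[symmetric] field_simps)
    finally show ?case .
  qed
qed

text \<open>The hits from \<open>D\<close> and from \<open>V - D\<close> add up to
  \<open>card B\<close>, so the centred count for \<open>D\<close> is the negative of the one for
  \<open>V - D\<close>; the previous bound applies with \<open>- s\<close>.\<close>

lemma permutation_count_mgf_compl:
  fixes s :: real
  assumes "finite V" "D \<subseteq> V" "B \<subseteq> V"
  shows "(\<Sum>\<sigma> | \<sigma> permutes V.
      exp (s * (real (card {x \<in> D. \<sigma> x \<in> B}) - real (card D) * real (card B) / real (card V))))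
    \<le> fact (card V) * exp (s\<^sup>2 * real (card V - card D) / 8)"
proof -
  have fin: "finite D" "finite B" using assms finite_subset by blast+
  have "exp (s * (real (card {x \<in> D. \<sigma> x \<in> B}) - real (card D) * real (card B) / real (card V)))
      = exp (- s * (real (card {x \<in> V - D. \<sigma> x \<in> B})
          - real (card (V - D)) * real (card B) / real (card V)))"
    if \<sigma>: "\<sigma> permutes V" for \<sigma>
  proof -
    have "\<sigma> ` {x \<in> V. \<sigma> x \<in> B} = B"
      using assms(3) permutes_image[OF \<sigma>] by (auto simp: image_iff)
    then have "card {x \<in> V. \<sigma> x \<in> B} = card B"
      using card_image[OF inj_on_subset[OF permutes_inj[OF \<sigma>] subset_UNIV], of "{x \<in> V. \<sigma> x \<in> B}"]
      by simp
    moreover have "{x \<in> V. \<sigma> x \<in> B} = {x \<in> D. \<sigma> x \<in> B} \<union> {x \<in> V - D. \<sigma> x \<in> B}"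
      using assms(2) by auto
    then have "card {x \<in> V. \<sigma> x \<in> B} = card {x \<in> D. \<sigma> x \<in> B} + card {x \<in> V - D. \<sigma> x \<in> B}"
      using assms(1) fin by (simp add: card_Un_disjoint[symmetric] disjoint_iff)
    ultimately have a: "real (card {x \<in> D. \<sigma> x \<in> B}) = real (card B) - real (card {x \<in> V - D. \<sigma> x \<in> B})"
      by simp
    have b: "real (card (V - D)) = real (card V) - real (card D)"
      using assms fin by (simp add: card_Diff_subset of_nat_diff card_mono)
    show ?thesis
    proof (cases "V = {}")
      case True
      then show ?thesis using assms by simp
    next
      case False
      then have "real (card V) \<noteq> 0" using assms(1) by simp
      then show ?thesis unfolding a b by (simp add: field_simps)
    qed
  qed
  then have "(\<Sum>\<sigma> | \<sigma> permutes V.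
      exp (s * (real (card {x \<in> D. \<sigma> x \<in> B}) - real (card D) * real (card B) / real (card V))))
    = (\<Sum>\<sigma> | \<sigma> permutes V. exp (- s * (real (card {x \<in> V - D. \<sigma> x \<in> B})
          - real (card (V - D)) * real (card B) / real (card V))))"
    by (intro sum.cong) auto
  also have "\<dots> \<le> fact (card V) * exp ((- s)\<^sup>2 * real (card (V - D)) / 8)"
    using assms by (intro permutation_count_mgf) auto
  finally show ?thesis
    using assms fin by (simp add: card_Diff_subset)
qed

text \<open>\<open>V\<close> is the set of shuffled keys; every key outside it is at most
  \<open>v\<close>. The summand 1 is the pivot's own place, and the other exchanges are the shuffled
  keys among the first places that are replaced by a key above the pivot, which is a sampling
  count.\<close>

lemma swaps_map_eq:
  assumes A: "A \<in> permutations_of_set S" "A ! 0 = v" "Min S < v" and S: "finite S" "v \<in> S"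
    and V: "V \<subseteq> S - {v}" "{x \<in> S. v < x} \<subseteq> V" "\<sigma> permutes V"
  shows "swaps (map \<sigma> A) =
    1 + card {x \<in> V \<inter> set (take (card {x \<in> S. x < v}) A). \<sigma> x \<in> {x \<in> S. v < x}}"
proof -
  let ?I = "card {x \<in> S. x < v}" and ?A = "map \<sigma> A"
  have AS: "set A = S" "distinct A" using A(1) by (auto dest: permutations_of_setD)
  have \<sigma>S: "\<sigma> permutes S" using V(1) permutes_subset[OF V(3)] by blast
  have \<sigma>v: "\<sigma> v = v" using V by (auto simp: permutes_def)
  have A': "set ?A = S" "distinct ?A"
    using AS \<sigma>S by (auto simp: permutes_image distinct_map permutes_inj_on)
  have minS: "Min S \<in> S" by (rule Min_in) (use S in auto)
  have ne: "A \<noteq> []" using AS S(2) by auto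
  have A'0: "?A ! 0 = v" using ne A(2) \<sigma>v by (simp add: hd_conv_nth)
  note P = parts_of_pivot[OF A'(2), of "Min S", unfolded A'(1) A'0, OF minS A(3)]
  have I: "?I \<le> length A" "1 \<le> ?I"
  proof -
    have "?I \<le> card S" using S by (intro card_mono) auto
    then show "?I \<le> length A" using AS distinct_card[of A] by simp
    have "{x \<in> S. x < v} \<noteq> {}" using minS A(3) by auto
    then show "1 \<le> ?I" using S by (simp add: Suc_le_eq card_gt_0_iff)
  qed
  have "swaps ?A = card {i \<in> {..<?I}. v \<le> \<sigma> (A ! i)}"
    unfolding P(7) P(5) using I by (intro arg_cong[where f = card]) auto
  also have "\<dots> = card ((\<lambda>i. A ! i) ` {i \<in> {..<?I}. v \<le> \<sigma> (A ! i)})"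
    using I by (intro card_image[symmetric] inj_on_nth[OF AS(2)]) auto
  also have "(\<lambda>i. A ! i) ` {i \<in> {..<?I}. v \<le> \<sigma> (A ! i)} = {x \<in> set (take ?I A). v \<le> \<sigma> x}"
    unfolding nth_image[OF I(1), symmetric] lessThan_atLeast0 by blast
  also have "\<dots> = insert v {x \<in> V \<inter> set (take ?I A). \<sigma> x \<in> {x \<in> S. v < x}}"
  proof (intro set_eqI iffI)
    fix x assume x: "x \<in> {x \<in> set (take ?I A). v \<le> \<sigma> x}"
    show "x \<in> insert v {x \<in> V \<inter> set (take ?I A). \<sigma> x \<in> {x \<in> S. v < x}}"
    proof (cases "x = v")
      case False
      have xS: "x \<in> S" using x AS by (auto dest: in_set_takeD)
      have "x \<in> V"
      proof (rule ccontr)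
        assume "x \<notin> V"
        then have "\<sigma> x = x" using V(3) by (auto simp: permutes_def)
        then have "v < x" using x False by auto
        then show False using \<open>x \<notin> V\<close> V(2) xS by auto
      qed
      moreover from this have "\<sigma> x \<in> V" using V(3) by (simp add: permutes_in_image)
      ultimately show ?thesis using x V(1) by (auto simp: less_le)
    qed simp
  next
    fix x assume x: "x \<in> insert v {x \<in> V \<inter> set (take ?I A). \<sigma> x \<in> {x \<in> S. v < x}}"
    have "v \<in> set (take ?I A)"
      using I(2) ne A(2) nth_image[OF I(1)] by (metis (no_types, lifting) atLeastLessThan_iff
          imageI less_le_trans zero_less_one zero_le)
    then show "x \<in> {x \<in> set (take ?I A). v \<le> \<sigma> x}" using x \<sigma>v by auto
  qed
  also have "card \<dots> = 1 + card {x \<in> V \<inter> set (take ?I A). \<sigma> x \<in> {x \<in> S. v < x}}"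
    using V(1) by (subst card_insert_disjoint) auto
  finally show ?thesis .
qed

text \<open>Averaging over the shuffles of \<open>V\<close> makes the exchanges 1 plus a
  hypergeometric variable: \<open>d\<close> draws from \<open>V\<close>, where the keys above the
  pivot are the successes. Both bounds are wanted because the admissible cost is the size of the
  discarded part, and either part may be the discarded one.\<close>

lemma swaps_mgf:
  fixes s :: real
  assumes S: "finite S" "v \<in> S" "Min S < v"
    and \<A>: "\<A> \<subseteq> permutations_of_set S" "\<And>A. A \<in> \<A> \<Longrightarrow> A ! 0 = v"
    and V: "V \<subseteq> S - {v}" "{x \<in> S. v < x} \<subseteq> V"
    and closed: "\<And>\<sigma> A. \<sigma> permutes V \<Longrightarrow> A \<in> \<A> \<Longrightarrow> map \<sigma> A \<in> \<A>"
    and d: "\<And>A. A \<in> \<A> \<Longrightarrow> card (V \<inter> set (take (card {x \<in> S. x < v}) A)) = d"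
  shows "(\<Sum>A\<in>\<A>. exp (s * (real (swaps A) - (1 + real d * real (card {x \<in> S. v < x}) / real (card V)))))
      \<le> real (card \<A>) * exp (s\<^sup>2 * real d / 8)" (is "?L \<le> _")
    and "(\<Sum>A\<in>\<A>. exp (s * (real (swaps A) - (1 + real d * real (card {x \<in> S. v < x}) / real (card V)))))
      \<le> real (card \<A>) * exp (s\<^sup>2 * real (card V - d) / 8)"
proof -
  have finV: "finite V" using V(1) S(1) finite_subset by blast
  have fin\<A>: "finite \<A>" by (rule finite_subset[OF \<A>(1)]) simp
  let ?B = "{x \<in> S. v < x}" and ?I = "card {x \<in> S. x < v}" and ?G = "{\<sigma>. \<sigma> permutes V}"
  let ?h = "\<lambda>A. exp (s * (real (swaps A) - (1 + real d * real (card ?B) / real (card V))))"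
  have key: "fact (card V) * ?L \<le> real (card \<A>) * (fact (card V) * c)"
    if c: "\<And>D. D \<subseteq> V \<Longrightarrow> card D = d \<Longrightarrow> (\<Sum>\<sigma> | \<sigma> permutes V.
      exp (s * (real (card {x \<in> D. \<sigma> x \<in> ?B}) - real (card D) * real (card ?B) / real (card V))))
      \<le> fact (card V) * c" for c
  proof -
    have "fact (card V) * ?L = (\<Sum>\<sigma>\<in>?G. \<Sum>A\<in>\<A>. ?h A)"
      using finV by (simp add: card_permutations)
    also have "\<dots> = (\<Sum>\<sigma>\<in>?G. \<Sum>A\<in>\<A>. ?h (map \<sigma> A))"
    proof (rule sum.cong[OF refl])
      fix \<sigma> assume "\<sigma> \<in> ?G"
      then have "bij_betw (map \<sigma>) \<A> \<A>"
        using closed by (intro bij_betw_map_invariant[OF fin\<A> \<A>(1)]) auto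
      from sum.reindex_bij_betw[OF this, of ?h] show "(\<Sum>A\<in>\<A>. ?h A) = (\<Sum>A\<in>\<A>. ?h (map \<sigma> A))" by simp
    qed
    also have "\<dots> = (\<Sum>A\<in>\<A>. \<Sum>\<sigma>\<in>?G. ?h (map \<sigma> A))" by (rule sum.swap)
    also have "\<dots> \<le> (\<Sum>A\<in>\<A>. fact (card V) * c)"
    proof (rule sum_mono)
      fix A assume A: "A \<in> \<A>"
      let ?D = "V \<inter> set (take ?I A)"
      have "(\<Sum>\<sigma>\<in>?G. ?h (map \<sigma> A)) = (\<Sum>\<sigma> | \<sigma> permutes V.
          exp (s * (real (card {x \<in> ?D. \<sigma> x \<in> ?B}) - real (card ?D) * real (card ?B) / real (card V))))"
      proof (rule sum.cong[OF refl])
        fix \<sigma> assume "\<sigma> \<in> ?G"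
        then have "swaps (map \<sigma> A) = 1 + card {x \<in> ?D. \<sigma> x \<in> ?B}"
          using \<A> A S V by (intro swaps_map_eq) auto
        then show "?h (map \<sigma> A) = exp (s * (real (card {x \<in> ?D. \<sigma> x \<in> ?B})
            - real (card ?D) * real (card ?B) / real (card V)))"
          using d[OF A] by simp
      qed
      also have "\<dots> \<le> fact (card V) * c" by (rule c) (use d[OF A] in auto)
      finally show "(\<Sum>\<sigma>\<in>?G. ?h (map \<sigma> A)) \<le> fact (card V) * c" .
    qed
    finally show ?thesis by simp
  qed
  have cancel: "?L \<le> real (card \<A>) * c"
    if "fact (card V) * ?L \<le> real (card \<A>) * (fact (card V) * c)" for c
  proof -
    have "fact (card V) * ?L \<le> fact (card V) * (real (card \<A>) * c)"
      using that by (simp add: mult.left_commute)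
    then show ?thesis by (rule mult_left_le_imp_le) simp
  qed
  show "?L \<le> real (card \<A>) * exp (s\<^sup>2 * real d / 8)"
  proof (rule cancel[OF key])
    show "(\<Sum>\<sigma> | \<sigma> permutes V. exp (s * (real (card {x \<in> D. \<sigma> x \<in> ?B})
        - real (card D) * real (card ?B) / real (card V)))) \<le> fact (card V) * exp (s\<^sup>2 * real d / 8)"
      if "D \<subseteq> V" "card D = d" for D
      using permutation_count_mgf[OF finV that(1) V(2), of s] unfolding that(2) .
  qed
  show "?L \<le> real (card \<A>) * exp (s\<^sup>2 * real (card V - d) / 8)"
  proof (rule cancel[OF key])
    show "(\<Sum>\<sigma> | \<sigma> permutes V. exp (s * (real (card {x \<in> D. \<sigma> x \<in> ?B})
        - real (card D) * real (card ?B) / real (card V)))) \<le> fact (card V) * exp (s\<^sup>2 * real (card V - d) / 8)"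
      if "D \<subseteq> V" "card D = d" for D
      using permutation_count_mgf_compl[OF finV that(1) V(2), of s] unfolding that(2) .
  qed
qed

section \<open>The limit law\<close>

abbreviation unit_uniform :: "real measure" where
  "unit_uniform \<equiv> uniform_measure lborel {0..1}"

definition step :: "real \<Rightarrow> real \<Rightarrow> real" where
  "step x u = sqrt u * x + sqrt u * (1 - sqrt u)"

lemma step_measurable [measurable]:
  "(\<lambda>(x, u). step x u) \<in> borel_measurable (borel \<Otimes>\<^sub>M borel)"
  unfolding step_def by measurable

lemma step_measurable2 [measurable (raw)]:
  assumes [measurable]: "f \<in> borel_measurable M" "g \<in> borel_measurable M"
  shows "(\<lambda>x. step (f x) (g x)) \<in> borel_measurable M"
  unfolding step_def by measurable

lemma step_mono: "x \<le> y \<Longrightarrow> 0 \<le> u \<Longrightarrow> step x u \<le> step y u"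
  by (simp add: step_def mult_left_mono)

lemma step_range:
  assumes "0 \<le> x" "x \<le> 1" "0 \<le> u" "u \<le> 1"
  shows "0 \<le> step x u" "step x u \<le> 1"
proof -
  have r: "0 \<le> sqrt u" "sqrt u \<le> 1" using assms by auto
  then show "0 \<le> step x u" using assms by (simp add: step_def)
  have "step x u \<le> sqrt u * 1 + sqrt u * (1 - sqrt u)"
    unfolding step_def using r assms by (intro add_right_mono mult_left_mono) auto
  also have "\<dots> = 1 - (1 - sqrt u)\<^sup>2" by (simp add: power2_eq_square algebra_simps)
  finally show "step x u \<le> 1" by (smt (verit) zero_le_power2)
qed

lemma prob_space_unit_uniform: "prob_space unit_uniform"
  by (rule prob_space_uniform_measure) auto

text \<open>The head of the stream drives the outermost map, so increasing \<open>n\<close> changes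
  only the innermost start value. As this value is 0 and the maps are monotone, the iterates
  increase and converge for every stream. Clamping the head to [0, 1] makes this hold everywhere and
  not only almost surely.\<close>

primrec perp :: "nat \<Rightarrow> real stream \<Rightarrow> real" where
  "perp 0 \<omega> = 0"
| "perp (Suc n) \<omega> = step (perp n (stl \<omega>)) (max 0 (min 1 (shd \<omega>)))"

lemma perp_range: "0 \<le> perp n \<omega> \<and> perp n \<omega> \<le> 1"
  by (induction n arbitrary: \<omega>) (auto intro!: step_range)

lemma perp_mono: "perp n \<omega> \<le> perp (Suc n) \<omega>"
proof (induction n arbitrary: \<omega>)
  case 0
  show ?case using perp_range[of "Suc 0" \<omega>] by simp
next
  case (Suc n)
  show ?case
    unfolding perp.simps(2)[of n \<omega>] perp.simps(2)[of "Suc n" \<omega>]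
    by (rule step_mono[OF Suc]) simp
qed

lemma perp_measurable [measurable]: "perp n \<in> borel_measurable (stream_space borel)"
proof (induction n)
  case 0
  have "perp 0 = (\<lambda>_. 0)" by (rule ext) simp
  then show ?case by simp
next
  case (Suc n)
  note [measurable] = Suc
  have "perp (Suc n) = (\<lambda>\<omega>. step (perp n (stl \<omega>)) (max 0 (min 1 (shd \<omega>))))"
    by (rule ext) simp
  then show ?case by simp
qed

definition perpetuity :: "real stream \<Rightarrow> real" where
  "perpetuity \<omega> = lim (\<lambda>n. perp n \<omega>)"

lemma perp_tendsto: "(\<lambda>n. perp n \<omega>) \<longlonglongrightarrow> perpetuity \<omega>"
proof -
  have "incseq (\<lambda>n. perp n \<omega>)" by (rule incseq_SucI) (rule perp_mono)
  then have "convergent (\<lambda>n. perp n \<omega>)"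
    using perp_range[of _ \<omega>] by (metis incseq_convergent convergentI)
  then show ?thesis by (simp add: perpetuity_def convergent_LIMSEQ_iff)
qed

lemma perpetuity_range: "0 \<le> perpetuity \<omega>" "perpetuity \<omega> \<le> 1"
  using perp_range[of _ \<omega>] perp_tendsto[of \<omega>] by (auto intro: LIMSEQ_le_const LIMSEQ_le_const2)

lemma perpetuity_measurable [measurable]: "perpetuity \<in> borel_measurable (stream_space borel)"
  by (rule borel_measurable_LIMSEQ_real[OF perp_tendsto]) simp

lemma perpetuity_Stream:
  assumes "0 \<le> u" "u \<le> 1"
  shows "perpetuity (u ## \<omega>) = step (perpetuity \<omega>) u"
proof -
  have "(\<lambda>n. perp (Suc n) (u ## \<omega>)) \<longlonglongrightarrow> step (perpetuity \<omega>) u"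
    using assms by (simp add: step_def) (intro tendsto_intros perp_tendsto)
  moreover have "(\<lambda>n. perp (Suc n) (u ## \<omega>)) \<longlonglongrightarrow> perpetuity (u ## \<omega>)"
    by (rule LIMSEQ_Suc[OF perp_tendsto])
  ultimately show ?thesis by (rule LIMSEQ_unique[symmetric])
qed

lemma AE_unit_uniform: "AE u in unit_uniform. 0 \<le> u \<and> u \<le> 1"
  by (rule AE_uniform_measureI) auto

lemma nn_integral_distr_step:
  assumes "prob_space \<nu>" "sets \<nu> = sets borel" "prob_space U" "sets U = sets borel"
    and [measurable]: "f \<in> borel_measurable borel"
  shows "(\<integral>\<^sup>+x. f x \<partial>distr (\<nu> \<Otimes>\<^sub>M U) borel (\<lambda>(x, u). step x u))
    = (\<integral>\<^sup>+x. (\<integral>\<^sup>+u. f (step x u) \<partial>U) \<partial>\<nu>)"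
    and "(\<integral>\<^sup>+x. f x \<partial>distr (\<nu> \<Otimes>\<^sub>M U) borel (\<lambda>(x, u). step x u))
    = (\<integral>\<^sup>+u. (\<integral>\<^sup>+x. f (step x u) \<partial>\<nu>) \<partial>U)"
proof -
  interpret \<nu>: prob_space \<nu> by fact
  interpret U: prob_space U by fact
  interpret P: pair_sigma_finite \<nu> U ..
  note [measurable_cong] = assms(2,4)
  have eq: "(\<integral>\<^sup>+x. f x \<partial>distr (\<nu> \<Otimes>\<^sub>M U) borel (\<lambda>(x, u). step x u))
      = (\<integral>\<^sup>+p. f (step (fst p) (snd p)) \<partial>(\<nu> \<Otimes>\<^sub>M U))"
    by (subst nn_integral_distr) (auto simp: case_prod_beta')
  show "(\<integral>\<^sup>+x. f x \<partial>distr (\<nu> \<Otimes>\<^sub>M U) borel (\<lambda>(x, u). step x u))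
    = (\<integral>\<^sup>+x. (\<integral>\<^sup>+u. f (step x u) \<partial>U) \<partial>\<nu>)"
    unfolding eq by (subst U.nn_integral_fst[symmetric]) auto
  show "(\<integral>\<^sup>+x. f x \<partial>distr (\<nu> \<Otimes>\<^sub>M U) borel (\<lambda>(x, u). step x u))
    = (\<integral>\<^sup>+u. (\<integral>\<^sup>+x. f (step x u) \<partial>\<nu>) \<partial>U)"
    unfolding eq by (subst P.nn_integral_snd[symmetric]) auto
qed

text \<open>The law of \<open>perpetuity\<close> under independent uniform variables: splitting off
  the head of the stream is the fixed point equation, and the support comes from the range of
  \<open>perpetuity\<close>.\<close>

lemma fixed_point_exists:
  "\<exists>\<mu>. solves_fixed_point \<mu> \<and> (AE x in \<mu>. 0 \<le> x \<and> x \<le> 1)"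
proof -
  interpret U: prob_space unit_uniform by (rule prob_space_unit_uniform)
  let ?\<Omega> = "stream_space unit_uniform"
  interpret \<Omega>: prob_space ?\<Omega> by (rule U.prob_space_stream_space)
  have [measurable_cong]: "sets ?\<Omega> = sets (stream_space borel)"
    by (rule sets_stream_space_cong) simp
  define \<mu> where "\<mu> = distr ?\<Omega> borel perpetuity"
  have sets: "sets \<mu> = sets borel" by (simp add: \<mu>_def)
  have prob: "prob_space \<mu>" unfolding \<mu>_def by (rule \<Omega>.prob_space_distr) simp
  then have "real_distribution \<mu>"
    by (simp add: real_distribution_def real_distribution_axioms_def \<mu>_def)
  moreover have "\<mu> = distr (\<mu> \<Otimes>\<^sub>M unit_uniform) borel (\<lambda>(x, u). step x u)"
  proof (rule measure_eqI)
    fix A assume "A \<in> sets \<mu>"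
    then have A [measurable]: "A \<in> sets borel" by (simp add: \<mu>_def)
    have "emeasure \<mu> A = (\<integral>\<^sup>+x. indicator A x \<partial>\<mu>)"
      using \<open>A \<in> sets \<mu>\<close> by simp
    also have "\<dots> = (\<integral>\<^sup>+\<omega>. indicator A (perpetuity \<omega>) \<partial>?\<Omega>)"
      unfolding \<mu>_def by (subst nn_integral_distr) auto
    also have "\<dots> = (\<integral>\<^sup>+u. (\<integral>\<^sup>+\<omega>. indicator A (perpetuity (u ## \<omega>)) \<partial>?\<Omega>) \<partial>unit_uniform)"
      by (rule U.nn_integral_stream_space) measurable
    also have "\<dots> = (\<integral>\<^sup>+u. (\<integral>\<^sup>+\<omega>. indicator A (step (perpetuity \<omega>) u) \<partial>?\<Omega>) \<partial>unit_uniform)"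
      by (rule nn_integral_cong_AE) (use AE_unit_uniform in eventually_elim, simp add: perpetuity_Stream)
    also have "\<dots> = (\<integral>\<^sup>+u. (\<integral>\<^sup>+x. indicator A (step x u) \<partial>\<mu>) \<partial>unit_uniform)"
      unfolding \<mu>_def by (subst nn_integral_distr) auto
    also have "\<dots> = (\<integral>\<^sup>+x. indicator A x \<partial>distr (\<mu> \<Otimes>\<^sub>M unit_uniform) borel (\<lambda>(x, u). step x u))"
      by (rule nn_integral_distr_step(2)[symmetric, OF prob sets prob_space_unit_uniform]) auto
    also have "\<dots> = emeasure (distr (\<mu> \<Otimes>\<^sub>M unit_uniform) borel (\<lambda>(x, u). step x u)) A"
      by (rule nn_integral_indicator) simp
    finally show "emeasure \<mu> A = emeasure (distr (\<mu> \<Otimes>\<^sub>M unit_uniform) borel (\<lambda>(x, u). step x u)) A" .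
  qed (simp add: \<mu>_def)
  ultimately have "solves_fixed_point \<mu>"
    by (simp add: solves_fixed_point_def step_def)
  moreover have "AE x in \<mu>. 0 \<le> x \<and> x \<le> 1"
    unfolding \<mu>_def by (subst AE_distr_iff) (auto simp: perpetuity_range)
  ultimately show ?thesis by blast
qed

lemma char_fixed_point:
  assumes "solves_fixed_point \<mu>"
  shows "char \<mu> t = (CLINT u|unit_uniform. iexp (t * (sqrt u * (1 - sqrt u))) * char \<mu> (t * sqrt u))"
proof -
  interpret \<mu>: real_distribution \<mu> using assms by (simp add: solves_fixed_point_def)
  interpret U: prob_space unit_uniform by (rule prob_space_unit_uniform)
  interpret P: pair_prob_space \<mu> unit_uniform ..
  have fp: "\<mu> = distr (\<mu> \<Otimes>\<^sub>M unit_uniform) borel (\<lambda>(x, u). step x u)"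
    using assms by (simp add: solves_fixed_point_def step_def)
  note [measurable_cong] = \<mu>.events_eq_borel
  have "char \<mu> t = (CLINT x|distr (\<mu> \<Otimes>\<^sub>M unit_uniform) borel (\<lambda>(x, u). step x u). iexp (t * x))"
    using fp by (simp add: char_def)
  also have "\<dots> = (CLINT p|\<mu> \<Otimes>\<^sub>M unit_uniform. iexp (t * step (fst p) (snd p)))"
    by (subst integral_distr) (auto simp: case_prod_beta')
  also have "\<dots> = (CLINT u|unit_uniform. CLINT x|\<mu>. iexp (t * step x u))"
  proof -
    have "integrable (\<mu> \<Otimes>\<^sub>M unit_uniform) (\<lambda>(x, u). iexp (t * step x u))"
      by (rule P.integrable_const_bound[of _ 1]) (auto simp: case_prod_beta')
    from P.integral_snd[OF this] show ?thesis by (simp add: case_prod_beta')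
  qed
  also have "\<dots> = (CLINT u|unit_uniform. iexp (t * (sqrt u * (1 - sqrt u))) * char \<mu> (t * sqrt u))"
    by (intro Bochner_Integration.integral_cong refl)
      (simp add: char_def step_def distrib_left exp_add mult.assoc mult.commute mult.left_commute)
  finally show ?thesis .
qed

text \<open>A solution carries no moment assumption, so the argument runs through characteristic
  functions. Their distance D satisfies D(t) \<le> E D(t sqrt U). At a maximum point r of D on
  [-|t|, |t|] the arguments r sqrt u stay in the interval, and those with small u have values near
  D(0) = 0, so the mean falls below D(r) unless D(r) = 0.\<close>

lemma fixed_point_unique:
  assumes "solves_fixed_point \<mu>" "solves_fixed_point \<nu>"
  shows "\<mu> = \<nu>"
proof (rule Levy_uniqueness)
  show \<mu>: "real_distribution \<mu>" and \<nu>: "real_distribution \<nu>"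
    using assms by (auto simp: solves_fixed_point_def)
  interpret \<mu>: real_distribution \<mu> by fact
  interpret \<nu>: real_distribution \<nu> by fact
  interpret U: prob_space unit_uniform by (rule prob_space_unit_uniform)
  define D where "D t = norm (char \<mu> t - char \<nu> t)" for t
  have contD: "continuous_on A D" for A
    unfolding D_def
    by (intro continuous_intros continuous_at_imp_continuous_on ballI \<mu>.isCont_char \<nu>.isCont_char)
  have [measurable]: "D \<in> borel_measurable borel"
    using contD by (rule borel_measurable_continuous_onI)
  have [measurable]: "char \<mu> \<in> borel_measurable borel" "char \<nu> \<in> borel_measurable borel"
    by (auto intro!: borel_measurable_continuous_onI continuous_at_imp_continuous_on
        \<mu>.isCont_char \<nu>.isCont_char)
  have D0: "D 0 = 0" by (simp add: D_def \<mu>.char_zero \<nu>.char_zero)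
  have D2: "D t \<le> 2" for t
    unfolding D_def using norm_triangle_ineq4[of "char \<mu> t" "char \<nu> t"]
      \<mu>.cmod_char_le_1[of t] \<nu>.cmod_char_le_1[of t] by linarith
  have intD: "integrable unit_uniform (\<lambda>u. D (t * sqrt u))" for t
    by (rule U.integrable_const_bound[of _ 2]) (use D2 in \<open>auto simp: D_def\<close>)
  have contr: "D t \<le> (LINT u|unit_uniform. D (t * sqrt u))" for t
  proof -
    have i: "integrable unit_uniform (\<lambda>u. iexp (t * (sqrt u * (1 - sqrt u))) * char \<mu> (t * sqrt u))"
      "integrable unit_uniform (\<lambda>u. iexp (t * (sqrt u * (1 - sqrt u))) * char \<nu> (t * sqrt u))"
      using \<mu>.cmod_char_le_1 \<nu>.cmod_char_le_1
      by (auto intro!: U.integrable_const_bound[of _ 1] simp: norm_mult)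
    have eq: "char \<mu> t - char \<nu> t
        = (CLINT u|unit_uniform. iexp (t * (sqrt u * (1 - sqrt u))) * (char \<mu> (t * sqrt u) - char \<nu> (t * sqrt u)))"
      unfolding char_fixed_point[OF assms(1), of t] char_fixed_point[OF assms(2), of t]
        Bochner_Integration.integral_diff[OF i, symmetric]
      by (rule Bochner_Integration.integral_cong[OF refl]) (simp only: right_diff_distrib)
    have "D t \<le> (LINT u|unit_uniform. norm (iexp (t * (sqrt u * (1 - sqrt u)))
        * (char \<mu> (t * sqrt u) - char \<nu> (t * sqrt u))))"
      unfolding D_def eq by (rule integral_norm_bound)
    then show ?thesis by (simp add: norm_mult D_def)
  qed
  have "D t = 0" for t
  proof (rule ccontr)
    assume nz: "D t \<noteq> 0"
    let ?T = "{- \<bar>t\<bar>..\<bar>t\<bar>}"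
    obtain r where r: "r \<in> ?T" "\<And>y. y \<in> ?T \<Longrightarrow> D y \<le> D r"
      using continuous_attains_sup[of ?T D] contD by auto
    have "0 < D t" using nz by (simp add: D_def)
    also have "D t \<le> D r" by (rule r(2)) auto
    finally have m: "0 < D r" .
    have "isCont D 0" using contD[of UNIV] by (simp add: continuous_on_eq_continuous_at)
    then obtain d where d: "0 < d" "\<And>y. \<bar>y\<bar> < d \<Longrightarrow> D y < D r / 2"
      using m D0 unfolding continuous_at_eps_delta dist_real_def
      by (metis diff_zero half_gt_zero abs_of_nonneg D_def norm_ge_zero)
    \<comment> \<open>For u \<le> \<eta> this gives |r| sqrt u \<le> d / 2, inside the neighbourhood
      of 0 where D is below half its maximum.\<close>
    define \<eta> where "\<eta> = min 1 ((d / (2 * (\<bar>t\<bar> + 1)))\<^sup>2)"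
    have \<eta>: "0 < \<eta>" "\<eta> \<le> 1" using d(1) by (auto simp: \<eta>_def)
    have bound: "D (r * sqrt u) \<le> D r - D r / 2 * indicator {0..\<eta>} u" if u: "0 \<le> u" "u \<le> 1" for u
    proof (cases "u \<le> \<eta>")
      case True
      have "sqrt u \<le> sqrt ((d / (2 * (\<bar>t\<bar> + 1)))\<^sup>2)"
        using True by (intro real_sqrt_le_mono) (simp add: \<eta>_def)
      then have "sqrt u \<le> d / (2 * (\<bar>t\<bar> + 1))" using d(1) by simp
      then have "\<bar>r\<bar> * sqrt u \<le> (\<bar>t\<bar> + 1) * (d / (2 * (\<bar>t\<bar> + 1)))"
        using r(1) u by (intro mult_mono) auto
      also have "\<dots> = d / 2" by (simp add: field_simps)
      finally have "\<bar>r * sqrt u\<bar> < d" using d(1) u by (simp add: abs_mult)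
      then show ?thesis using d(2)[of "r * sqrt u"] True u by simp
    next
      case False
      have "\<bar>r * sqrt u\<bar> \<le> \<bar>t\<bar> * 1"
        unfolding abs_mult using r(1) u by (intro mult_mono) auto
      then have "r * sqrt u \<in> ?T" by (auto simp: abs_le_iff)
      then show ?thesis using False r(2) by auto
    qed
    have meas: "measure unit_uniform {0..\<eta>} = \<eta>"
      using \<eta> by (subst measure_uniform_measure) (auto simp: inf_min Int_absorb1)
    have "D r \<le> (LINT u|unit_uniform. D (r * sqrt u))" by (rule contr)
    also have "\<dots> \<le> (LINT u|unit_uniform. D r - D r / 2 * indicator {0..\<eta>} u)"
    proof (rule integral_mono_AE[OF intD])
      show "integrable unit_uniform (\<lambda>u. D r - D r / 2 * indicator {0..\<eta>} u)"
        by (intro Bochner_Integration.integrable_diff integrable_mult_right)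
          (auto simp: U.emeasure_eq_measure)
      show "AE u in unit_uniform. D (r * sqrt u) \<le> D r - D r / 2 * indicator {0..\<eta>} u"
        using AE_unit_uniform by eventually_elim (rule bound; simp)
    qed
    also have "\<dots> = D r - D r / 2 * measure unit_uniform {0..\<eta>}"
      using U.prob_space by (simp add: U.emeasure_eq_measure)
    finally show False using mult_pos_pos[OF m \<eta>(1)] unfolding meas by simp
  qed
  then show "char \<mu> = char \<nu>" by (auto simp: D_def)
qed

lemma limit_law_solves: "solves_fixed_point limit_law"
  and AE_limit_law: "AE x in limit_law. 0 \<le> x \<and> x \<le> 1"
proof -
  obtain \<mu> where \<mu>: "solves_fixed_point \<mu>" "AE x in \<mu>. 0 \<le> x \<and> x \<le> 1"
    using fixed_point_exists by blast
  then have "limit_law = \<mu>"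
    unfolding limit_law_def using fixed_point_unique by blast
  then show "solves_fixed_point limit_law" "AE x in limit_law. 0 \<le> x \<and> x \<le> 1" using \<mu> by auto
qed

section \<open>Drift estimates\<close>

lemma sqrt_diff_ge:
  fixes n k :: real
  assumes "0 \<le> k" "k \<le> n" "0 < n"
  shows "(n - k) / (2 * sqrt n) \<le> sqrt n - sqrt k"
proof -
  have r: "0 \<le> sqrt k" "sqrt k \<le> sqrt n" "0 < sqrt n" using assms by auto
  have "n - k = (sqrt n - sqrt k) * (sqrt n + sqrt k)"
    using assms by (simp add: algebra_simps)
  also have "\<dots> \<le> (sqrt n - sqrt k) * (2 * sqrt n)"
    using r by (intro mult_left_mono) auto
  finally show ?thesis using r by (simp add: divide_le_eq)
qed

text \<open>Turns errors proportional to the number \<open>n - k\<close> of discarded keys into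
  differences of square roots. There is ample room: the factor 21/10 is dictated by the lists with
  the minimum in front, in \<open>drift_error_min\<close>.\<close>

lemma sqrt_diff_ge':
  fixes n k :: real
  assumes "0 \<le> k" "k \<le> n" "48 \<le> n"
  shows "4 * (n - k) / (n - 2) \<le> 21 / 10 * (sqrt n - sqrt k)"
proof -
  have "69/10 \<le> sqrt n" using assms by (intro real_le_rsqrt) (simp add: power2_eq_square)
  then have "69/10 * sqrt n \<le> sqrt n * sqrt n" using assms by (intro mult_right_mono) auto
  then have a: "69/10 * sqrt n \<le> n" using assms by simp
  have "4 / (n - 2) \<le> 21/20 / sqrt n"
    using a assms by (simp add: field_simps)
  then have "4 / (n - 2) * (n - k) \<le> 21/20 / sqrt n * (n - k)"
    using assms by (intro mult_right_mono) auto
  also have "\<dots> = 21 / 10 * ((n - k) / (2 * sqrt n))" by simp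
  also have "\<dots> \<le> 21 / 10 * (sqrt n - sqrt k)"
    using sqrt_diff_ge[of k n] assms by (intro mult_left_mono) auto
  finally show ?thesis by simp
qed

text \<open>Here \<open>a\<close> is the size of the left part, \<open>b\<close> the number of keys
  above the pivot, and \<open>e\<close> records whether the minimum sits among the first
  \<open>a\<close> places, where it is not shuffled; the fraction is then the mean of the sampling
  count. Since \<open>u\<close> lies in the cell of \<open>k\<close>, the quantity y = n sqrt u
  stays between k - (n - k) / (n - 1) and k + 1, so that n \<open>step z u\<close> is close to k z +
  k (n - k) / n, and k (n - k) = a (b + 1).\<close>

lemma drift_error_pivot:
  fixes n k a b e z u :: real
  assumes n: "48 \<le> n" and ab: "a + b + 1 = n" "1 \<le> a" "0 \<le> b" and k: "k = a \<or> k = b + 1"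
    and k1: "1 \<le> k" and e: "e = 0 \<or> e = 1" and z: "0 \<le> z" "z \<le> 1"
    and u: "0 \<le> u" "k * (k - 1) \<le> n * (n - 1) * u" "n * (n - 1) * u \<le> k * (k + 1)"
  shows "\<bar>1 + (a - 1 - e) * b / (n - 2) + k * z - n * (sqrt u * z + sqrt u * (1 - sqrt u))\<bar>
    \<le> 1 + 21/10 * (sqrt n - sqrt k)"
proof -
  define y where "y = n * sqrt u"
  \<comment> \<open>For \<open>e = 0\<close> the mean number of exchanges exceeds k (n - k) / n by
    exactly \<open>1 - D\<close>. Below, \<open>q\<close> is the difference quotient of
    \<open>\<lambda>y. y * z + y * (1 - y / n)\<close> between \<open>k\<close> and
    \<open>y\<close>.\<close>
  define D where "D = a\<^sup>2 / ((n - 1) * n) + b\<^sup>2 / ((n - 1) * (n - 2))"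
  define d q where "d = y - k" and "q = z + 1 - (y + k) / n"
  define j where "j = n - k"
  have j: "1 \<le> j" "j \<le> n - 1" using k ab k1 by (auto simp: j_def)
  have nz: "n \<noteq> 0" "n - 1 \<noteq> 0" "n - 2 \<noteq> 0" using n by auto
  have y0: "0 \<le> y" using n u by (simp add: y_def)
  have y2: "y\<^sup>2 = n * (n * u)" using u by (simp add: y_def power2_eq_square)
  have ka: "k * (n - k) = a * (b + 1)" using k ab by auto
  have nstep: "n * (sqrt u * z + sqrt u * (1 - sqrt u)) = y * z + y * (1 - y / n)"
    using nz by (simp add: y_def algebra_simps)
  have beta: "1 + (a - 1 - e) * b / (n - 2) - a * (b + 1) / n = 1 - D - e * b / (n - 2)"
  proof -
    have "(a - 1) * b / (n - 2) - a * (b + 1) / n = - D"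
    proof -
      have "((a - 1) * b * n * (n - 1) - a * (b + 1) * (n - 2) * (n - 1)) = - (a\<^sup>2 * (n - 2) + b\<^sup>2 * n)"
        unfolding ab(1)[symmetric] by (simp add: algebra_simps power2_eq_square)
      then have "((a - 1) * b * n * (n - 1) - a * (b + 1) * (n - 2) * (n - 1)) / (n * (n - 1) * (n - 2))
          = - (a\<^sup>2 * (n - 2) + b\<^sup>2 * n) / (n * (n - 1) * (n - 2))" by simp
      then show ?thesis using nz unfolding D_def
        by (simp add: diff_divide_distrib add_divide_distrib mult.commute mult.left_commute)
    qed
    moreover have "(a - 1 - e) * b / (n - 2) = (a - 1) * b / (n - 2) - e * b / (n - 2)"
      by (simp add: left_diff_distrib diff_divide_distrib)
    ultimately show ?thesis by linarith
  qed
  have main: "1 + (a - 1 - e) * b / (n - 2) + k * z - n * (sqrt u * z + sqrt u * (1 - sqrt u))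
      = (1 - D - e * b / (n - 2)) - d * q"
  proof -
    have "k * z - (y * z + y * (1 - y / n)) + k * (n - k) / n = - d * q"
      unfolding d_def q_def using nz by (simp add: field_simps)
    then show ?thesis unfolding nstep beta[symmetric] ka by simp
  qed
  have D1: "D \<le> 1"
  proof -
    have "0 \<le> 2 * a * b - b + a - 1"
    proof -
      have "b * 1 \<le> b * a" using ab(2,3) by (rule mult_left_mono)
      moreover have "0 \<le> a * b" "1 \<le> a" using ab by auto
      ultimately show ?thesis by (simp add: algebra_simps)
    qed
    then have "0 \<le> (2 * a * b - b + a - 1) * (n - 1)" using n by simp
    also have "(2 * a * b - b + a - 1) * (n - 1) = (n - 1) * n * (n - 2) - (a\<^sup>2 * (n - 2) + b\<^sup>2 * n)"
      unfolding ab(1)[symmetric] by (simp add: algebra_simps power2_eq_square)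
    finally have "(a\<^sup>2 * (n - 2) + b\<^sup>2 * n) / ((n - 1) * n * (n - 2)) \<le> 1"
      using n by (simp add: divide_le_eq_1)
    also have "(a\<^sup>2 * (n - 2) + b\<^sup>2 * n) / ((n - 1) * n * (n - 2)) = D"
      using nz unfolding D_def by (simp add: add_divide_distrib)
    finally show ?thesis .
  qed
  \<comment> \<open>According to which part survives, one of the two squares in \<open>D\<close> is
    already within \<open>2 * j / (n - 2)\<close> of 1.\<close>
  have D2: "1 - D \<le> 2 * j / (n - 2)"
  proof (cases "k = a")
    case True
    have "a\<^sup>2 / ((n - 1) * n) \<le> D" using n by (simp add: D_def)
    moreover have "1 - a\<^sup>2 / ((n - 1) * n) \<le> 2 * j / (n - 1)"
    proof -
      have "n\<^sup>2 - a\<^sup>2 \<le> 2 * j * n"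
      proof -
        have "2 * j * n - (n\<^sup>2 - a\<^sup>2) = (n - a)\<^sup>2"
          unfolding j_def True by (simp add: power2_eq_square algebra_simps)
        then show ?thesis by (metis zero_le_power2 diff_ge_0_iff_ge)
      qed
      then have "(n - 1) * n - a\<^sup>2 \<le> 2 * j * n" using n by (simp add: power2_eq_square algebra_simps)
      then have "((n - 1) * n - a\<^sup>2) / ((n - 1) * n) \<le> 2 * j * n / ((n - 1) * n)"
        using n by (intro divide_right_mono) auto
      then show ?thesis using nz by (simp add: diff_divide_distrib)
    qed
    moreover have "2 * j / (n - 1) \<le> 2 * j / (n - 2)" using n j by (intro divide_left_mono) auto
    ultimately show ?thesis by linarith
  next
    case False
    then have b: "b = n - 1 - j" using k by (simp add: j_def)
    have "b\<^sup>2 / ((n - 1) * (n - 2)) \<le> D" using n by (simp add: D_def)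
    moreover have "1 - b\<^sup>2 / ((n - 1) * (n - 2)) \<le> 2 * j / (n - 2)"
    proof -
      have "(n - 1)\<^sup>2 - b\<^sup>2 \<le> 2 * j * (n - 1)"
      proof -
        have "2 * j * (n - 1) - ((n - 1)\<^sup>2 - b\<^sup>2) = j\<^sup>2"
          unfolding b by (simp add: power2_eq_square algebra_simps)
        then show ?thesis by (metis zero_le_power2 diff_ge_0_iff_ge)
      qed
      then have "(n - 1) * (n - 2) - b\<^sup>2 \<le> 2 * j * (n - 1)" using n by (simp add: power2_eq_square algebra_simps)
      then have "((n - 1) * (n - 2) - b\<^sup>2) / ((n - 1) * (n - 2)) \<le> 2 * j * (n - 1) / ((n - 1) * (n - 2))"
        using n by (intro divide_right_mono) auto
      then show ?thesis using nz by (simp add: diff_divide_distrib)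
    qed
    ultimately show ?thesis by linarith
  qed
  have y2': "(n - 1) * y\<^sup>2 = n * (n * (n - 1) * u)" by (simp add: y2)
  have ylow: "- (j / (n - 1)) \<le> d"
  proof (rule ccontr)
    assume neg: "\<not> - (j / (n - 1)) \<le> d"
    \<comment> \<open>With this choice (n - 1) (k^2 - k t) = n k (k - 1), which is the lower end of
      the cell on the scale of (n - 1) y^2.\<close>
    define t where "t = j / (n - 1)"
    have t: "0 \<le> t" "t \<le> 1" using j n by (auto simp: t_def divide_le_eq_1)
    have "y < k - t" using neg by (simp add: d_def t_def)
    then have "y\<^sup>2 < (k - t)\<^sup>2" using y0 by (intro power_strict_mono) auto
    also have "(k - t)\<^sup>2 = k\<^sup>2 - k * t - t * (k - t)" by (simp add: power2_eq_square algebra_simps)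
    also have "\<dots> \<le> k\<^sup>2 - k * t"
    proof -
      have "0 \<le> t * (k - t)" using t k1 by (intro mult_nonneg_nonneg) auto
      then show ?thesis by linarith
    qed
    finally have "(n - 1) * y\<^sup>2 < (n - 1) * (k\<^sup>2 - k * t)" using n by simp
    also have "\<dots> = n * (k * (k - 1))"
      using nz by (simp add: t_def j_def field_simps power2_eq_square)
    also have "\<dots> \<le> n * (n * (n - 1) * u)" using u n by (intro mult_left_mono) auto
    finally show False using y2' by simp
  qed
  have yup: "d \<le> 1"
  proof (rule ccontr)
    assume "\<not> d \<le> 1"
    then have "(k + 1)\<^sup>2 < y\<^sup>2" using k1 by (intro power_strict_mono) (auto simp: d_def)
    then have "(n - 1) * (k + 1)\<^sup>2 < (n - 1) * y\<^sup>2" using n by simp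
    also have "\<dots> \<le> n * (k * (k + 1))" unfolding y2' using u n by (intro mult_left_mono) auto
    finally have "0 < (k + 1) * (n * k - (n - 1) * (k + 1))"
      by (simp add: power2_eq_square algebra_simps)
    then have "0 < n * k - (n - 1) * (k + 1)" using k1 by (simp add: zero_less_mult_iff)
    then show False using j by (simp add: j_def algebra_simps)
  qed
  have yn: "y \<le> n"
  proof -
    have "k * (k + 1) \<le> (n - 1) * (n - 1 + 1)"
      using j k1 by (intro mult_mono) (auto simp: j_def)
    then have "n * (n - 1) * u \<le> n * (n - 1) * 1" using u by (simp add: mult.commute)
    then have "u \<le> 1" using n by (subst (asm) mult_le_cancel_left) auto
    then show ?thesis using n by (simp add: y_def)
  qed
  have small: "4 * j / (n - 2) \<le> 21/10 * (sqrt n - sqrt k)"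
    unfolding j_def using n j k1 by (intro sqrt_diff_ge') (auto simp: j_def)
  have jn: "j / (n - 1) \<le> j / (n - 2)" "0 \<le> j / (n - 1)" "j / n \<le> j / (n - 2)"
    using n j by (auto intro!: divide_left_mono)
  have eb: "0 \<le> e * b / (n - 2)" "e * b / (n - 2) \<le> 1"
    using e ab n by (auto simp: divide_le_eq_1)
  have E: "0 \<le> (y + k) / n" "(y + k) / n \<le> 2"
    using y0 k1 n yn j by (auto simp: divide_le_eq j_def)
  have up: "- d * q \<le> 1 + 2 * (j / (n - 2))"
  proof (cases "0 \<le> d")
    case True
    have "- d * q = d * (- q)" by simp
    also have "\<dots> \<le> d * ((y + k) / n - 1)"
      using True z by (intro mult_left_mono) (auto simp: q_def)
    also have "\<dots> \<le> d * 1" using True E by (intro mult_left_mono) auto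
    finally show ?thesis using yup jn by linarith
  next
    case False
    have "- d * q \<le> - d * 2" using False z E by (intro mult_left_mono) (auto simp: q_def)
    then show ?thesis using ylow jn by linarith
  qed
  have low: "d * q \<le> 2 * (j / (n - 2))"
  proof (cases "0 \<le> d")
    case True
    have q2: "q \<le> 2 * (j / n)"
    proof -
      have "q \<le> 2 - (k + k) / n"
        unfolding q_def
      proof -
        have "(k + k) / n \<le> (y + k) / n" using True n by (intro divide_right_mono) (auto simp: d_def)
        then show "z + 1 - (y + k) / n \<le> 2 - (k + k) / n" using z by linarith
      qed
      also have "\<dots> = 2 * (j / n)" using nz by (simp add: j_def field_simps)
      finally show ?thesis .
    qed
    show ?thesis
    proof (cases "0 \<le> q")
      case qpos: True
      have "d * q \<le> 1 * q" using yup qpos by (intro mult_right_mono) auto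
      then show ?thesis using q2 jn by linarith
    next
      case False
      then have "d * q \<le> 0" using True by (simp add: mult_nonneg_nonpos)
      then show ?thesis using jn by linarith
    qed
  next
    case False
    have "d * q = - d * (- q)" by simp
    also have "\<dots> \<le> - d * 1" using False z E by (intro mult_left_mono) (auto simp: q_def)
    finally show ?thesis using ylow jn by linarith
  qed
  have sj: "4 * j / (n - 2) = 4 * (j / (n - 2))" "2 * j / (n - 2) = 2 * (j / (n - 2))" by auto
  show ?thesis
    unfolding main
    using up low D1 D2 eb small jn unfolding sj by (intro abs_leI) linarith+
qed

text \<open>Here \<open>m\<close> and \<open>a\<close> stand for the square roots of the list length
  and of the new size k. The inequality says that d = 21/20 m^2 / (m + a) already satisfies d^2 + 2
  d k \<ge> k + m^2; the value 34/5 is a lower bound of sqrt 47.\<close>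

lemma poly_bound:
  fixes a m :: real
  assumes "1 \<le> a" "a \<le> m" "34/5 \<le> m"
  shows "(m\<^sup>2 + a\<^sup>2) * (m + a)\<^sup>2 \<le> (21/20 * m\<^sup>2)\<^sup>2 + 21/10 * m\<^sup>2 * a\<^sup>2 * (m + a)"
proof -
  have m0: "0 \<le> m" "0 \<le> a" using assms by auto
  have e: "(21/20 * m\<^sup>2)\<^sup>2 + 21/10 * m\<^sup>2 * a\<^sup>2 * (m + a) - (m\<^sup>2 + a\<^sup>2) * (m + a)\<^sup>2
     = 41/400 * m^4 + m^3 * a * (21/10 * a - 2) + m\<^sup>2 * a\<^sup>2 * (21/10 * a - 2) - 2 * m * a^3 - a^4"
    by (simp add: power2_eq_square power3_eq_cube power4_eq_xxxx field_simps)
  have a4: "a^4 \<le> m * a^3"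
  proof -
    have "a * a^3 \<le> m * a^3" using assms m0 by (intro mult_right_mono) auto
    then show ?thesis by (simp add: power4_eq_xxxx power3_eq_cube mult.assoc)
  qed
  have t2: "0 \<le> m\<^sup>2 * a\<^sup>2 * (21/10 * a - 2)" using assms by simp
  have t1: "0 \<le> m^3 * a * (21/10 * a - 2)" using assms by simp
  have "3 * m * a^3 \<le> 41/400 * m^4 + m^3 * a * (21/10 * a - 2) + m\<^sup>2 * a\<^sup>2 * (21/10 * a - 2)"
  \<comment> \<open>For \<open>a\<close> near 1 the factor \<open>21/10 * a - 2\<close> is close to
    0 and the surplus 41/400 = (21/20)^2 - 1 of the leading term does the work; beyond 6/5 that
    factor is at least \<open>43/100 * a\<close>.\<close>
  proof (cases "a \<le> 6/5")
    case True
    have "a^3 \<le> (6/5)^3" using True assms by (intro power_mono) auto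
    moreover have "(34/5)^3 \<le> m^3" using assms by (intro power_mono) auto
    ultimately have "3 * a^3 \<le> 41/400 * m^3" by (simp add: power3_eq_cube)
    then have "m * (3 * a^3) \<le> m * (41/400 * m^3)" using m0(1) by (rule mult_left_mono)
    then have "3 * m * a^3 \<le> 41/400 * m^4" by (simp add: power4_eq_xxxx power3_eq_cube mult.assoc mult.left_commute)
    then show ?thesis using t1 t2 by linarith
  next
    case False
    have c: "43/100 * a \<le> 21/10 * a - 2" using False by simp
    have "m^3 * a * (43/100 * a) \<le> m^3 * a * (21/10 * a - 2)"
      "m\<^sup>2 * a\<^sup>2 * (43/100 * a) \<le> m\<^sup>2 * a\<^sup>2 * (21/10 * a - 2)"
      by (rule mult_left_mono[OF c], use m0 in simp)+
    moreover have "m\<^sup>2 * a\<^sup>2 * (43/100 * a) \<le> m^3 * a * (43/100 * a)"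
    proof -
      have "(m\<^sup>2 * a\<^sup>2 * (43/100)) * a \<le> (m\<^sup>2 * a\<^sup>2 * (43/100)) * m"
        using assms by (intro mult_left_mono) auto
      then show ?thesis by (simp add: power2_eq_square power3_eq_cube mult.assoc mult.left_commute mult.commute)
    qed
    moreover have "3 * m * a^3 \<le> 2 * (m\<^sup>2 * a\<^sup>2 * (43/100 * a))"
    proof -
      have "(m * a^3) * 3 \<le> (m * a^3) * (86/100 * m)"
        using assms m0 by (intro mult_left_mono) auto
      then show ?thesis by (simp add: power2_eq_square power3_eq_cube mult.assoc mult.left_commute mult.commute)
    qed
    moreover have "0 \<le> 41/400 * m^4" by simp
    ultimately show ?thesis by linarith
  qed
  then have "0 \<le> (21/20 * m\<^sup>2)\<^sup>2 + 21/10 * m\<^sup>2 * a\<^sup>2 * (m + a) - (m\<^sup>2 + a\<^sup>2) * (m + a)\<^sup>2"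
    unfolding e using a4 by linarith
  then show ?thesis by simp
qed

text \<open>The tail has length \<open>m\<close> and all its keys except the pivot are shuffled.
  Because the cells start at 1 / m, y = m sqrt u never falls below \<open>k\<close>, but for small
  \<open>k\<close> it may exceed \<open>k\<close> by the order of sqrt m. This excess is what
  requires 21/10. The extra value of \<open>step\<close> coming from n = m + 1 lies in [0, 1] and is
  absorbed by the constant 1 of the lower estimate.\<close>

lemma drift_error_min:
  fixes n m k a b z u :: real
  assumes n: "48 \<le> n" and m: "n = m + 1" and ab: "a + b + 1 = m" "1 \<le> a" "0 \<le> b"
    and k: "k = a \<or> k = b + 1" and k1: "1 \<le> k" and z: "0 \<le> z" "z \<le> 1"
    and u: "0 \<le> u" "k\<^sup>2 - k + m \<le> m\<^sup>2 * u" "m\<^sup>2 * u \<le> k\<^sup>2 + k + m"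
  shows "\<bar>1 + (a - 1) * b / (m - 1) + k * z - n * (sqrt u * z + sqrt u * (1 - sqrt u))\<bar>
    \<le> 1 + 21/10 * (sqrt n - sqrt k)"
proof -
  define y where "y = m * sqrt u"
  define d q where "d = y - k" and "q = z + 1 - (y + k) / m"
  define st where "st = sqrt u * z + sqrt u * (1 - sqrt u)"
  \<comment> \<open>\<open>\<beta>\<close> is the exact excess of the mean number of exchanges over
    k (m - k) / m.\<close>
  define \<beta> where "\<beta> = k * (m - k) / (m * (m - 1))"
  have m47: "47 \<le> m" using n m by simp
  have nz: "m \<noteq> 0" "m - 1 \<noteq> 0" using m47 by auto
  have km: "k \<le> m - 1" using k ab by auto
  have y0: "0 \<le> y" using m47 u by (simp add: y_def)
  have y2: "y\<^sup>2 = m\<^sup>2 * u" using u by (simp add: y_def power2_eq_square)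
  have ka: "k * (m - k) = a * (b + 1)" using k ab by auto
  have u1: "u \<le> 1"
  proof -
    have "k\<^sup>2 + k + m \<le> (m - 1)\<^sup>2 + (m - 1) + m"
      using km k1 by (intro add_mono power_mono) auto
    also have "\<dots> = m\<^sup>2 * 1" by (simp add: power2_eq_square algebra_simps)
    finally have "m\<^sup>2 * u \<le> m\<^sup>2 * 1" using u by linarith
    then show ?thesis using m47 by (subst (asm) mult_le_cancel_left) auto
  qed
  have ym: "y \<le> m" using u1 m47 by (simp add: y_def)
  have st: "0 \<le> st" "st \<le> 1"
  proof -
    have r: "0 \<le> sqrt u" "sqrt u \<le> 1" using u u1 by auto
    then show "0 \<le> st" using z by (simp add: st_def)
    have "st \<le> sqrt u * 1 + sqrt u * (1 - sqrt u)"
      unfolding st_def using r z by (intro add_right_mono mult_left_mono) auto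
    also have "\<dots> = 1 - (1 - sqrt u)\<^sup>2" by (simp add: power2_eq_square algebra_simps)
    finally show "st \<le> 1" by (smt (verit) zero_le_power2)
  qed
  have nstep: "n * st = y * z + y * (1 - y / m) + st"
    using nz unfolding m by (simp add: y_def st_def algebra_simps)
  have beta: "1 + (a - 1) * b / (m - 1) - a * (b + 1) / m = \<beta>"
  proof -
    have "m * (m - 1) + (a - 1) * b * m - a * (b + 1) * (m - 1) = a * (b + 1)"
      unfolding ab(1)[symmetric] by (simp add: algebra_simps)
    then have "(m * (m - 1) + (a - 1) * b * m - a * (b + 1) * (m - 1)) / (m * (m - 1))
        = a * (b + 1) / (m * (m - 1))" by simp
    then show ?thesis using nz unfolding \<beta>_def ka
      by (simp add: diff_divide_distrib add_divide_distrib)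
  qed
  have main: "1 + (a - 1) * b / (m - 1) + k * z - n * st = \<beta> - d * q - st"
  proof -
    have "k * z - (y * z + y * (1 - y / m)) + k * (m - k) / m = - d * q"
      unfolding d_def q_def using nz by (simp add: field_simps)
    then show ?thesis unfolding nstep beta[symmetric] ka by simp
  qed
  have \<beta>: "0 \<le> \<beta>" "\<beta> \<le> (m - k) / (m - 1)"
  proof -
    show "0 \<le> \<beta>" unfolding \<beta>_def using k1 km m47 by (intro divide_nonneg_nonneg mult_nonneg_nonneg) auto
    have "\<beta> = k / m * ((m - k) / (m - 1))" by (simp add: \<beta>_def)
    also have "\<dots> \<le> 1 * ((m - k) / (m - 1))"
      using k1 km m47 by (intro mult_right_mono divide_nonneg_nonneg) auto
    finally show "\<beta> \<le> (m - k) / (m - 1)" by simp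
  qed
  have d0: "0 \<le> d"
  proof (rule ccontr)
    assume "\<not> 0 \<le> d"
    then have "y\<^sup>2 < k\<^sup>2" using y0 by (intro power_strict_mono) (auto simp: d_def)
    then show False using u(2) km unfolding y2 by linarith
  qed
  have dd: "d * (y + k) \<le> k + m" "d\<^sup>2 + 2 * d * k \<le> k + m"
    using u(3) unfolding y2[symmetric] by (simp_all add: d_def power2_eq_square algebra_simps)
  have E: "0 \<le> (y + k) / m" "(y + k) / m \<le> 2"
    using y0 k1 m47 ym km by (auto simp: divide_le_eq)
  have small: "(m - k) / (m - 1) \<le> 21/10 * (sqrt n - sqrt k)"
  proof -
    have "(m - k) / (m - 1) \<le> 4 * (n - k) / (n - 2)"
      unfolding m using km m47 by (intro frac_le) auto
    also have "\<dots> \<le> 21/10 * (sqrt n - sqrt k)" using n k1 km m by (intro sqrt_diff_ge') auto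
    finally show ?thesis .
  qed
  have up: "- d * q \<le> 1"
  proof -
    have "- d * q = d * (- q)" by simp
    also have "\<dots> \<le> d * ((y + k) / m - 1)"
      using d0 z by (intro mult_left_mono) (auto simp: q_def)
    also have "\<dots> \<le> 1"
    proof (cases "d \<le> 1")
      case True
      have "d * ((y + k) / m - 1) \<le> d * 1" using d0 E by (intro mult_left_mono) auto
      then show ?thesis using True by simp
    next
      case False
      have "d * ((y + k) / m - 1) = d * (y + k) / m - d" by (simp add: algebra_simps)
      also have "\<dots> \<le> (k + m) / m - 1"
        using dd(1) False m47 by (intro diff_mono divide_right_mono) auto
      also have "\<dots> \<le> 1" using km m47 by (simp add: divide_le_eq)
      finally show ?thesis .
    qed
    finally show ?thesis .
  qed
  have low: "d * q \<le> 21/10 * (sqrt n - sqrt k)"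
  proof -
    let ?M = "sqrt m" and ?a = "sqrt k"
    have r: "1 \<le> ?a" "?a \<le> ?M" "34/5 \<le> ?M" "?M\<^sup>2 = m" "?a\<^sup>2 = k"
    proof -
      show "34/5 \<le> ?M" using m47 by (intro real_le_rsqrt) (simp add: power2_eq_square)
    qed (use k1 km m47 in auto)
    \<comment> \<open>The upper end of the cell gives d^2 + 2 d k \<le> k + m. By
      \<open>poly_bound\<close> the left side reaches \<open>k + m\<close> at d = 21/20 m / (sqrt m
      + sqrt k), so \<open>d\<close> cannot be larger.\<close>
    have bd: "d * (?M + ?a) \<le> 21/20 * m"
    proof (rule ccontr)
      assume "\<not> d * (?M + ?a) \<le> 21/20 * m"
      then have gt: "21/20 * m < d * (?M + ?a)" by simp
      define t where "t = ?M + ?a"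
      have s0: "0 < t" unfolding t_def using r(1,3) by linarith
      have "(21/20 * m)\<^sup>2 < (d * t)\<^sup>2" using gt m47 unfolding t_def[symmetric] by (intro power_strict_mono) auto
      moreover have "2 * k * t * (21/20 * m) \<le> 2 * k * t * (d * t)"
        using gt k1 s0 unfolding t_def[symmetric] by (intro mult_left_mono) auto
      ultimately have "(21/20 * m)\<^sup>2 + 2 * k * t * (21/20 * m) < (d\<^sup>2 + 2 * d * k) * t\<^sup>2"
        unfolding power_mult_distrib by (simp add: power2_eq_square algebra_simps)
      also have "\<dots> \<le> (k + m) * t\<^sup>2" using dd(2) by (intro mult_right_mono) auto
      also have "\<dots> \<le> (21/20 * m)\<^sup>2 + 21/10 * m * k * t"
        using poly_bound[OF r(1,2,3)] unfolding r(4,5) t_def[symmetric] by (simp add: add.commute)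
      finally show False by simp
    qed
    have "d * q \<le> d * (2 - (k + k) / m)"
      unfolding q_def using z d0 m47 by (intro mult_left_mono diff_mono divide_right_mono) (auto simp: d_def)
    also have "\<dots> = 2 * d * (m - k) / m" using nz by (simp add: field_simps)
    also have "\<dots> = 2 * (d * (?M + ?a)) * (?M - ?a) / m"
    proof -
      have "m - k = ?M\<^sup>2 - ?a\<^sup>2" using r by simp
      also have "\<dots> = (?M + ?a) * (?M - ?a)" by (simp add: power2_eq_square algebra_simps)
      finally have "2 * d * (m - k) = 2 * (d * (?M + ?a)) * (?M - ?a)"
        by (simp only: mult.assoc)
      then show ?thesis by (simp only:)
    qed
    also have "\<dots> \<le> 2 * (21/20 * m) * (?M - ?a) / m"
      using bd r m47 by (intro divide_right_mono mult_right_mono mult_left_mono) auto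
    also have "\<dots> = 21/10 * (?M - ?a)" using nz by simp
    also have "\<dots> \<le> 21/10 * (sqrt n - sqrt k)" using m by simp
    finally show ?thesis .
  qed
  show ?thesis
    unfolding st_def[symmetric] main
    using up low \<beta> st small by (intro abs_leI) linarith+
qed


text \<open>The exponent, per unit of |s|, left over when a step reaches size \<open>k\<close>: the
  change of the square root term of the moment bound plus the drift error. It is positive for
  \<open>k\<close> close to \<open>n\<close>, so only its exponential average over \<open>k\<close>
  can be controlled.\<close>

definition drift :: "real \<Rightarrow> real \<Rightarrow> real" where
  "drift n k = 69/10 * (sqrt k - sqrt n) + (1 + 21/10 * (sqrt n - sqrt k))"

lemma drift_eq: "drift n k = 1 - 24/5 * (sqrt n - sqrt k)"
proof -
  have "69/10 * (- a) + (1 + 21/10 * a) = 1 - 24/5 * a" for a :: real by simp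
  from this[of "sqrt n - sqrt k"] show ?thesis by (simp only: drift_def minus_diff_eq)
qed

section \<open>Exponential averages of the drift over the new size\<close>

lemma exp_4_le: "exp 4 \<le> (5474/100 :: real)"
proof -
  have "exp 4 = (exp 1 :: real) ^ 4" using exp_of_nat_mult[of 4 "1 :: real"] by simp
  also have "\<dots> \<le> (272/100 :: real) ^ 4"
    using e_less_272 by (intro power_mono) auto
  also have "\<dots> \<le> (5474/100 :: real)" by (simp add: power_divide)
  finally show ?thesis .
qed

text \<open>The summand is the probability of the new size \<open>k\<close> when the first key is
  uniform among the non-minimal ones: two pivots, each of probability 1 / (n - 1), create a part of
  size \<open>k\<close>, and it contains the rank with probability k / n.\<close>

lemma sum_sizes: "(\<Sum>k=1..<n. 2 * real k / (real n * (real n - 1))) = (if n \<ge> 2 then 1 else 0)"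
proof -
  have "(\<Sum>k=1..<n. 2 * real k) = real n * (real n - 1)"
    by (induction n) (auto simp: algebra_simps)
  then show ?thesis by (auto simp: sum_divide_distrib[symmetric])
qed

text \<open>The tangent bound for sqrt n - sqrt k dominates the sum by a geometric series with ratio
  exp (- x), where x = (48/5) / sqrt n, and exp x - 1 is bounded below by x + x^2 / 2. The result
  stays below 1 by 27/1000, a margin that \<open>drift_sum_min\<close> spends on its additional
  stopping term.\<close>

lemma drift_sum_4:
  assumes n: "48 \<le> n"
  shows "(\<Sum>k=1..<n. 2 * real k / (real n * (real n - 1)) * exp (4 * drift n k)) \<le> 973/1000"
proof -
  let ?n = "real n"
  define x where "x = 48/5 / sqrt ?n"
  have sq: "6927/1000 \<le> sqrt ?n" using n by (intro real_le_rsqrt) (simp add: power2_eq_square)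
  have x0: "0 < x" using n by (simp add: x_def)
  \<comment> \<open>The threshold 48 enters here: 1 / x + 1 / 2 is then at least 12215/10000, and
    the quotient of exp 4 by this quantity is small enough.\<close>
  have ix: "72156/100000 \<le> 1 / x" using sq by (simp add: x_def)
  have x2: "2 / ?n = 2 * x\<^sup>2 / (48/5)\<^sup>2" using n by (simp add: x_def power_divide)
  define r where "r = exp (- x)"
  have r: "0 < r" "r < 1" using x0 by (auto simp: r_def)
  have trm: "2 * real k / (?n * (?n - 1)) * exp (4 * drift n k) \<le> 2 / ?n * exp 4 * r ^ (n - k)"
    if k: "k \<in> {1..<n}" for k
  proof -
    have kn: "real k \<le> ?n - 1" using k by auto
    have "2 * real k / (?n * (?n - 1)) \<le> 2 * (?n - 1) / (?n * (?n - 1))"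
      using kn n by (intro divide_right_mono) auto
    also have "\<dots> = 2 / ?n" using n by (intro mult_divide_mult_cancel_right) auto
    finally have a: "2 * real k / (?n * (?n - 1)) \<le> 2 / ?n" .
    have "(?n - real k) / (2 * sqrt ?n) \<le> sqrt ?n - sqrt (real k)"
      using k by (intro sqrt_diff_ge) auto
    then have "4 * (1 - 24/5 * (sqrt ?n - sqrt (real k)))
        \<le> 4 * (1 - 24/5 * ((?n - real k) / (2 * sqrt ?n)))"
      by (intro mult_left_mono diff_mono) auto
    then have "4 * drift n k \<le> 4 * (1 - 24/5 * ((?n - real k) / (2 * sqrt ?n)))"
      unfolding drift_eq .
    also have "\<dots> = 4 + real (n - k) * (- x)" using k n by (simp add: x_def of_nat_diff field_simps)
    finally have "exp (4 * drift n k) \<le> exp (4 + real (n - k) * (- x))" by simp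
    also have "\<dots> = exp 4 * r ^ (n - k)" unfolding exp_add r_def exp_of_nat_mult ..
    finally have b: "exp (4 * drift n k) \<le> exp 4 * r ^ (n - k)" .
    have "2 * real k / (?n * (?n - 1)) * exp (4 * drift n k) \<le> 2 / ?n * (exp 4 * r ^ (n - k))"
      by (rule mult_mono[OF a b]) auto
    then show ?thesis by (simp add: mult.assoc)
  qed
  have "(\<Sum>k=1..<n. r ^ (n - k)) = (\<Sum>j=1..<n. r ^ j)"
    by (rule sum.reindex_bij_witness[of _ "\<lambda>j. n - j" "\<lambda>k. n - k"]) auto
  also have "\<dots> \<le> r / (1 - r)"
  proof -
    have "(\<Sum>j=1..<n. r ^ j) = r * (\<Sum>j<n - 1. r ^ j)"
      unfolding sum_distrib_left
      by (rule sum.reindex_bij_witness[of _ "\<lambda>j. j + 1" "\<lambda>j. j - 1"]) (auto simp: power_eq_if)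
    also have "\<dots> = r * ((1 - r ^ (n - 1)) / (1 - r))" using r by (simp add: sum_gp_strict)
    also have "\<dots> \<le> r * (1 / (1 - r))" using r by (intro mult_left_mono divide_right_mono) auto
    finally show ?thesis by simp
  qed
  also have "r / (1 - r) = 1 / (exp x - 1)"
    using r x0 by (simp add: r_def exp_minus field_simps)
  also have "\<dots> \<le> 1 / (12215/10000 * x\<^sup>2)"
  proof (rule divide_left_mono)
    have "12215/10000 * x\<^sup>2 \<le> (1 / x + 1 / 2) * x\<^sup>2" using ix by (intro mult_right_mono) auto
    also have "\<dots> = x + x\<^sup>2 / 2" using x0 by (simp add: field_simps power2_eq_square)
    also have "\<dots> \<le> exp x - 1" using exp_lower_Taylor_quadratic[of x] x0 by simp
    finally show "12215/10000 * x\<^sup>2 \<le> exp x - 1" .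
    then show "0 < (exp x - 1) * (12215/10000 * x\<^sup>2)" using x0 by simp
  qed simp
  finally have S: "(\<Sum>k=1..<n. r ^ (n - k)) \<le> 1 / (12215/10000 * x\<^sup>2)" .
  have "(\<Sum>k=1..<n. 2 * real k / (?n * (?n - 1)) * exp (4 * drift n k))
      \<le> (\<Sum>k=1..<n. 2 / ?n * exp 4 * r ^ (n - k))"
    by (rule sum_mono[OF trm])
  also have "\<dots> = 2 / ?n * exp 4 * (\<Sum>k=1..<n. r ^ (n - k))" by (simp add: sum_distrib_left)
  also have "\<dots> \<le> 2 / ?n * exp 4 * (1 / (12215/10000 * x\<^sup>2))"
    by (rule mult_left_mono[OF S]) simp
  also have "2 / ?n * exp 4 * (1 / (12215/10000 * x\<^sup>2)) = exp 4 * (2 / ((48/5)\<^sup>2 * (12215/10000)))"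
    unfolding x2 using x0 by simp
  also have "\<dots> \<le> 5474/100 * (2 / ((48/5)\<^sup>2 * (12215/10000)))"
    using exp_4_le by (intro mult_right_mono) auto
  also have "\<dots> \<le> 973/1000" by (simp add: power2_eq_square)
  finally show ?thesis .
qed

lemma exp_chord:
  fixes s x :: real
  assumes "0 \<le> s" "s \<le> 4"
  shows "exp (s * x) \<le> (1 - s / 4) + s / 4 * exp (4 * x)"
proof -
  have "exp (4 * ((1 - s/4) *\<^sub>R 0 + (s/4) *\<^sub>R x)) \<le> (1 - s/4) * exp (4 * 0) + s/4 * exp (4 * x)"
    using assms by (intro convex_onD[OF convex_on_exp[of 4]]) auto
  then show ?thesis by simp
qed

text \<open>Each exponential is convex in \<open>s\<close> and lies below its chord between 0 and 4,
  so only \<open>s = 4\<close> has to be estimated numerically; at \<open>s = 0\<close> the weights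
  sum to at most 1.\<close>

lemma weighted_exp_le_1:
  fixes s :: real and w x :: "'i \<Rightarrow> real"
  assumes "finite I" "0 \<le> s" "s \<le> 4" "\<And>i. i \<in> I \<Longrightarrow> 0 \<le> w i" "sum w I \<le> 1"
    and "(\<Sum>i\<in>I. w i * exp (4 * x i)) \<le> 1"
  shows "(\<Sum>i\<in>I. w i * exp (s * x i)) \<le> 1"
proof -
  have "(\<Sum>i\<in>I. w i * exp (s * x i)) \<le> (\<Sum>i\<in>I. w i * ((1 - s / 4) + s / 4 * exp (4 * x i)))"
    using assms by (intro sum_mono mult_left_mono exp_chord) auto
  also have "\<dots> = (1 - s / 4) * sum w I + s / 4 * (\<Sum>i\<in>I. w i * exp (4 * x i))"
    by (simp add: distrib_left sum.distrib sum_distrib_left sum_distrib_right mult_ac)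
  also have "\<dots> \<le> (1 - s / 4) * 1 + s / 4 * 1"
    using assms by (intro add_mono mult_left_mono) auto
  finally show ?thesis by simp
qed

lemma drift_sum_pivot:
  assumes "48 \<le> n" "0 \<le> s" "s \<le> 4"
  shows "(\<Sum>k=1..<n. 2 * real k / (real n * (real n - 1)) * exp (s * drift n k)) \<le> 1"
proof (rule weighted_exp_le_1[OF _ assms(2,3)])
  show "(\<Sum>k=1..<n. 2 * real k / (real n * (real n - 1))) \<le> 1" by (simp only: sum_sizes) simp
  show "(\<Sum>k=1..<n. 2 * real k / (real n * (real n - 1)) * exp (4 * drift n k)) \<le> 1"
    using drift_sum_4[OF assms(1)] by linarith
  show "0 \<le> 2 * real k / (real n * (real n - 1))" if "k \<in> {1..<n}" for k
    using assms(1) by simp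
qed simp

text \<open>Probabilities for a list with the minimum in front: 1 / n for stopping, 1 / n for the
  minimum being in front again, and 2 k / (n (n - 1)) for a size k < n - 1 after two merged steps.
  Compared with the pivot sum, the mass 2 / n of size n - 1 is split into the first two. The
  repeated minimum is covered by the old term, and stopping contributes at most 1/48.\<close>

lemma drift_sum_min:
  assumes n: "48 \<le> n" and s: "0 \<le> s" "s \<le> 4"
  shows "exp (s * (69/10 * (sqrt (real n - 1) - sqrt (real n)) + 1)) / real n
    + exp (s * (2 * real n / sqrt (real n - 1) - 69/10 * sqrt (real n))) / real n
    + (\<Sum>k=1..<n - 1. 2 * real k / (real n * (real n - 1)) * exp (s * drift n k)) \<le> 1"
proof -
  let ?n = "real n"
  \<comment> \<open>The merged step reaches sizes below \<open>n - 1\<close> only, so the indices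
    \<open>n - 1\<close> and \<open>n\<close> are free to encode the repeated minimum and the
    stop.\<close>
  define x where "x k = (if k = n - 1 then 69/10 * (sqrt (?n - 1) - sqrt ?n) + 1
    else if k = n then 2 * ?n / sqrt (?n - 1) - 69/10 * sqrt ?n else drift n k)" for k
  define w where "w k = (if k = n - 1 \<or> k = n then 1 / ?n else 2 * real k / (?n * (?n - 1)))" for k
  have split: "(\<Sum>k=1..n. f k) = f (n - 1) + f n + (\<Sum>k=1..<n - 1. f k)" for f :: "nat \<Rightarrow> real"
  proof -
    have "{1..n} = insert (n - 1) (insert n {1..<n - 1})" using n by auto
    moreover have "n - 1 \<notin> insert n {1..<n - 1}" "n \<notin> {1..<n - 1}" using n by auto
    ultimately show ?thesis by simp
  qed
  have split': "(\<Sum>k=1..<n. f k) = f (n - 1) + (\<Sum>k=1..<n - 1. f k)" for f :: "nat \<Rightarrow> real"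
  proof -
    have "{1..<n} = insert (n - 1) {1..<n - 1}" using n by auto
    then show ?thesis by simp
  qed
  have inner: "(\<Sum>k=1..<n - 1. w k * f (x k)) = (\<Sum>k=1..<n - 1. 2 * real k / (?n * (?n - 1)) * f (drift n k))"
    for f by (intro sum.cong) (auto simp: w_def x_def)
  have last: "2 * real (n - 1) / (?n * (?n - 1)) = 2 / ?n"
  proof -
    have "real (n - 1) = ?n - 1" "?n - 1 \<noteq> 0" using n by auto
    then show ?thesis by (metis mult_divide_mult_cancel_right)
  qed
  have ends: "w (n - 1) = 1 / ?n" "w n = 1 / ?n" "x (n - 1) = 69/10 * (sqrt (?n - 1) - sqrt ?n) + 1"
    "x n = 2 * ?n / sqrt (?n - 1) - 69/10 * sqrt ?n"
    using n by (auto simp: w_def x_def)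
  have "(\<Sum>k=1..n. w k * exp (s * x k)) \<le> 1"
  proof (rule weighted_exp_le_1)
    have "sum w {1..n} = w (n - 1) + w n + (\<Sum>k=1..<n - 1. w k)" by (rule split)
    also have "(\<Sum>k=1..<n - 1. w k) = (\<Sum>k=1..<n - 1. 2 * real k / (?n * (?n - 1)))"
      by (intro sum.cong) (auto simp: w_def)
    also have "\<dots> = 1 - 2 / ?n"
      using split'[of "\<lambda>k. 2 * real k / (?n * (?n - 1))"] sum_sizes[of n] n last by simp
    finally show "sum w {1..n} \<le> 1" unfolding ends by simp
    \<comment> \<open>The factor 2 matches the weight 1 / n of this event with the weight 2 / n of
      size \<open>n - 1\<close> in the pivot sum.\<close>
    have e1: "exp (4 * x (n - 1)) \<le> 2 * exp (4 * drift n (n - 1))"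
    proof -
      have "sqrt (?n - 1) \<le> sqrt ?n" by simp
      then have "x (n - 1) \<le> drift n (n - 1)"
        unfolding ends drift_def using n by (simp add: of_nat_diff)
      then have "exp (4 * x (n - 1)) \<le> exp (4 * drift n (n - 1))" by simp
      then show ?thesis using exp_gt_zero[of "4 * drift n (n - 1)"] by linarith
    qed
    have e2: "exp (4 * x n) \<le> 1"
    proof -
      have "2 * ?n \<le> 69/10 * sqrt ?n * sqrt (?n - 1)"
      proof -
        have "(sqrt ?n / 2)\<^sup>2 \<le> ?n - 1" using n by (simp add: power_divide)
        then have "sqrt ?n / 2 \<le> sqrt (?n - 1)" by (rule real_le_rsqrt)
        then have "69/10 * sqrt ?n * (sqrt ?n / 2) \<le> 69/10 * sqrt ?n * sqrt (?n - 1)"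
          by (intro mult_left_mono) auto
        then show ?thesis by simp
      qed
      then have "x n \<le> 0" unfolding ends using n by (simp add: divide_le_eq)
      then show ?thesis by simp
    qed
    have "(\<Sum>k=1..n. w k * exp (4 * x k)) = w (n - 1) * exp (4 * x (n - 1)) + w n * exp (4 * x n)
        + (\<Sum>k=1..<n - 1. 2 * real k / (?n * (?n - 1)) * exp (4 * drift n k))"
      using split[of "\<lambda>k. w k * exp (4 * x k)"] inner[of "\<lambda>y. exp (4 * y)"] by simp
    also have "\<dots> \<le> 1 / ?n * (2 * exp (4 * drift n (n - 1))) + 1 / ?n * 1
        + (\<Sum>k=1..<n - 1. 2 * real k / (?n * (?n - 1)) * exp (4 * drift n k))"
      unfolding ends(1,2) using e1 e2 by (intro add_mono mult_left_mono) auto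
    also have "\<dots> = (\<Sum>k=1..<n. 2 * real k / (?n * (?n - 1)) * exp (4 * drift n k)) + 1 / ?n"
      unfolding split'[of "\<lambda>k. 2 * real k / (?n * (?n - 1)) * exp (4 * drift n k)"] last by simp
    also have "\<dots> \<le> 973/1000 + 1/48"
      using n by (intro add_mono drift_sum_4 divide_left_mono) auto
    finally show "(\<Sum>k=1..n. w k * exp (4 * x k)) \<le> 1" by simp
  qed (use s n in \<open>auto simp: w_def\<close>)
  then show ?thesis
    using split[of "\<lambda>k. w k * exp (s * x k)"] inner[of "\<lambda>y. exp (s * y)"] unfolding ends by simp
qed

section \<open>Averaging over the arrangements with a given pivot\<close>

text \<open>As \<open>F\<close> has the same average over all places of the minimum, the unknown
  place inside the part drops out, and the part becomes independent of the weight.\<close>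

lemma sum_over_part_eq:
  fixes F w :: "'a::linorder list \<Rightarrow> ennreal"
  assumes "finite \<A>" "\<A> \<subseteq> permutations_of_set S" "finite P" "P \<noteq> {}"
    and "\<And>\<sigma> A. \<sigma> permutes (P - {Min P}) \<Longrightarrow> A \<in> \<A> \<Longrightarrow> map \<sigma> A \<in> \<A>"
    and "\<And>\<sigma> A. \<sigma> permutes (P - {Min P}) \<Longrightarrow> A \<in> \<A> \<Longrightarrow> restr (map \<sigma> A) = map \<sigma> (restr A)"
    and "\<And>\<sigma> A. \<sigma> permutes (P - {Min P}) \<Longrightarrow> A \<in> \<A> \<Longrightarrow> w (map \<sigma> A) = w A"
    and "\<And>A. A \<in> \<A> \<Longrightarrow> restr A \<in> permutations_of_set P"
    and F: "\<And>q. q < card P \<Longrightarrow> (\<Sum>B\<in>arrangements P q. F B) = of_nat (card (arrangements P q)) * c"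
  shows "(\<Sum>A\<in>\<A>. w A * F (restr A)) = (\<Sum>A\<in>\<A>. w A) * c"
proof -
  let ?c = "of_nat (fact (card P - 1)) :: ennreal"
  obtain pos where pos: "\<And>A. A \<in> \<A> \<Longrightarrow> pos A < card P"
    and eq: "?c * (\<Sum>A\<in>\<A>. w A * F (restr A)) = (\<Sum>A\<in>\<A>. w A * (\<Sum>B\<in>arrangements P (pos A). F B))"
    using sum_over_part[OF assms(1-8), where F = F] by blast
  note eq
  also have "(\<Sum>A\<in>\<A>. w A * (\<Sum>B\<in>arrangements P (pos A). F B)) = (\<Sum>A\<in>\<A>. w A * (?c * c))"
    by (intro sum.cong refl) (simp add: F pos card_arrangements[OF assms(3)])
  also have "\<dots> = ?c * ((\<Sum>A\<in>\<A>. w A) * c)"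
    by (simp add: sum_distrib_left sum_distrib_right mult_ac)
  finally show ?thesis
    by (subst (asm) ennreal_mult_cancel_left) auto
qed

lemma sum_over_part_le:
  fixes F w :: "'a::linorder list \<Rightarrow> ennreal"
  assumes "finite \<A>" "\<A> \<subseteq> permutations_of_set S" "finite P" "P \<noteq> {}"
    and "\<And>\<sigma> A. \<sigma> permutes (P - {Min P}) \<Longrightarrow> A \<in> \<A> \<Longrightarrow> map \<sigma> A \<in> \<A>"
    and "\<And>\<sigma> A. \<sigma> permutes (P - {Min P}) \<Longrightarrow> A \<in> \<A> \<Longrightarrow> restr (map \<sigma> A) = map \<sigma> (restr A)"
    and "\<And>\<sigma> A. \<sigma> permutes (P - {Min P}) \<Longrightarrow> A \<in> \<A> \<Longrightarrow> w (map \<sigma> A) = w A"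
    and "\<And>A. A \<in> \<A> \<Longrightarrow> restr A \<in> permutations_of_set P"
    and F: "\<And>q. q < card P \<Longrightarrow> (\<Sum>B\<in>arrangements P q. F B) \<le> of_nat (card (arrangements P q)) * c"
  shows "(\<Sum>A\<in>\<A>. w A * F (restr A)) \<le> (\<Sum>A\<in>\<A>. w A) * c"
proof -
  let ?c = "of_nat (fact (card P - 1)) :: ennreal"
  obtain pos where pos: "\<And>A. A \<in> \<A> \<Longrightarrow> pos A < card P"
    and eq: "?c * (\<Sum>A\<in>\<A>. w A * F (restr A)) = (\<Sum>A\<in>\<A>. w A * (\<Sum>B\<in>arrangements P (pos A). F B))"
    using sum_over_part[OF assms(1-8), where F = F] by blast
  note eq
  also have "(\<Sum>A\<in>\<A>. w A * (\<Sum>B\<in>arrangements P (pos A). F B)) \<le> (\<Sum>A\<in>\<A>. w A * (?c * c))"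
    by (intro sum_mono mult_left_mono order_trans[OF F])
      (simp_all add: pos card_arrangements[OF assms(3)])
  also have "\<dots> = ?c * ((\<Sum>A\<in>\<A>. w A) * c)"
    by (simp add: sum_distrib_left sum_distrib_right mult_ac)
  finally show ?thesis
    by (subst (asm) ennreal_mult_le_mult_iff) auto
qed

text \<open>Lists with a given non-minimal first key. Fixing \<open>v\<close> and
  \<open>Min S\<close> suffices for the symmetry of both parts: \<open>Min S\<close> is the minimum
  of the left part and \<open>v\<close> that of the right part, so exactly the permutations used in
  \<open>sum_over_part\<close> are available.\<close>

locale pivot_class =
  fixes S :: "'a::linorder set" and v :: 'a and \<A> :: "'a list set"
  assumes fin: "finite S" and vS: "v \<in> S" and v_min: "Min S < v"
    and sub: "\<A> \<subseteq> permutations_of_set S" and hd: "\<And>A. A \<in> \<A> \<Longrightarrow> A ! 0 = v"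
    and closed: "\<And>\<sigma> A. \<sigma> permutes (S - {v, Min S}) \<Longrightarrow> A \<in> \<A> \<Longrightarrow> map \<sigma> A \<in> \<A>"
begin

definition "L = {x \<in> S. x < v}"
definition "R = {x \<in> S. v \<le> x}"

lemma finA: "finite \<A>"
  by (rule finite_subset[OF sub]) simp

lemma min_in: "Min S \<in> S"
  by (rule Min_in) (use fin vS in auto)

lemma min_le: "x \<in> S \<Longrightarrow> Min S \<le> x"
  using fin by simp

lemma LR: "finite L" "finite R" "L \<noteq> {}" "R \<noteq> {}" "Min L = Min S" "Min R = v"
  "card L + card R = card S" "1 \<le> card L" "1 \<le> card R"
proof -
  show f: "finite L" "finite R" using fin by (auto simp: L_def R_def)
  show n: "L \<noteq> {}" "R \<noteq> {}" using min_in v_min vS by (auto simp: L_def R_def)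
  show "Min L = Min S"
    by (rule Min_eqI[OF f(1)]) (use min_in v_min min_le in \<open>auto simp: L_def\<close>)
  show "Min R = v"
    by (rule Min_eqI[OF f(2)]) (use vS in \<open>auto simp: R_def\<close>)
  have "S = L \<union> R" "L \<inter> R = {}" by (auto simp: L_def R_def)
  then show "card L + card R = card S" using f card_Un_disjoint by metis
  show "1 \<le> card L" "1 \<le> card R" using f n by (auto simp: Suc_le_eq card_gt_0_iff)
qed

lemma member:
  assumes "A \<in> \<A>"
  shows "set A = S" "distinct A" "length A = card S" "A \<noteq> []" "2 \<le> length A"
    "cut A = card L" "left_part A \<in> permutations_of_set L" "right_part A \<in> permutations_of_set R"
proof -
  have A: "set A = S" "distinct A" using assms sub by (auto dest: permutations_of_setD)
  then show "set A = S" "distinct A" by auto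
  show len: "length A = card S" using A distinct_card by metis
  show "A \<noteq> []" using A vS by auto
  show "2 \<le> length A" using LR(7-9) len by linarith
  note P = parts_of_pivot[OF A(2), of "Min S", unfolded A(1) hd[OF assms], OF min_in v_min]
  show "cut A = card L" using P(5) by (simp add: L_def)
  show "left_part A \<in> permutations_of_set L" "right_part A \<in> permutations_of_set R"
    using P(1-4) by (auto intro!: permutations_of_setI simp: L_def R_def)
qed

text \<open>Shuffling the keys within one side of the pivot, minima fixed, leaves every comparison
  with the pivot unchanged. So the exchanges of the step carry no information on the order of the
  keys inside the parts.\<close>

lemma map_parts:
  assumes A: "A \<in> \<A>" and \<sigma>: "\<sigma> permutes (L - {Min L}) \<or> \<sigma> permutes (R - {Min R})"
  shows "map \<sigma> A \<in> \<A>" "swaps (map \<sigma> A) = swaps A"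
    "left_part (map \<sigma> A) = map \<sigma> (left_part A)" "right_part (map \<sigma> A) = map \<sigma> (right_part A)"
proof -
  have "\<sigma> permutes (S - {v, Min S})"
    using \<sigma>
  proof
    assume "\<sigma> permutes (L - {Min L})"
    then show ?thesis unfolding LR(5) by (rule permutes_subset) (auto simp: L_def)
  next
    assume "\<sigma> permutes (R - {Min R})"
    then show ?thesis unfolding LR(6) by (rule permutes_subset) (use v_min in \<open>auto simp: R_def\<close>)
  qed
  then show "map \<sigma> A \<in> \<A>" using closed A by blast
  have \<sigma>v: "\<sigma> v = v"
    using \<sigma> unfolding LR(5,6) by (auto simp: permutes_def L_def)
  have side: "\<sigma> x < v \<longleftrightarrow> x < v" if "x \<in> S" for x
    using \<sigma>
  proof
    assume p: "\<sigma> permutes (L - {Min L})"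
    show ?thesis
    proof (cases "x \<in> L - {Min L}")
      case True
      moreover have "\<sigma> x \<in> L - {Min L}" using True p by (simp only: permutes_in_image)
      ultimately show ?thesis by (auto simp: L_def)
    next
      case False
      then show ?thesis using p by (simp add: permutes_def)
    qed
  next
    assume p: "\<sigma> permutes (R - {Min R})"
    show ?thesis
    proof (cases "x \<in> R - {Min R}")
      case True
      moreover have "\<sigma> x \<in> R - {Min R}" using True p by (simp only: permutes_in_image)
      ultimately show ?thesis by (auto simp: R_def)
    next
      case False
      then show ?thesis using p by (simp add: permutes_def)
    qed
  qed
  have inj: "\<sigma> x = v \<longleftrightarrow> x = v" for x
  proof
    assume "\<sigma> x = v"
    then have "\<sigma> x = \<sigma> v" using \<sigma>v by simp
    moreover have "inj \<sigma>" using \<sigma> by (auto dest: permutes_inj)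
    ultimately show "x = v" by (simp add: inj_eq)
  qed (simp add: \<sigma>v)
  have ss: "same_side \<sigma> (A ! 0) (set A)"
    unfolding same_side_def hd[OF A] member(1)[OF A]
  proof (intro ballI conjI)
    fix x assume x: "x \<in> S"
    show "\<sigma> x \<le> v \<longleftrightarrow> x \<le> v" unfolding le_less using side[OF x] inj[of x] by blast
    show "v \<le> \<sigma> x \<longleftrightarrow> v \<le> x" unfolding not_less[symmetric] using side[OF x] by blast
  qed
  note P = parts_map[OF ss _ member(4)[OF A], unfolded hd[OF A], OF \<sigma>v]
  show "swaps (map \<sigma> A) = swaps A" "left_part (map \<sigma> A) = map \<sigma> (left_part A)"
    "right_part (map \<sigma> A) = map \<sigma> (right_part A)" using P by auto
qed

text \<open>The weight expresses conditioning on the exchanges: given these, the left part is still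
  a mixture of uniform arrangements. The next three lemmas are the variants for the right part and
  for inequalities.\<close>

lemma left_eq:
  fixes W :: "nat \<Rightarrow> ennreal"
  assumes "\<And>q. q < card L \<Longrightarrow> (\<Sum>B\<in>arrangements L q. F B) = of_nat (card (arrangements L q)) * c"
  shows "(\<Sum>A\<in>\<A>. W (swaps A) * F (left_part A)) = (\<Sum>A\<in>\<A>. W (swaps A)) * c"
  by (rule sum_over_part_eq[OF finA sub LR(1,3),
      where restr = left_part and w = "\<lambda>A. W (swaps A)" and F = F])
    (simp_all add: map_parts member assms)

lemma right_eq:
  fixes W :: "nat \<Rightarrow> ennreal"
  assumes "\<And>q. q < card R \<Longrightarrow> (\<Sum>B\<in>arrangements R q. F B) = of_nat (card (arrangements R q)) * c"
  shows "(\<Sum>A\<in>\<A>. W (swaps A) * F (right_part A)) = (\<Sum>A\<in>\<A>. W (swaps A)) * c"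
  by (rule sum_over_part_eq[OF finA sub LR(2,4),
      where restr = right_part and w = "\<lambda>A. W (swaps A)" and F = F])
    (simp_all add: map_parts member assms)

lemma left_le:
  fixes W :: "nat \<Rightarrow> ennreal"
  assumes "\<And>q. q < card L \<Longrightarrow> (\<Sum>B\<in>arrangements L q. F B) \<le> of_nat (card (arrangements L q)) * c"
  shows "(\<Sum>A\<in>\<A>. W (swaps A) * F (left_part A)) \<le> (\<Sum>A\<in>\<A>. W (swaps A)) * c"
  by (rule sum_over_part_le[OF finA sub LR(1,3),
      where restr = left_part and w = "\<lambda>A. W (swaps A)" and F = F])
    (simp_all add: map_parts member assms)

lemma right_le:
  fixes W :: "nat \<Rightarrow> ennreal"
  assumes "\<And>q. q < card R \<Longrightarrow> (\<Sum>B\<in>arrangements R q. F B) \<le> of_nat (card (arrangements R q)) * c"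
  shows "(\<Sum>A\<in>\<A>. W (swaps A) * F (right_part A)) \<le> (\<Sum>A\<in>\<A>. W (swaps A)) * c"
  by (rule sum_over_part_le[OF finA sub LR(2,4),
      where restr = right_part and w = "\<lambda>A. W (swaps A)" and F = F])
    (simp_all add: map_parts member assms)

end

section \<open>Frequencies of the pivots and of the sizes\<close>

lemma bij_betw_rank:
  fixes S :: "'a::linorder set"
  assumes "finite S" "S \<noteq> {}"
  shows "bij_betw (\<lambda>v. card {x \<in> S. x < v}) (S - {Min S}) {1..<card S}"
proof -
  let ?f = "\<lambda>v. card {x \<in> S. x < v}"
  have less: "?f v < ?f w" if "v \<in> S" "v < w" for v w
    using that assms(1) by (intro psubset_card_mono) auto
  have inj: "inj_on ?f (S - {Min S})"
  proof (rule linorder_inj_onI')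
    fix v w assume "v \<in> S - {Min S}" "v < w"
    then show "?f v \<noteq> ?f w" using less[of v w] by simp
  qed
  have "?f ` (S - {Min S}) \<subseteq> {1..<card S}"
  proof (intro image_subsetI)
    fix v assume v: "v \<in> S - {Min S}"
    have "Min S \<in> {x \<in> S. x < v}" using v assms by (auto simp: less_le)
    then have "1 \<le> ?f v" using assms(1) by (auto simp: Suc_le_eq card_gt_0_iff)
    moreover have "?f v < card S" using v assms(1) by (intro psubset_card_mono) auto
    ultimately show "?f v \<in> {1..<card S}" by simp
  qed
  moreover have "card (S - {Min S}) = card {1..<card S}"
    using assms by simp
  ultimately show ?thesis
    using inj assms(1) by (intro bij_betw_imageI) (auto simp: card_image card_subset_eq)
qed

text \<open>A family of lists symmetric in all non-minimal keys, none starting with the minimum.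
  Every non-minimal key is then equally often the first one, so the size of the left part is uniform
  on {1..<card S}.\<close>

locale pivot_family =
  fixes S :: "'a::linorder set" and \<D> :: "'a list set"
  assumes finS: "finite S" "2 \<le> card S"
    and D_sub: "\<D> \<subseteq> permutations_of_set S" and D_hd: "\<And>A. A \<in> \<D> \<Longrightarrow> A ! 0 \<noteq> Min S"
    and D_closed: "\<And>\<sigma> A. \<sigma> permutes (S - {Min S}) \<Longrightarrow> A \<in> \<D> \<Longrightarrow> map \<sigma> A \<in> \<D>"
begin

definition "cls v = {A \<in> \<D>. A ! 0 = v}"

lemma D_fin: "finite \<D>"
  by (rule finite_subset[OF D_sub]) simp

lemma S_ne: "S \<noteq> {}" using finS by auto

lemma D_member: "A \<in> \<D> \<Longrightarrow> set A = S \<and> distinct A \<and> A \<noteq> []"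
proof -
  assume "A \<in> \<D>"
  then have "set A = S" "distinct A" using D_sub by (auto dest: permutations_of_setD)
  then show ?thesis using S_ne by auto
qed

lemma cls_pivot: "v \<in> S - {Min S} \<Longrightarrow> pivot_class S v (cls v)"
proof
  fix \<sigma> A assume v: "v \<in> S - {Min S}" and \<sigma>: "\<sigma> permutes (S - {v, Min S})" and A: "A \<in> cls v"
  have "\<sigma> permutes (S - {Min S})" using \<sigma> by (rule permutes_subset) auto
  moreover have "\<sigma> v = v" using \<sigma> by (simp add: permutes_def)
  ultimately show "map \<sigma> A \<in> cls v"
    using A D_closed D_member[of A] by (auto simp: cls_def)
qed (use finS D_sub in \<open>auto simp: cls_def less_le\<close>)

lemma card_cls:
  assumes "v \<in> S - {Min S}" "w \<in> S - {Min S}"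
  shows "card (cls v) = card (cls w)"
proof -
  have le: "card (cls v) \<le> card (cls w)" if v: "v \<in> S - {Min S}" and w: "w \<in> S - {Min S}" for v w
  proof (rule card_inj_on_le)
    let ?\<sigma> = "Transposition.transpose v w"
    have p: "?\<sigma> permutes (S - {Min S})" using v w by (intro permutes_swap_id) auto
    then have "inj (map ?\<sigma>)" by (simp add: permutes_inj)
    then show "inj_on (map ?\<sigma>) (cls v)" by (rule inj_on_subset) simp
    show "map ?\<sigma> ` cls v \<subseteq> cls w"
      using D_closed[OF p] D_member by (auto simp: cls_def)
    show "finite (cls w)" using D_fin by (simp add: cls_def)
  qed
  show ?thesis using le[OF assms] le[OF assms(2,1)] by simp
qed

text \<open>The common size of all classes; \<open>Max S\<close> is just one representative of the
  non-minimal keys.\<close>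

definition "c0 = card (cls (Max S))"

lemma Max_ne: "Max S \<in> S - {Min S}"
proof -
  have "Max S \<noteq> Min S"
  proof
    assume eq: "Max S = Min S"
    have "x = Min S" if "x \<in> S" for x
      using that finS(1) eq by (metis Max_ge Min_le antisym)
    then have "S \<subseteq> {Min S}" by blast
    then have "card S \<le> 1" using card_mono[of "{Min S}" S] by simp
    then show False using finS(2) by simp
  qed
  then show ?thesis using finS(1) S_ne by simp
qed

lemma D_sum: "(\<Sum>A\<in>\<D>. g A) = (\<Sum>v\<in>S - {Min S}. \<Sum>A\<in>cls v. g A)"
proof -
  have "(\<Sum>v\<in>S - {Min S}. \<Sum>A | A \<in> \<D> \<and> A ! 0 = v. g A) = (\<Sum>A\<in>\<D>. g A)"
  proof (rule sum.group[OF D_fin])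
    show "(\<lambda>A. A ! 0) ` \<D> \<subseteq> S - {Min S}"
    proof (intro image_subsetI)
      fix A assume A: "A \<in> \<D>"
      then have "A ! 0 \<in> set A" using D_member by (intro nth_mem) auto
      then show "A ! 0 \<in> S - {Min S}" using D_member[OF A] D_hd[OF A] by simp
    qed
  qed (use finS in simp)
  then show ?thesis by (simp add: cls_def)
qed

lemma card_D: "card \<D> = (card S - 1) * c0"
proof -
  have "card \<D> = (\<Sum>A\<in>\<D>. 1)" by simp
  also have "\<dots> = (\<Sum>v\<in>S - {Min S}. c0)"
    unfolding D_sum by (intro sum.cong refl) (auto simp: c0_def intro!: card_cls Max_ne)
  finally show ?thesis using finS S_ne by simp
qed

text \<open>Every size occurs twice, once as a left part and once as a right part.\<close>

lemma sum_sizes_sym: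
  fixes h :: "nat \<Rightarrow> 'b::comm_semiring_1"
  shows "(\<Sum>v\<in>S - {Min S}. h (card {x \<in> S. x < v}) + h (card S - card {x \<in> S. x < v}))
    = 2 * (\<Sum>k=1..<card S. h k)"
proof -
  have "(\<Sum>v\<in>S - {Min S}. h (card {x \<in> S. x < v}) + h (card S - card {x \<in> S. x < v}))
      = (\<Sum>k=1..<card S. h k + h (card S - k))"
    by (rule sum.reindex_bij_betw[OF bij_betw_rank[OF finS(1) S_ne]])
  also have "\<dots> = (\<Sum>k=1..<card S. h k) + (\<Sum>k=1..<card S. h (card S - k))"
    by (rule sum.distrib)
  also have "(\<Sum>k=1..<card S. h (card S - k)) = (\<Sum>k=1..<card S. h k)"
    by (rule sum.reindex_bij_witness[of _ "\<lambda>k. card S - k" "\<lambda>k. card S - k"]) auto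
  finally show ?thesis by (simp add: mult_2)
qed

lemma family_eq:
  fixes g :: "'a list \<Rightarrow> ennreal"
  assumes "\<And>v. v \<in> S - {Min S} \<Longrightarrow> (\<Sum>A\<in>cls v. g A) =
    of_nat (card (cls v)) * (h (card {x \<in> S. x < v}) + h (card S - card {x \<in> S. x < v}))"
  shows "(\<Sum>A\<in>\<D>. g A) = of_nat c0 * (2 * (\<Sum>k=1..<card S. h k))"
proof -
  have "(\<Sum>A\<in>\<D>. g A) = (\<Sum>v\<in>S - {Min S}. of_nat c0 *
      (h (card {x \<in> S. x < v}) + h (card S - card {x \<in> S. x < v})))"
    unfolding D_sum
  proof (rule sum.cong[OF refl])
    fix v assume v: "v \<in> S - {Min S}"
    show "(\<Sum>A\<in>cls v. g A) = of_nat c0 * (h (card {x \<in> S. x < v}) + h (card S - card {x \<in> S. x < v}))"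
      using assms[OF v] card_cls[OF Max_ne v] by (simp add: c0_def)
  qed
  then show ?thesis by (simp only: sum_distrib_left[symmetric] sum_sizes_sym)
qed

lemma family_le:
  fixes g :: "'a list \<Rightarrow> ennreal"
  assumes "\<And>v. v \<in> S - {Min S} \<Longrightarrow> (\<Sum>A\<in>cls v. g A) \<le>
    of_nat (card (cls v)) * (h (card {x \<in> S. x < v}) + h (card S - card {x \<in> S. x < v}))"
  shows "(\<Sum>A\<in>\<D>. g A) \<le> of_nat c0 * (2 * (\<Sum>k=1..<card S. h k))"
proof -
  have "(\<Sum>A\<in>\<D>. g A) \<le> (\<Sum>v\<in>S - {Min S}. of_nat c0 *
      (h (card {x \<in> S. x < v}) + h (card S - card {x \<in> S. x < v})))"
    unfolding D_sum
  proof (rule sum_mono)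
    fix v assume v: "v \<in> S - {Min S}"
    show "(\<Sum>A\<in>cls v. g A) \<le> of_nat c0 * (h (card {x \<in> S. x < v}) + h (card S - card {x \<in> S. x < v}))"
      using assms[OF v] card_cls[OF Max_ne v] by (simp add: c0_def)
  qed
  then show ?thesis by (simp only: sum_distrib_left[symmetric] sum_sizes_sym)
qed

end

section \<open>The coupling kernel\<close>

definition unit_law :: "real measure \<Rightarrow> bool" where
  "unit_law \<nu> \<longleftrightarrow> prob_space \<nu> \<and> sets \<nu> = sets borel \<and> (AE x in \<nu>. 0 \<le> x \<and> x \<le> 1)"

abbreviation cell :: "real \<Rightarrow> real \<Rightarrow> real measure" where
  "cell a b \<equiv> uniform_measure lborel {a<..b}"

text \<open>
  The conditional law of the perpetuity when its first uniform variable falls into the given cell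
  and the remaining part has the given law.
\<close>

definition refine :: "real measure \<Rightarrow> real \<Rightarrow> real \<Rightarrow> real measure" where
  "refine \<nu> a b = distr (\<nu> \<Otimes>\<^sub>M cell a b) borel (\<lambda>(x, u). step x u)"

lemma prob_space_cell: "a < b \<Longrightarrow> prob_space (cell a b)"
  by (rule prob_space_uniform_measure) auto

lemma AE_cell: "AE u in cell a b. u \<in> {a<..b}"
  by (rule AE_uniform_measureI) auto

lemma unit_law_limit: "unit_law limit_law"
proof -
  have r: "real_distribution limit_law"
    using limit_law_solves unfolding solves_fixed_point_def by (rule conjunct1)
  then interpret real_distribution limit_law .
  show ?thesis unfolding unit_law_def using AE_limit_law prob_space_axioms by simp
qed

lemma nn_integral_refine:
  assumes "unit_law \<nu>" "a < b" "f \<in> borel_measurable borel"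
  shows "(\<integral>\<^sup>+x. f x \<partial>refine \<nu> a b) = (\<integral>\<^sup>+x. (\<integral>\<^sup>+u. f (step x u) \<partial>cell a b) \<partial>\<nu>)"
    and "(\<integral>\<^sup>+x. f x \<partial>refine \<nu> a b) = (\<integral>\<^sup>+u. (\<integral>\<^sup>+x. f (step x u) \<partial>\<nu>) \<partial>cell a b)"
proof -
  have \<nu>: "prob_space \<nu>" "sets \<nu> = sets borel" using assms(1) by (auto simp: unit_law_def)
  have U: "prob_space (cell a b)" "sets (cell a b) = sets borel"
    using assms(2) by (auto intro: prob_space_cell)
  show "(\<integral>\<^sup>+x. f x \<partial>refine \<nu> a b) = (\<integral>\<^sup>+x. (\<integral>\<^sup>+u. f (step x u) \<partial>cell a b) \<partial>\<nu>)"
    unfolding refine_def by (rule nn_integral_distr_step(1)[OF \<nu> U assms(3)])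
  show "(\<integral>\<^sup>+x. f x \<partial>refine \<nu> a b) = (\<integral>\<^sup>+u. (\<integral>\<^sup>+x. f (step x u) \<partial>\<nu>) \<partial>cell a b)"
    unfolding refine_def by (rule nn_integral_distr_step(2)[OF \<nu> U assms(3)])
qed

lemma unit_law_refine:
  assumes "unit_law \<nu>" "0 \<le> a" "a < b" "b \<le> 1"
  shows "unit_law (refine \<nu> a b)"
proof -
  interpret \<nu>: prob_space \<nu> using assms by (simp add: unit_law_def)
  interpret U: prob_space "cell a b" using assms by (intro prob_space_cell)
  interpret P: pair_prob_space \<nu> "cell a b" ..
  have [measurable_cong]: "sets \<nu> = sets borel" using assms by (simp add: unit_law_def)
  have "prob_space (refine \<nu> a b)"
    unfolding refine_def by (rule P.prob_space_distr) measurable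
  moreover have "AE x in refine \<nu> a b. 0 \<le> x \<and> x \<le> 1"
  proof -
    have "(\<integral>\<^sup>+x. indicator {x. \<not> (0 \<le> x \<and> x \<le> 1)} x \<partial>refine \<nu> a b)
        = (\<integral>\<^sup>+x. (\<integral>\<^sup>+u. indicator {x. \<not> (0 \<le> x \<and> x \<le> 1)} (step x u) \<partial>cell a b) \<partial>\<nu>)"
      by (rule nn_integral_refine(1)[OF assms(1,3)]) measurable
    also have "\<dots> = (\<integral>\<^sup>+x. 0 \<partial>\<nu>)"
    proof (rule nn_integral_cong_AE)
      have "AE x in \<nu>. 0 \<le> x \<and> x \<le> 1" using assms by (simp add: unit_law_def)
      then show "AE x in \<nu>. (\<integral>\<^sup>+u. indicator {x. \<not> (0 \<le> x \<and> x \<le> 1)} (step x u) \<partial>cell a b) = 0"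
      proof eventually_elim
        case (elim x)
        have "(\<integral>\<^sup>+u. indicator {x. \<not> (0 \<le> x \<and> x \<le> 1)} (step x u) \<partial>cell a b) = (\<integral>\<^sup>+u. 0 \<partial>cell a b)"
        proof (rule nn_integral_cong_AE)
          show "AE u in cell a b. (indicator {x. \<not> (0 \<le> x \<and> x \<le> 1)} (step x u) :: ennreal) = 0"
            using AE_cell[of a b]
          proof eventually_elim
            case (elim u)
            then show ?case
              using step_range[of x u] \<open>0 \<le> x \<and> x \<le> 1\<close> assms by auto
          qed
        qed
        then show ?case by simp
      qed
    qed
    finally show ?thesis
      by (subst AE_iff_nn_integral) (simp_all add: refine_def)
  qed
  moreover have "sets (refine \<nu> a b) = sets borel" by (simp add: refine_def)
  ultimately show ?thesis unfolding unit_law_def by blast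
qed

definition slice :: "(real \<Rightarrow> ennreal) \<Rightarrow> real \<Rightarrow> ennreal" where
  "slice f u = (\<integral>\<^sup>+x. f (step x u) \<partial>limit_law)"

text \<open>The contribution to E f(X) of the event that the first uniform variable falls into (a,
  b]. It is additive over adjacent cells, and (0, 1] gives all of E f(X).\<close>

definition cell_mass :: "(real \<Rightarrow> ennreal) \<Rightarrow> real \<Rightarrow> real \<Rightarrow> ennreal" where
  "cell_mass f a b = (\<integral>\<^sup>+u. slice f u * indicator {a<..b} u \<partial>lborel)"

lemma slice_measurable [measurable]:
  assumes [measurable]: "f \<in> borel_measurable borel"
  shows "slice f \<in> borel_measurable borel"
proof -
  interpret prob_space limit_law using unit_law_limit by (simp add: unit_law_def)
  have [measurable_cong]: "sets limit_law = sets borel" using unit_law_limit by (simp add: unit_law_def)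
  show ?thesis unfolding slice_def by measurable
qed

lemma nn_integral_refine_limit:
  assumes "a < b" and [measurable]: "f \<in> borel_measurable borel"
  shows "(\<integral>\<^sup>+x. f x \<partial>refine limit_law a b) = cell_mass f a b / ennreal (b - a)"
proof -
  have "(\<integral>\<^sup>+x. f x \<partial>refine limit_law a b) = (\<integral>\<^sup>+u. slice f u \<partial>cell a b)"
    unfolding slice_def by (rule nn_integral_refine(2)[OF unit_law_limit assms])
  also have "\<dots> = (\<integral>\<^sup>+u. slice f u * indicator {a<..b} u \<partial>lborel) / emeasure lborel {a<..b}"
    by (rule nn_integral_uniform_measure) auto
  finally show ?thesis using assms(1) by (simp add: cell_mass_def)
qed

lemma nn_integral_limit_law:
  assumes [measurable]: "f \<in> borel_measurable borel"
  shows "(\<integral>\<^sup>+x. f x \<partial>limit_law) = cell_mass f 0 1"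
proof -
  have eq: "limit_law = distr (limit_law \<Otimes>\<^sub>M unit_uniform) borel (\<lambda>(x, u). step x u)"
    using limit_law_solves unfolding solves_fixed_point_def step_def by (rule conjunct2)
  have "(\<integral>\<^sup>+x. f x \<partial>limit_law)
      = (\<integral>\<^sup>+x. f x \<partial>distr (limit_law \<Otimes>\<^sub>M unit_uniform) borel (\<lambda>(x, u). step x u))"
    by (rule arg_cong[OF eq])
  also have "\<dots> = (\<integral>\<^sup>+u. slice f u \<partial>unit_uniform)"
    unfolding slice_def
    by (rule nn_integral_distr_step(2))
      (use unit_law_limit prob_space_unit_uniform in \<open>auto simp: unit_law_def\<close>)
  also have "\<dots> = (\<integral>\<^sup>+u. slice f u * indicator {0..1} u \<partial>lborel) / emeasure lborel {0..1::real}"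
    by (rule nn_integral_uniform_measure) auto
  also have "\<dots> = (\<integral>\<^sup>+u. slice f u * indicator {0..1} u \<partial>lborel)"
    by (simp add: divide_ennreal_def)
  also have "\<dots> = cell_mass f 0 1"
    unfolding cell_mass_def
  proof (rule nn_integral_cong_AE)
    show "AE u in lborel. slice f u * indicator {0..1} u = slice f u * indicator {0<..1} u"
      using AE_lborel_singleton[of "0::real"] by eventually_elim (auto split: split_indicator)
  qed
  finally show ?thesis .
qed

lemma cell_mass_add:
  assumes "a \<le> b" "b \<le> c" and [measurable]: "f \<in> borel_measurable borel"
  shows "cell_mass f a b + cell_mass f b c = cell_mass f a c"
proof -
  have "cell_mass f a b + cell_mass f b c
      = (\<integral>\<^sup>+u. slice f u * indicator {a<..b} u + slice f u * indicator {b<..c} u \<partial>lborel)"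
    unfolding cell_mass_def by (rule nn_integral_add[symmetric]) measurable
  also have "\<dots> = cell_mass f a c"
    unfolding cell_mass_def
  proof (rule nn_integral_cong)
    fix u
    have "indicator {a<..b} u + indicator {b<..c} u = (indicator {a<..c} u :: ennreal)"
      using assms(1,2) by (auto simp: indicator_def)
    then show "slice f u * indicator {a<..b} u + slice f u * indicator {b<..c} u
        = slice f u * indicator {a<..c} u"
      by (simp only: distrib_left[symmetric])
  qed
  finally show ?thesis .
qed

lemma cell_mass_sum:
  assumes "incseq t" "f \<in> borel_measurable borel"
  shows "(\<Sum>k=1..<Suc n. cell_mass f (t (k - 1)) (t k)) = cell_mass f (t 0) (t n)"
proof (induction n)
  case 0
  show ?case by (simp add: cell_mass_def)
next
  case (Suc n)
  have "(\<Sum>k=1..<Suc (Suc n). cell_mass f (t (k - 1)) (t k))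
      = cell_mass f (t 0) (t n) + cell_mass f (t n) (t (Suc n))"
    using Suc by simp
  also have "\<dots> = cell_mass f (t 0) (t (Suc n))"
    using assms(1) by (intro cell_mass_add assms(2)) (simp_all add: incseq_def)
  finally show ?case .
qed

text \<open>
  If the first key is not the minimum, \<open>pivot_cell n k\<close> is the probability that the sub-list
  containing the rank has at most \<open>k\<close> elements. The value \<open>min_cell m k\<close> is the analogue for lists of
  length \<open>m + 1\<close> with the minimum in front, two partitioning steps merged and a stop counted as
  size 0, given that the minimum is not in front again after the first step.
\<close>

definition pivot_cell :: "nat \<Rightarrow> nat \<Rightarrow> real" where
  "pivot_cell n k = real (k * (k + 1)) / real (n * (n - 1))"

definition min_cell :: "nat \<Rightarrow> nat \<Rightarrow> real" where
  "min_cell m k = real (k * k + k + m) / real (m * m)"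

text \<open>
  The kernel follows the algorithm. If the minimum comes first, the search stops for rank 1, which
  is matched with small values of the perpetuity; the other ranks lose only the minimum, and the
  next partitioning step is merged with this one.
\<close>

function nu :: "'a::linorder list \<Rightarrow> nat \<Rightarrow> real measure" where
  "nu A r =
    (if length A < 48 then limit_law
     else if A ! 0 \<noteq> Min (set A) then
       (if r \<le> cut A
        then refine (nu (left_part A) r)
          (pivot_cell (length A) (cut A - 1)) (pivot_cell (length A) (cut A))
        else refine (nu (right_part A) (r - cut A))
          (pivot_cell (length A) (length A - cut A - 1)) (pivot_cell (length A) (length A - cut A)))
     else if r \<le> 1 then refine limit_law 0 (min_cell (length A - 1) 0)
     else if tl A ! 0 \<noteq> Min (set (tl A)) then
       (if r - 1 \<le> cut (tl A)
        then refine (nu (left_part (tl A)) (r - 1))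
          (min_cell (length (tl A)) (cut (tl A) - 1)) (min_cell (length (tl A)) (cut (tl A)))
        else refine (nu (right_part (tl A)) (r - 1 - cut (tl A)))
          (min_cell (length (tl A)) (length (tl A) - cut (tl A) - 1))
          (min_cell (length (tl A)) (length (tl A) - cut (tl A))))
     else nu (tl A) (r - 1))"
  by pat_completeness auto
termination
proof (relation "Wellfounded.measure (\<lambda>(A, r). length A)", goal_cases)
  case (2 A r)
  then show ?case using cut_bounds[of A] by auto
next
  case (3 A r)
  then show ?case using cut_bounds[of A] by auto
next
  case (4 A r)
  then have "2 \<le> length (tl A)" by simp
  from cut_bounds[OF this] show ?case using 4 by auto
next
  case (5 A r)
  then have "2 \<le> length (tl A)" by simp
  from cut_bounds[OF this] show ?case using 5 by auto
next
  case (6 A r)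
  then show ?case by auto
qed simp

declare nu.simps [simp del]

text \<open>The common shape of the two recursive cases of \<open>nu\<close> that follow a
  non-minimal pivot, with the cell boundaries \<open>t\<close> left open so that the averaging is
  carried out once for both.\<close>

definition descend :: "(nat \<Rightarrow> real) \<Rightarrow> 'a::linorder list \<Rightarrow> nat \<Rightarrow> real measure" where
  "descend t A r = (if r \<le> cut A
     then refine (nu (left_part A) r) (t (cut A - 1)) (t (cut A))
     else refine (nu (right_part A) (r - cut A)) (t (length A - cut A - 1)) (t (length A - cut A)))"

lemma nu_base: "length A < 48 \<Longrightarrow> nu A r = limit_law"
  by (simp add: nu.simps)

lemma nu_pivot:
  "48 \<le> length A \<Longrightarrow> A ! 0 \<noteq> Min (set A) \<Longrightarrow> nu A r = descend (pivot_cell (length A)) A r"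
  unfolding nu.simps[of A r] by (simp add: descend_def)

lemma nu_stop:
  "48 \<le> length A \<Longrightarrow> A ! 0 = Min (set A) \<Longrightarrow> nu A 1 = refine limit_law 0 (min_cell (length A - 1) 0)"
  unfolding nu.simps[of A 1] by simp

lemma nu_lazy:
  "48 \<le> length A \<Longrightarrow> A ! 0 = Min (set A) \<Longrightarrow> tl A ! 0 = Min (set (tl A)) \<Longrightarrow> 1 \<le> r \<Longrightarrow>
    nu A (Suc r) = nu (tl A) r"
  unfolding nu.simps[of A "Suc r"] by simp

lemma nu_min:
  "48 \<le> length A \<Longrightarrow> A ! 0 = Min (set A) \<Longrightarrow> tl A ! 0 \<noteq> Min (set (tl A)) \<Longrightarrow> 1 \<le> r \<Longrightarrow>
    nu A (Suc r) = descend (min_cell (length (tl A))) (tl A) r"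
  unfolding nu.simps[of A "Suc r"] by (simp add: descend_def)

lemma incseq_pivot_cell: "incseq (pivot_cell n)"
  unfolding pivot_cell_def by (intro incseq_SucI divide_right_mono) auto

lemma incseq_min_cell: "incseq (min_cell m)"
  unfolding min_cell_def by (intro incseq_SucI divide_right_mono) auto

lemma pivot_cell_bounds:
  assumes "1 \<le> k" "k < n"
  shows "0 \<le> pivot_cell n (k - 1)" "pivot_cell n (k - 1) < pivot_cell n k" "pivot_cell n k \<le> 1"
    "pivot_cell n k - pivot_cell n (k - 1) = 2 * real k / (real n * (real n - 1))"
    "pivot_cell n 0 = 0" "pivot_cell n (n - 1) = 1"
    "pivot_cell n (k - 1) = real k * (real k - 1) / (real n * (real n - 1))"
    "pivot_cell n k = real k * (real k + 1) / (real n * (real n - 1))"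
proof -
  have n: "0 < real n * (real n - 1)" using assms by simp
  show lo: "pivot_cell n (k - 1) = real k * (real k - 1) / (real n * (real n - 1))"
    and hi: "pivot_cell n k = real k * (real k + 1) / (real n * (real n - 1))"
    using assms by (auto simp: pivot_cell_def of_nat_diff algebra_simps)
  show "pivot_cell n k - pivot_cell n (k - 1) = 2 * real k / (real n * (real n - 1))"
    unfolding lo hi diff_divide_distrib[symmetric] by (simp add: algebra_simps)
  show "pivot_cell n (k - 1) < pivot_cell n k"
    unfolding lo hi using n assms by (intro divide_strict_right_mono) auto
  show "0 \<le> pivot_cell n (k - 1)" by (simp add: pivot_cell_def)
  show "pivot_cell n 0 = 0" by (simp add: pivot_cell_def)
  show one: "pivot_cell n (n - 1) = 1" using assms by (simp add: pivot_cell_def mult.commute)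
  have "pivot_cell n k \<le> pivot_cell n (n - 1)"
    using incseq_pivot_cell assms by (auto simp: incseq_def)
  then show "pivot_cell n k \<le> 1" using one by simp
qed

lemma min_cell_bounds:
  assumes "1 \<le> k" "k < m"
  shows "0 \<le> min_cell m (k - 1)" "min_cell m (k - 1) < min_cell m k" "min_cell m k \<le> 1"
    "min_cell m k - min_cell m (k - 1) = 2 * real k / (real m)\<^sup>2"
    "min_cell m 0 = 1 / real m" "min_cell m (m - 1) = 1"
    "min_cell m (k - 1) = ((real k)\<^sup>2 - real k + real m) / (real m)\<^sup>2"
    "min_cell m k = ((real k)\<^sup>2 + real k + real m) / (real m)\<^sup>2"
proof -
  have m: "0 < (real m)\<^sup>2" using assms by simp
  show hi: "min_cell m k = ((real k)\<^sup>2 + real k + real m) / (real m)\<^sup>2"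
    by (simp add: min_cell_def power2_eq_square)
  obtain i where i: "k = Suc i" using assms by (cases k) auto
  show lo: "min_cell m (k - 1) = ((real k)\<^sup>2 - real k + real m) / (real m)\<^sup>2"
    unfolding i by (simp add: min_cell_def power2_eq_square algebra_simps)
  show "min_cell m k - min_cell m (k - 1) = 2 * real k / (real m)\<^sup>2"
    unfolding lo hi diff_divide_distrib[symmetric] by simp
  show "min_cell m (k - 1) < min_cell m k"
    unfolding lo hi using m assms by (intro divide_strict_right_mono) auto
  show "0 \<le> min_cell m (k - 1)" by (simp add: min_cell_def)
  show "min_cell m 0 = 1 / real m" using assms by (simp add: min_cell_def)
  obtain j where j: "m = Suc j" using assms by (cases m) auto
  show one: "min_cell m (m - 1) = 1"
  proof -
    have "(m - 1) * (m - 1) + (m - 1) + m = m * m" unfolding j by simp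
    then show ?thesis using assms by (simp add: min_cell_def)
  qed
  have "min_cell m k \<le> min_cell m (m - 1)"
    using incseq_min_cell assms by (auto simp: incseq_def)
  then show "min_cell m k \<le> 1" using one by simp
qed

lemma unit_law_descend:
  fixes A :: "'a::linorder list"
  assumes "2 \<le> length A" and "\<And>(B :: 'a list) r. length B < length A \<Longrightarrow> unit_law (nu B r)"
    and "\<And>k. 1 \<le> k \<Longrightarrow> k < length A \<Longrightarrow> 0 \<le> t (k - 1) \<and> t (k - 1) < t k \<and> t k \<le> 1"
  shows "unit_law (descend t A r)"
proof -
  note b = cut_bounds[OF assms(1)]
  have "unit_law (nu (left_part A) r)" "unit_law (nu (right_part A) (r - cut A))"
    using b by (simp_all add: assms(2))
  then show ?thesis
    using assms(3)[of "cut A"] assms(3)[of "length A - cut A"] b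
    by (simp add: descend_def unit_law_refine)
qed

lemma unit_law_nu: "unit_law (nu A r)"
proof (induction "length A" arbitrary: A r rule: less_induct)
  case less
  show ?case
  proof (cases "length A < 48")
    case True
    then show ?thesis by (simp add: nu_base unit_law_limit)
  next
    case False
    then have len: "48 \<le> length A" by simp
    show ?thesis
    proof (cases "A ! 0 = Min (set A)")
      case False
      show ?thesis
        unfolding nu_pivot[OF len False]
      proof (rule unit_law_descend)
        show "2 \<le> length A" using len by simp
        show "unit_law (nu B r)" if "length B < length A" for B :: "'a list" and r
          using that by (rule less)
        show "0 \<le> pivot_cell (length A) (k - 1) \<and> pivot_cell (length A) (k - 1) < pivot_cell (length A) k
          \<and> pivot_cell (length A) k \<le> 1" if "1 \<le> k" "k < length A" for k
          using pivot_cell_bounds(1-3)[OF that] by (intro conjI)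
      qed
    next
      case min: True
      show ?thesis
      proof (cases "r \<le> 1")
        case True
        let ?m = "length A - 1"
        have "min_cell ?m 0 = 1 / real ?m" using len by (intro min_cell_bounds[of 1]) auto
        moreover have "1 / real ?m \<le> 1" "0 < 1 / real ?m" using len by (auto simp: divide_le_eq)
        ultimately have "unit_law (refine limit_law 0 (min_cell ?m 0))"
          by (intro unit_law_refine unit_law_limit) simp_all
        moreover have "nu A r = refine limit_law 0 (min_cell ?m 0)"
          unfolding nu.simps[of A r] using len min True by simp
        ultimately show ?thesis by simp
      next
        case False
        then obtain r' where r: "r = Suc r'" "1 \<le> r'" by (cases r) auto
        have len': "length (tl A) < length A" "2 \<le> length (tl A)" using len by auto
        show ?thesis
        proof (cases "tl A ! 0 = Min (set (tl A))")
          case True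
          show ?thesis unfolding r(1) nu_lazy[OF len min True r(2)] by (rule less[OF len'(1)])
        next
          case False
          show ?thesis
            unfolding r(1) nu_min[OF len min False r(2)]
          proof (rule unit_law_descend[OF len'(2)])
            show "unit_law (nu B r)" if "length B < length (tl A)" for B :: "'a list" and r
              using that len'(1) by (intro less) linarith
            show "0 \<le> min_cell (length (tl A)) (k - 1)
              \<and> min_cell (length (tl A)) (k - 1) < min_cell (length (tl A)) k
              \<and> min_cell (length (tl A)) k \<le> 1" if "1 \<le> k" "k < length (tl A)" for k
              using min_cell_bounds(1-3)[OF that] by (intro conjI)
          qed
        qed
      qed
    qed
  qed
qed

section \<open>Averaging one descent over a class with given pivot\<close>

definition exp_moment :: "real \<Rightarrow> real \<Rightarrow> 'a::linorder list \<Rightarrow> nat \<Rightarrow> ennreal" where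
  "exp_moment s c A r = (\<integral>\<^sup>+z. ennreal (exp (s * (real (key_exchanges A r) - c * z))) \<partial>nu A r)"

text \<open>The exponent is the sum of the fluctuation \<open>T - m\<close> of this step's
  exchanges, the drift error, which is bounded pointwise on the cell, and the difference
  \<open>Y - k * z\<close> of the recursive call; the three exponentials factor.\<close>

lemma exp_refine_le:
  assumes \<nu>: "unit_law \<nu>" and ab: "a < b"
    and drift: "\<And>z u. 0 \<le> z \<Longrightarrow> z \<le> 1 \<Longrightarrow> u \<in> {a<..b} \<Longrightarrow> \<bar>m + k * z - N * step z u\<bar> \<le> \<delta>"
  shows "(\<integral>\<^sup>+z. ennreal (exp (s * (T + Y - N * z))) \<partial>refine \<nu> a b)
    \<le> ennreal (exp (s * (T - m))) * (ennreal (exp (\<bar>s\<bar> * \<delta>)) * (\<integral>\<^sup>+z. ennreal (exp (s * (Y - k * z))) \<partial>\<nu>))"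
proof -
  interpret U: prob_space "cell a b" using ab by (rule prob_space_cell)
  have [measurable_cong]: "sets \<nu> = sets borel" using \<nu> by (simp add: unit_law_def)
  have "(\<integral>\<^sup>+z. ennreal (exp (s * (T + Y - N * z))) \<partial>refine \<nu> a b)
      = (\<integral>\<^sup>+z. (\<integral>\<^sup>+u. ennreal (exp (s * (T + Y - N * step z u))) \<partial>cell a b) \<partial>\<nu>)"
    by (rule nn_integral_refine(1)[OF \<nu> ab]) measurable
  also have "\<dots> \<le> (\<integral>\<^sup>+z. ennreal (exp (s * (T - m))) * (ennreal (exp (\<bar>s\<bar> * \<delta>))
      * ennreal (exp (s * (Y - k * z)))) \<partial>\<nu>)"
  proof (rule nn_integral_mono_AE)
    have "AE z in \<nu>. 0 \<le> z \<and> z \<le> 1" using \<nu> by (simp add: unit_law_def)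
    then show "AE z in \<nu>. (\<integral>\<^sup>+u. ennreal (exp (s * (T + Y - N * step z u))) \<partial>cell a b)
        \<le> ennreal (exp (s * (T - m))) * (ennreal (exp (\<bar>s\<bar> * \<delta>)) * ennreal (exp (s * (Y - k * z))))"
    proof eventually_elim
      case (elim z)
      let ?C = "exp (s * (T - m)) * (exp (\<bar>s\<bar> * \<delta>) * exp (s * (Y - k * z)))"
      have "(\<integral>\<^sup>+u. ennreal (exp (s * (T + Y - N * step z u))) \<partial>cell a b) \<le> (\<integral>\<^sup>+u. ennreal ?C \<partial>cell a b)"
      proof (rule nn_integral_mono_AE)
        show "AE u in cell a b. ennreal (exp (s * (T + Y - N * step z u))) \<le> ennreal ?C"
          using AE_cell[of a b]
        proof eventually_elim
          case (elim u)
          have "s * (m + k * z - N * step z u) \<le> \<bar>s\<bar> * \<bar>m + k * z - N * step z u\<bar>"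
            by (metis abs_ge_self abs_mult)
          also have "\<dots> \<le> \<bar>s\<bar> * \<delta>"
            using drift[of z u] elim \<open>0 \<le> z \<and> z \<le> 1\<close> by (intro mult_left_mono) auto
          finally have "s * (T + Y - N * step z u) \<le> s * (T - m) + (\<bar>s\<bar> * \<delta> + s * (Y - k * z))"
            by (simp add: algebra_simps)
          then have "exp (s * (T + Y - N * step z u)) \<le> ?C"
            unfolding exp_add[symmetric] by (simp only: exp_le_cancel_iff)
          then show ?case by (rule ennreal_leI)
        qed
      qed
      also have "\<dots> = ennreal ?C" using U.emeasure_space_1 by simp
      finally show ?case by (simp add: ennreal_mult)
    qed
  qed
  also have "\<dots> = ennreal (exp (s * (T - m))) * (ennreal (exp (\<bar>s\<bar> * \<delta>)) * (\<integral>\<^sup>+z. ennreal (exp (s * (Y - k * z))) \<partial>\<nu>))"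
    by (simp add: nn_integral_cmult)
  finally show ?thesis .
qed

lemma sum_split_rank:
  fixes f :: "nat \<Rightarrow> 'b::comm_monoid_add"
  assumes "l \<le> n"
  shows "(\<Sum>r=1..n. f r) = (\<Sum>r=1..l. f r) + (\<Sum>r=1..n - l. f (l + r))"
proof -
  have "(\<Sum>r=1..n. f r) = (\<Sum>r=1..l. f r) + (\<Sum>r=l+1..n. f r)"
    using assms by (metis le_add1 le_add2 le_add_diff_inverse sum.ub_add_nat add.commute)
  also have "(\<Sum>r=l+1..n. f r) = (\<Sum>r=1..n - l. f (l + r))"
    by (rule sum.reindex_bij_witness[of _ "\<lambda>r. l + r" "\<lambda>r. r - l"]) (use assms in auto)
  finally show ?thesis .
qed

context pivot_class
begin

lemma card_R: "card R = card S - card L" "card L < card S" "card R < card S"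
  using LR(7-9) by auto

lemma descend_left:
  "A \<in> \<A> \<Longrightarrow> r \<in> {1..card L} \<Longrightarrow> descend t A r = refine (nu (left_part A) r) (t (card L - 1)) (t (card L))"
  by (simp add: descend_def member)

lemma descend_right:
  "A \<in> \<A> \<Longrightarrow> r \<in> {1..card R} \<Longrightarrow>
    descend t A (card L + r) = refine (nu (right_part A) r) (t (card R - 1)) (t (card R))"
  by (simp add: descend_def member card_R)

text \<open>The integration over the cell is moved into the test function: \<open>\<Phi> k\<close>
  is again a measurable test function, to which the induction hypothesis for the parts applies. That
  hypothesis replaces \<open>nu\<close> by the limit law, and reading the integral backwards gives
  \<open>refine limit_law\<close>.\<close>

lemma descend_integral:
  assumes t: "\<And>k. 1 \<le> k \<Longrightarrow> k < card S \<Longrightarrow> t (k - 1) < t k" and f: "f \<in> borel_measurable borel"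
    and IH: "\<And>P q g. P = L \<or> P = R \<Longrightarrow> q < card P \<Longrightarrow> g \<in> borel_measurable borel \<Longrightarrow>
      (\<Sum>B\<in>arrangements P q. \<Sum>r=1..card P. \<integral>\<^sup>+z. g z \<partial>nu B r)
      = of_nat (card (arrangements P q)) * (of_nat (card P) * (\<integral>\<^sup>+z. g z \<partial>limit_law))"
  defines "h \<equiv> \<lambda>k. of_nat k * (\<integral>\<^sup>+z. f z \<partial>refine limit_law (t (k - 1)) (t k))"
  shows "(\<Sum>A\<in>\<A>. \<Sum>r=1..card S. \<integral>\<^sup>+z. f z \<partial>descend t A r)
    = of_nat (card \<A>) * (h (card L) + h (card R))"
proof -
  define \<Phi> where "\<Phi> k z = (\<integral>\<^sup>+u. f (step z u) \<partial>cell (t (k - 1)) (t k))" for k z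
  have ref: "(\<integral>\<^sup>+z. f z \<partial>refine \<nu> (t (k - 1)) (t k)) = (\<integral>\<^sup>+z. \<Phi> k z \<partial>\<nu>)"
    if "unit_law \<nu>" "1 \<le> k" "k < card S" for \<nu> k
    unfolding \<Phi>_def by (rule nn_integral_refine(1)[OF that(1) t[OF that(2,3)] f])
  have meas: "\<Phi> k \<in> borel_measurable borel" if "1 \<le> k" "k < card S" for k
  proof -
    interpret U: prob_space "cell (t (k - 1)) (t k)" using t[OF that] by (rule prob_space_cell)
    note [measurable] = f
    show ?thesis unfolding \<Phi>_def by measurable
  qed
  have "(\<Sum>A\<in>\<A>. \<Sum>r=1..card S. \<integral>\<^sup>+z. f z \<partial>descend t A r)
      = (\<Sum>A\<in>\<A>. (\<lambda>_. 1) (swaps A) * (\<Sum>r=1..card L. \<integral>\<^sup>+z. \<Phi> (card L) z \<partial>nu (left_part A) r))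
      + (\<Sum>A\<in>\<A>. (\<lambda>_. 1) (swaps A) * (\<Sum>r=1..card R. \<integral>\<^sup>+z. \<Phi> (card R) z \<partial>nu (right_part A) r))"
    unfolding sum.distrib[symmetric]
  proof (rule sum.cong[OF refl])
    fix A assume A: "A \<in> \<A>"
    have "(\<Sum>r=1..card S. \<integral>\<^sup>+z. f z \<partial>descend t A r) = (\<Sum>r=1..card L. \<integral>\<^sup>+z. f z \<partial>descend t A r)
        + (\<Sum>r=1..card R. \<integral>\<^sup>+z. f z \<partial>descend t A (card L + r))"
      unfolding card_R(1) using card_R by (intro sum_split_rank) simp
    also have "(\<Sum>r=1..card L. \<integral>\<^sup>+z. f z \<partial>descend t A r)
        = (\<Sum>r=1..card L. \<integral>\<^sup>+z. \<Phi> (card L) z \<partial>nu (left_part A) r)"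
    proof (rule sum.cong[OF refl])
      fix r assume "r \<in> {1..card L}"
      from descend_left[OF A this]
      show "(\<integral>\<^sup>+z. f z \<partial>descend t A r) = (\<integral>\<^sup>+z. \<Phi> (card L) z \<partial>nu (left_part A) r)"
        using ref[OF unit_law_nu LR(8) card_R(2)] by simp
    qed
    also have "(\<Sum>r=1..card R. \<integral>\<^sup>+z. f z \<partial>descend t A (card L + r))
        = (\<Sum>r=1..card R. \<integral>\<^sup>+z. \<Phi> (card R) z \<partial>nu (right_part A) r)"
    proof (rule sum.cong[OF refl])
      fix r assume "r \<in> {1..card R}"
      from descend_right[OF A this]
      show "(\<integral>\<^sup>+z. f z \<partial>descend t A (card L + r)) = (\<integral>\<^sup>+z. \<Phi> (card R) z \<partial>nu (right_part A) r)"
        using ref[OF unit_law_nu LR(9) card_R(3)] by simp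
    qed
    finally show "(\<Sum>r=1..card S. \<integral>\<^sup>+z. f z \<partial>descend t A r)
      = (\<lambda>_. 1) (swaps A) * (\<Sum>r=1..card L. \<integral>\<^sup>+z. \<Phi> (card L) z \<partial>nu (left_part A) r)
      + (\<lambda>_. 1) (swaps A) * (\<Sum>r=1..card R. \<integral>\<^sup>+z. \<Phi> (card R) z \<partial>nu (right_part A) r)" by simp
  qed
  also have "(\<Sum>A\<in>\<A>. (\<lambda>_. 1) (swaps A) * (\<Sum>r=1..card L. \<integral>\<^sup>+z. \<Phi> (card L) z \<partial>nu (left_part A) r))
      = (\<Sum>A\<in>\<A>. (\<lambda>_. 1) (swaps A)) * h (card L)"
    by (rule left_eq[where F = "\<lambda>B. \<Sum>r=1..card L. \<integral>\<^sup>+z. \<Phi> (card L) z \<partial>nu B r"])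
      (simp only: h_def ref[OF unit_law_limit LR(8) card_R(2)],
        rule IH[OF disjI1[OF refl] _ meas[OF LR(8) card_R(2)]])
  also have "(\<Sum>A\<in>\<A>. (\<lambda>_. 1) (swaps A) * (\<Sum>r=1..card R. \<integral>\<^sup>+z. \<Phi> (card R) z \<partial>nu (right_part A) r))
      = (\<Sum>A\<in>\<A>. (\<lambda>_. 1) (swaps A)) * h (card R)"
    by (rule right_eq[where F = "\<lambda>B. \<Sum>r=1..card R. \<integral>\<^sup>+z. \<Phi> (card R) z \<partial>nu B r"])
      (simp only: h_def ref[OF unit_law_limit LR(9) card_R(3)],
        rule IH[OF disjI2[OF refl] _ meas[OF LR(9) card_R(3)]])
  finally show ?thesis by (simp add: distrib_left)
qed

text \<open>\<open>exp_refine_le\<close> factors each term, the symmetry of the class separates the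
  recursive part from the exchanges, and \<open>swaps_mgf\<close> averages the latter. The
  conditions \<open>dle\<close> bring the fluctuation cost into the telescoping form with
  \<open>card S - k\<close>.\<close>

lemma descend_exp_moment:
  fixes \<delta> b :: "nat \<Rightarrow> real" and s N :: real
  assumes t: "\<And>k. 1 \<le> k \<Longrightarrow> k < card S \<Longrightarrow> t (k - 1) < t k"
    and V: "V \<subseteq> S - {v}" "{x \<in> S. v < x} \<subseteq> V"
    and closedV: "\<And>\<sigma> A. \<sigma> permutes V \<Longrightarrow> A \<in> \<A> \<Longrightarrow> map \<sigma> A \<in> \<A>"
    and d: "\<And>A. A \<in> \<A> \<Longrightarrow> card (V \<inter> set (take (card L) A)) = d"
    and dle: "d \<le> card L" "card V - d \<le> card R"
    and drift: "\<And>k z u. k = card L \<or> k = card R \<Longrightarrow> 0 \<le> z \<Longrightarrow> z \<le> 1 \<Longrightarrow> u \<in> {t (k - 1)<..t k} \<Longrightarrow>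
      \<bar>1 + real d * real (card {x \<in> S. v < x}) / real (card V) + real k * z - N * step z u\<bar> \<le> \<delta> k"
    and IH: "\<And>P q. P = L \<or> P = R \<Longrightarrow> q < card P \<Longrightarrow>
      (\<Sum>B\<in>arrangements P q. \<Sum>r=1..card P. exp_moment s (real (card P)) B r)
      \<le> of_nat (card (arrangements P q)) * ennreal (real (card P) * b (card P))"
    and b: "\<And>k. 0 \<le> b k"
  defines "h \<equiv> \<lambda>k. ennreal (real k * (exp (s\<^sup>2 * real (card S - k) / 8 + \<bar>s\<bar> * \<delta> k) * b k))"
  shows "(\<Sum>A\<in>\<A>. \<Sum>r=1..card S.
      \<integral>\<^sup>+z. ennreal (exp (s * (real (key_exchanges A r) - N * z))) \<partial>descend t A r)
    \<le> of_nat (card \<A>) * (h (card L) + h (card R))"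
proof -
  define m where "m = 1 + real d * real (card {x \<in> S. v < x}) / real (card V)"
  define W where "W T = ennreal (exp (s * (real T - m)))" for T
  define E where "E k = ennreal (exp (\<bar>s\<bar> * \<delta> k))" for k
  define G where "G k A r = E k * exp_moment s (real k) A r" for k and A :: "'a list" and r
  note keep = drift[folded m_def]
  have "(\<Sum>A\<in>\<A>. \<Sum>r=1..card S.
      \<integral>\<^sup>+z. ennreal (exp (s * (real (key_exchanges A r) - N * z))) \<partial>descend t A r)
    \<le> (\<Sum>A\<in>\<A>. W (swaps A) * (\<Sum>r=1..card L. G (card L) (left_part A) r)
         + W (swaps A) * (\<Sum>r=1..card R. G (card R) (right_part A) r))"
  proof (rule sum_mono)
    fix A assume A: "A \<in> \<A>"
    have ke: "key_exchanges A r = swaps A + (if r \<le> card L then key_exchanges (left_part A) r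
        else key_exchanges (right_part A) (r - card L))" for r
      using key_exchanges_rec[OF member(5)[OF A], of r] member(6)[OF A] by simp
    let ?I = "\<lambda>r. \<integral>\<^sup>+z. ennreal (exp (s * (real (key_exchanges A r) - N * z))) \<partial>descend t A r"
    have "(\<Sum>r=1..card S. ?I r) = (\<Sum>r=1..card L. ?I r) + (\<Sum>r=1..card R. ?I (card L + r))"
      unfolding card_R(1) using card_R by (intro sum_split_rank) simp
    also have "(\<Sum>r=1..card L. ?I r) \<le> (\<Sum>r=1..card L. W (swaps A) * G (card L) (left_part A) r)"
    proof (rule sum_mono)
      fix r assume r: "r \<in> {1..card L}"
      show "?I r \<le> W (swaps A) * G (card L) (left_part A) r"
        using exp_refine_le[OF unit_law_nu t[OF LR(8) card_R(2)] keep[of "card L"],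
            where s = s and T = "real (swaps A)" and Y = "real (key_exchanges (left_part A) r)"] r
        unfolding descend_left[OF A r] W_def G_def E_def exp_moment_def ke by simp
    qed
    also have "(\<Sum>r=1..card R. ?I (card L + r)) \<le> (\<Sum>r=1..card R. W (swaps A) * G (card R) (right_part A) r)"
    proof (rule sum_mono)
      fix r assume r: "r \<in> {1..card R}"
      show "?I (card L + r) \<le> W (swaps A) * G (card R) (right_part A) r"
        using exp_refine_le[OF unit_law_nu t[OF LR(9) card_R(3)] keep[of "card R"],
            where s = s and T = "real (swaps A)" and Y = "real (key_exchanges (right_part A) r)"] r
        unfolding descend_right[OF A r] W_def G_def E_def exp_moment_def ke by simp
    qed
    finally show "(\<Sum>r=1..card S. ?I r) \<le> W (swaps A) * (\<Sum>r=1..card L. G (card L) (left_part A) r)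
         + W (swaps A) * (\<Sum>r=1..card R. G (card R) (right_part A) r)"
      by (simp add: sum_distrib_left)
  qed
  also have "\<dots> = (\<Sum>A\<in>\<A>. W (swaps A) * (\<Sum>r=1..card L. G (card L) (left_part A) r))
      + (\<Sum>A\<in>\<A>. W (swaps A) * (\<Sum>r=1..card R. G (card R) (right_part A) r))"
    by (rule sum.distrib)
  also have "\<dots> \<le> (\<Sum>A\<in>\<A>. W (swaps A)) * (E (card L) * ennreal (real (card L) * b (card L)))
      + (\<Sum>A\<in>\<A>. W (swaps A)) * (E (card R) * ennreal (real (card R) * b (card R)))"
  proof (rule add_mono)
    have *: "(\<Sum>B\<in>arrangements P q. \<Sum>r=1..card P. G (card P) B r)
        \<le> of_nat (card (arrangements P q)) * (E (card P) * ennreal (real (card P) * b (card P)))"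
      if "P = L \<or> P = R" "q < card P" for P q
    proof -
      have "(\<Sum>B\<in>arrangements P q. \<Sum>r=1..card P. G (card P) B r)
          = E (card P) * (\<Sum>B\<in>arrangements P q. \<Sum>r=1..card P. exp_moment s (real (card P)) B r)"
        by (simp add: G_def sum_distrib_left)
      also have "\<dots> \<le> E (card P) * (of_nat (card (arrangements P q)) * ennreal (real (card P) * b (card P)))"
        using IH[OF that] by (rule mult_left_mono) simp
      finally show ?thesis by (simp add: mult.left_commute)
    qed
    show "(\<Sum>A\<in>\<A>. W (swaps A) * (\<Sum>r=1..card L. G (card L) (left_part A) r))
        \<le> (\<Sum>A\<in>\<A>. W (swaps A)) * (E (card L) * ennreal (real (card L) * b (card L)))"
      by (rule left_le[where F = "\<lambda>B. \<Sum>r=1..card L. G (card L) B r"]) (rule *, auto)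
    show "(\<Sum>A\<in>\<A>. W (swaps A) * (\<Sum>r=1..card R. G (card R) (right_part A) r))
        \<le> (\<Sum>A\<in>\<A>. W (swaps A)) * (E (card R) * ennreal (real (card R) * b (card R)))"
      by (rule right_le[where F = "\<lambda>B. \<Sum>r=1..card R. G (card R) B r"]) (rule *, auto)
  qed
  \<comment> \<open>If the left part survives, the bound by the points not sampled is taken,
    otherwise the one by the sampled points; either number is at most the size of the discarded
    part.\<close>
  also have "\<dots> \<le> of_nat (card \<A>) * h (card L) + of_nat (card \<A>) * h (card R)"
  proof (rule add_mono)
    note M = swaps_mgf[OF fin vS v_min sub hd V closedV d[unfolded L_def], of s, folded m_def]
    have wsum: "(\<Sum>A\<in>\<A>. W (swaps A)) = ennreal (\<Sum>A\<in>\<A>. exp (s * (real (swaps A) - m)))"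
      unfolding W_def by (rule sum_ennreal) simp
    have **: "(\<Sum>A\<in>\<A>. W (swaps A)) * (E k * ennreal (real k * b k)) \<le> of_nat (card \<A>) * h k"
      if le: "(\<Sum>A\<in>\<A>. exp (s * (real (swaps A) - m))) \<le> real (card \<A>) * exp (s\<^sup>2 * real e / 8)"
        "e \<le> card S - k" for e k
    proof -
      have "(\<Sum>A\<in>\<A>. exp (s * (real (swaps A) - m))) \<le> real (card \<A>) * exp (s\<^sup>2 * real (card S - k) / 8)"
      proof (rule order_trans[OF le(1)])
        have "s\<^sup>2 * real e / 8 \<le> s\<^sup>2 * real (card S - k) / 8"
          using le(2) by (intro divide_right_mono mult_left_mono) auto
        then show "real (card \<A>) * exp (s\<^sup>2 * real e / 8) \<le> real (card \<A>) * exp (s\<^sup>2 * real (card S - k) / 8)"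
          by (intro mult_left_mono) auto
      qed
      then have "(\<Sum>A\<in>\<A>. exp (s * (real (swaps A) - m))) * (exp (\<bar>s\<bar> * \<delta> k) * (real k * b k))
          \<le> (real (card \<A>) * exp (s\<^sup>2 * real (card S - k) / 8)) * (exp (\<bar>s\<bar> * \<delta> k) * (real k * b k))"
        using b[of k] by (intro mult_right_mono) auto
      also have "\<dots> = real (card \<A>) * (real k * (exp (s\<^sup>2 * real (card S - k) / 8 + \<bar>s\<bar> * \<delta> k) * b k))"
        by (simp add: exp_add)
      finally have "ennreal ((\<Sum>A\<in>\<A>. exp (s * (real (swaps A) - m))) * (exp (\<bar>s\<bar> * \<delta> k) * (real k * b k)))
          \<le> ennreal (real (card \<A>) * (real k * (exp (s\<^sup>2 * real (card S - k) / 8 + \<bar>s\<bar> * \<delta> k) * b k)))"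
        by (rule ennreal_leI)
      then show ?thesis
        unfolding wsum E_def h_def using b[of k]
        by (simp add: ennreal_mult sum_nonneg ennreal_of_nat_eq_real_of_nat)
    qed
    show "(\<Sum>A\<in>\<A>. W (swaps A)) * (E (card L) * ennreal (real (card L) * b (card L))) \<le> of_nat (card \<A>) * h (card L)"
    proof (rule **[OF M(2)])
      show "card V - d \<le> card S - card L" using dle(2) card_R(1) by linarith
    qed
    show "(\<Sum>A\<in>\<A>. W (swaps A)) * (E (card R) * ennreal (real (card R) * b (card R))) \<le> of_nat (card \<A>) * h (card R)"
    proof (rule **[OF M(1)])
      show "d \<le> card S - card R" using dle(1) LR(7) by linarith
    qed
  qed
  finally show ?thesis by (simp add: distrib_left)
qed

end

section \<open>The marginal of the kernel\<close>

text \<open>A part of size \<open>k\<close> contains \<open>k\<close> ranks, and its cell has length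
  2 k / c; the size cancels, so all cells enter with the same weight c / 2 and their masses can be
  glued together.\<close>

lemma cell_weight:
  assumes "0 < c" "1 \<le> k"
  shows "of_nat k * (x / ennreal (2 * real k / c)) = ennreal (c / 2) * (x :: ennreal)"
proof -
  have k: "0 < real k" using assms by simp
  define a where "a = c / (2 * real k)"
  have a: "0 < a" using assms k by (simp add: a_def)
  have "x / ennreal (2 * real k / c) = x * ennreal a"
    using assms k by (simp add: a_def divide_ennreal_def inverse_ennreal)
  then have "of_nat k * (x / ennreal (2 * real k / c)) = (ennreal (real k) * ennreal a) * x"
    by (simp add: ennreal_of_nat_eq_real_of_nat mult_ac)
  also have "ennreal (real k) * ennreal a = ennreal (real k * a)"
    using a by (simp add: ennreal_mult)
  also have "real k * a = c / 2" using k by (simp add: a_def)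
  finally show ?thesis .
qed

lemma perm_facts:
  assumes "A \<in> permutations_of_set S"
  shows "set A = S" "distinct A" "length A = card S"
proof -
  show A: "set A = S" "distinct A" by (rule permutations_of_setD[OF assms])+
  show "length A = card S" using distinct_card[OF A(2)] unfolding A(1) by (rule sym)
qed

context pivot_family
begin

lemma class_sizes:
  assumes v: "v \<in> S - {Min S}"
  shows "pivot_class.L S v = {x \<in> S. x < v}" "pivot_class.R S v = {x \<in> S. v \<le> x}"
    "card (pivot_class.R S v) = card S - card {x \<in> S. x < v}"
    "card {x \<in> S. v < x} = card S - card {x \<in> S. x < v} - 1"
    "1 \<le> card {x \<in> S. x < v}" "card {x \<in> S. x < v} < card S"
proof -
  interpret pivot_class S v "cls v" using v by (rule cls_pivot)
  show "pivot_class.L S v = {x \<in> S. x < v}" "pivot_class.R S v = {x \<in> S. v \<le> x}"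
    by (simp_all add: L_def R_def)
  show c: "card (pivot_class.R S v) = card S - card {x \<in> S. x < v}"
    using card_R(1) by (simp add: L_def)
  show "1 \<le> card {x \<in> S. x < v}" "card {x \<in> S. x < v} < card S"
    using LR(8) card_R(2) by (simp_all add: L_def)
  have "R = insert v {x \<in> S. v < x}" using v by (auto simp: R_def)
  then have "card R = card {x \<in> S. v < x} + 1" using finS by simp
  then show "card {x \<in> S. v < x} = card S - card {x \<in> S. x < v} - 1" using c by simp
qed

text \<open>After the cancellation in \<open>cell_weight\<close> the masses of consecutive cells
  telescope. The normalisation \<open>c\<close> is n (n - 1) for the pivot cells and m^2 for the
  merged step.\<close>

lemma family_integral:
  assumes t: "incseq t" "\<And>k. 1 \<le> k \<Longrightarrow> k < card S \<Longrightarrow> t k - t (k - 1) = 2 * real k / c" and c: "0 < c"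
    and f: "f \<in> borel_measurable borel"
    and IH: "\<And>(P :: 'a set) q g. finite P \<Longrightarrow> card P < card S \<Longrightarrow> q < card P \<Longrightarrow> g \<in> borel_measurable borel \<Longrightarrow>
      (\<Sum>B\<in>arrangements P q. \<Sum>r=1..card P. \<integral>\<^sup>+z. g z \<partial>nu B r)
      = of_nat (card (arrangements P q)) * (of_nat (card P) * (\<integral>\<^sup>+z. g z \<partial>limit_law))"
  shows "(\<Sum>A\<in>\<D>. \<Sum>r=1..card S. \<integral>\<^sup>+z. f z \<partial>descend t A r)
    = of_nat c0 * (ennreal c * cell_mass f (t 0) (t (card S - 1)))"
proof -
  define h where "h k = of_nat k * (\<integral>\<^sup>+z. f z \<partial>refine limit_law (t (k - 1)) (t k))" for k
  have tt: "t (k - 1) < t k" if "1 \<le> k" "k < card S" for k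
  proof -
    have "0 < 2 * real k / c" using that c by simp
    then show ?thesis using t(2)[OF that] by linarith
  qed
  have "(\<Sum>A\<in>\<D>. \<Sum>r=1..card S. \<integral>\<^sup>+z. f z \<partial>descend t A r) = of_nat c0 * (2 * (\<Sum>k=1..<card S. h k))"
  proof (rule family_eq)
    fix v assume v: "v \<in> S - {Min S}"
    interpret pivot_class S v "cls v" using v by (rule cls_pivot)
    note cs = class_sizes[OF v]
    have "(\<Sum>A\<in>cls v. \<Sum>r=1..card S. \<integral>\<^sup>+z. f z \<partial>descend t A r)
        = of_nat (card (cls v)) * (h (card L) + h (card R))"
      unfolding h_def
    proof (rule descend_integral[where t = t and f = f])
      fix P q and g :: "real \<Rightarrow> ennreal"
      assume P: "P = L \<or> P = R" "q < card P" "g \<in> borel_measurable borel"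
      have "finite P" "card P < card S" using P(1) LR(1,2) card_R(2,3) by auto
      from IH[OF this P(2,3)] show "(\<Sum>B\<in>arrangements P q. \<Sum>r=1..card P. \<integral>\<^sup>+z. g z \<partial>nu B r)
        = of_nat (card (arrangements P q)) * (of_nat (card P) * (\<integral>\<^sup>+z. g z \<partial>limit_law))" .
    qed (use tt f in auto)
    then show "(\<Sum>A\<in>cls v. \<Sum>r=1..card S. \<integral>\<^sup>+z. f z \<partial>descend t A r)
        = of_nat (card (cls v)) * (h (card {x \<in> S. x < v}) + h (card S - card {x \<in> S. x < v}))"
      unfolding cs(3) cs(1) .
  qed
  also have "(\<Sum>k=1..<card S. h k) = (\<Sum>k=1..<card S. ennreal (c / 2) * cell_mass f (t (k - 1)) (t k))"
  proof (rule sum.cong[OF refl])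
    fix k assume "k \<in> {1..<card S}"
    then have k: "1 \<le> k" "k < card S" by auto
    show "h k = ennreal (c / 2) * cell_mass f (t (k - 1)) (t k)"
      unfolding h_def nn_integral_refine_limit[OF tt[OF k] f] t(2)[OF k] by (rule cell_weight[OF c k(1)])
  qed
  also have "\<dots> = ennreal (c / 2) * (\<Sum>k=1..<card S. cell_mass f (t (k - 1)) (t k))"
    by (rule sum_distrib_left[symmetric])
  also have "(\<Sum>k=1..<card S. cell_mass f (t (k - 1)) (t k)) = cell_mass f (t 0) (t (card S - 1))"
    using cell_mass_sum[OF t(1) f, of "card S - 1"] finS(2) by simp
  also have "2 * (ennreal (c / 2) * cell_mass f (t 0) (t (card S - 1)))
      = ennreal c * cell_mass f (t 0) (t (card S - 1))"
  proof -
    have "2 * ennreal (c / 2) = ennreal c"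
      using c by (metis ennreal_mult ennreal_numeral field_sum_of_halves half_gt_zero_iff less_imp_le mult_2
          zero_le_numeral)
    then show ?thesis by (simp add: mult.assoc[symmetric])
  qed
  finally show ?thesis .
qed

end

section \<open>Lists with and without the minimum in front\<close>

lemma pivot_family_arrangements:
  assumes "finite S" "2 \<le> card S" "1 \<le> q" "q < card S"
  shows "pivot_family S (arrangements S q)"
proof
  fix A assume A: "A \<in> arrangements S q"
  have "set A = S" "distinct A" "length A = card S"
    using A by (auto simp: arrangements_def dest: perm_facts)
  then have "A ! 0 \<noteq> A ! q" using assms by (subst nth_eq_iff_index_eq) auto
  then show "A ! 0 \<noteq> Min S" using A by (simp add: arrangements_def)
next
  fix \<sigma> A assume \<sigma>: "\<sigma> permutes (S - {Min S})" and A: "A \<in> arrangements S q"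
  have S: "set A = S" "distinct A" "A ! q = Min S" "length A = card S"
    using A by (auto simp: arrangements_def dest: perm_facts)
  have "\<sigma> permutes S" using \<sigma> by (rule permutes_subset) auto
  moreover have "\<sigma> (Min S) = Min S" using \<sigma> by (simp add: permutes_def)
  ultimately show "map \<sigma> A \<in> arrangements S q"
    using S assms by (auto simp: arrangements_def permutes_image distinct_map permutes_inj_on
        intro!: permutations_of_setI)
qed (use assms in \<open>auto simp: arrangements_def\<close>)

text \<open>The tails of lists with the minimum in front for which the second step meets a proper
  pivot. Here the minimum of the tail is not tied to a place.\<close>

definition nonmin_first :: "'a::linorder set \<Rightarrow> 'a list set" where
  "nonmin_first S = {A \<in> permutations_of_set S. A ! 0 \<noteq> Min S}"

lemma pivot_family_nonmin:
  assumes "finite S" "2 \<le> card S"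
  shows "pivot_family S (nonmin_first S)"
proof
  fix \<sigma> A assume \<sigma>: "\<sigma> permutes (S - {Min S})" and A: "A \<in> nonmin_first S"
  have S: "set A = S" "distinct A" "A ! 0 \<noteq> Min S" "A \<noteq> []"
    using A assms by (auto simp: nonmin_first_def dest: permutations_of_setD)
  have p: "\<sigma> permutes S" using \<sigma> by (rule permutes_subset) auto
  have m: "\<sigma> (Min S) = Min S" using \<sigma> by (simp add: permutes_def)
  have "\<sigma> (A ! 0) \<noteq> \<sigma> (Min S)" using S(3) permutes_inj[OF p] by (simp add: inj_eq)
  then have "map \<sigma> A ! 0 \<noteq> Min S" using S(4) m by simp
  then show "map \<sigma> A \<in> nonmin_first S"
    using S(1,2) p by (auto simp: nonmin_first_def permutes_image distinct_map permutes_inj_on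
        intro!: permutations_of_setI)
qed (use assms in \<open>auto simp: nonmin_first_def\<close>)

text \<open>Behind a minimum in front stands an unrestricted permutation of the other keys.\<close>

lemma sum_arrangements_0:
  fixes g :: "'a::linorder list \<Rightarrow> 'b::comm_monoid_add"
  assumes "finite S" "2 \<le> card S"
  shows "(\<Sum>A\<in>arrangements S 0. g A)
    = (\<Sum>A\<in>permutations_of_set (S - {Min S}). g (Min S # A))"
proof (rule sum.reindex_bij_witness[of _ "\<lambda>A. Min S # A" tl])
  fix A assume A: "A \<in> arrangements S 0"
  then have "set A = S" "distinct A" "A ! 0 = Min S"
    by (auto simp: arrangements_def dest: permutations_of_setD)
  moreover have "A \<noteq> []" using calculation assms by auto
  ultimately obtain B where B: "A = Min S # B" by (cases A) auto
  then show "Min S # tl A = A" "tl A \<in> permutations_of_set (S - {Min S})" "g (Min S # tl A) = g A"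
    using \<open>set A = S\<close> \<open>distinct A\<close> by (auto intro!: permutations_of_setI)
next
  fix A assume A: "A \<in> permutations_of_set (S - {Min S})"
  have "Min S \<in> S" by (rule Min_in) (use assms in auto)
  then have "set (Min S # A) = S" "distinct (Min S # A)"
    using perm_facts(1,2)[OF A] by (simp_all add: insert_absorb)
  then have "Min S # A \<in> permutations_of_set S" by (rule permutations_of_setI)
  then show "Min S # A \<in> arrangements S 0" unfolding arrangements_def by simp
  show "tl (Min S # A) = A" by simp
qed

lemma sum_permutations_split:
  fixes g :: "'a::linorder list \<Rightarrow> 'b::comm_monoid_add"
  shows "(\<Sum>A\<in>permutations_of_set S. g A) = (\<Sum>A\<in>arrangements S 0. g A) + (\<Sum>A\<in>nonmin_first S. g A)"
proof -
  have "permutations_of_set S = arrangements S 0 \<union> nonmin_first S"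
    "arrangements S 0 \<inter> nonmin_first S = {}"
    unfolding arrangements_def nonmin_first_def by blast+
  moreover have "finite (arrangements S 0)" "finite (nonmin_first S)"
    unfolding arrangements_def nonmin_first_def by simp_all
  ultimately show ?thesis by (simp only: sum.union_disjoint)
qed

lemma card_nonmin:
  assumes "finite S" "2 \<le> card S"
  shows "card (nonmin_first S) = (card S - 1) * fact (card S - 1)"
    "pivot_family.c0 S (nonmin_first S) = fact (card S - 1)"
proof -
  interpret pivot_family S "nonmin_first S" by (rule pivot_family_nonmin[OF assms])
  obtain j where j: "card S = Suc j" "0 < j" using assms(2) by (cases "card S") auto
  have "fact (card S) = (\<Sum>A\<in>permutations_of_set S. 1 :: nat)" using assms(1) by simp
  also have "\<dots> = card (arrangements S 0) + card (nonmin_first S)"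
    unfolding sum_permutations_split by simp
  also have "card (arrangements S 0) = fact (card S - 1)"
    using assms by (intro card_arrangements) auto
  finally show *: "card (nonmin_first S) = (card S - 1) * fact (card S - 1)"
    unfolding j(1) by simp
  then have "j * c0 = j * fact j" using card_D unfolding j(1) by simp
  then show "c0 = fact (card S - 1)" using j by simp
qed

lemma list_with_min_first:
  fixes S :: "'a::linorder set"
  assumes S: "finite S" "2 \<le> card S" and A: "A \<in> permutations_of_set (S - {Min S})"
  shows "length A = card S - 1" "set A = S - {Min S}" "distinct A"
    "set (Min S # A) = S" "distinct (Min S # A)" "length (Min S # A) = card S"
    "swaps (Min S # A) = 0" "key_exchanges (Min S # A) 1 = 0"
    "1 \<le> r \<Longrightarrow> key_exchanges (Min S # A) (Suc r) = key_exchanges A r"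
proof -
  have m: "Min S \<in> S" using S by (intro Min_in) auto
  show A': "set A = S - {Min S}" "distinct A" by (rule perm_facts[OF A])+
  show s: "set (Min S # A) = S" "distinct (Min S # A)" using A' m by (simp_all add: insert_absorb)
  show l: "length (Min S # A) = card S" using distinct_card[OF s(2)] unfolding s(1) by (rule sym)
  then show "length A = card S - 1" by simp
  have l2: "2 \<le> length (Min S # A)" using l S by simp
  have le: "(Min S # A) ! 0 \<le> x" if "x \<in> set (Min S # A)" for x
    using that S(1) unfolding s(1) by simp
  have P: "cut (Min S # A) = 1" "swaps (Min S # A) = 0" "length (left_part (Min S # A)) = 1"
    "right_part (Min S # A) = tl (Min S # A)"
    using parts_of_min[OF l2 s(2)] le by blast+
  show "swaps (Min S # A) = 0" by (rule P)
  show "key_exchanges (Min S # A) 1 = 0"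
    unfolding key_exchanges_rec[OF l2] P(1,2)
    using P(3) by (simp add: key_exchanges.simps[of "left_part (Min S # A)"])
  show "1 \<le> r \<Longrightarrow> key_exchanges (Min S # A) (Suc r) = key_exchanges A r"
    unfolding key_exchanges_rec[OF l2] P by simp
qed

text \<open>This is the statement that the second marginal of the coupling is the limit law. For
  \<open>q = 0\<close> there are three contributions: stopping at rank 1, a tail that begins with
  its own minimum, which is covered by the induction hypothesis, and a tail with a proper pivot.
  With m = card S - 1 and without the second contribution, stopping has weight 1 / m and size
  \<open>k\<close> has weight 2 k / m^2, precisely the lengths of the cells given by
  \<open>min_cell\<close>.\<close>

theorem nu_integral:
  fixes S :: "'a::linorder set"
  assumes "finite S" "q < card S" "f \<in> borel_measurable borel"
  shows "(\<Sum>A\<in>arrangements S q. \<Sum>r=1..card S. \<integral>\<^sup>+z. f z \<partial>nu A r)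
    = of_nat (card (arrangements S q)) * (of_nat (card S) * (\<integral>\<^sup>+z. f z \<partial>limit_law))"
  using assms
proof (induction "card S" arbitrary: S q f rule: less_induct)
  case less
  note fin = less.prems(1) and f = less.prems(3)
  have len: "length A = card S" "set A = S" if "A \<in> arrangements S q" for A
    using that by (auto simp: arrangements_def dest: perm_facts)
  consider "card S < 48" | "48 \<le> card S" "1 \<le> q" | "48 \<le> card S" "q = 0" by linarith
  then show ?case
  proof cases
    case 1
    then show ?thesis by (simp add: nu_base len)
  next
    case 2
    let ?n = "card S"
    interpret pivot_family S "arrangements S q"
      by (rule pivot_family_arrangements[OF fin _ 2(2) less.prems(2)]) (use 2(1) in simp)
    have "(\<Sum>A\<in>arrangements S q. \<Sum>r=1..?n. \<integral>\<^sup>+z. f z \<partial>nu A r)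
        = (\<Sum>A\<in>arrangements S q. \<Sum>r=1..?n. \<integral>\<^sup>+z. f z \<partial>descend (pivot_cell ?n) A r)"
    proof (intro sum.cong refl)
      fix A r assume A: "A \<in> arrangements S q"
      have "nu A r = descend (pivot_cell (length A)) A r"
        using 2 A D_hd[OF A] len[OF A] by (intro nu_pivot) auto
      then show "(\<integral>\<^sup>+z. f z \<partial>nu A r) = (\<integral>\<^sup>+z. f z \<partial>descend (pivot_cell ?n) A r)"
        using len[OF A] by simp
    qed
    also have "\<dots> = of_nat c0 * (ennreal (real ?n * (real ?n - 1))
        * cell_mass f (pivot_cell ?n 0) (pivot_cell ?n (?n - 1)))"
    proof (rule family_integral[OF incseq_pivot_cell _ _ f])
      show "pivot_cell ?n k - pivot_cell ?n (k - 1) = 2 * real k / (real ?n * (real ?n - 1))"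
        if "1 \<le> k" "k < ?n" for k using that by (rule pivot_cell_bounds(4))
      show "0 < real ?n * (real ?n - 1)" using 2 by simp
      show "(\<Sum>B\<in>arrangements P q. \<Sum>r=1..card P. \<integral>\<^sup>+z. g z \<partial>nu B r)
          = of_nat (card (arrangements P q)) * (of_nat (card P) * (\<integral>\<^sup>+z. g z \<partial>limit_law))"
        if "finite P" "card P < card S" "q < card P" "g \<in> borel_measurable borel"
        for P :: "'a set" and q g
        by (rule less.hyps[OF that(2,1,3,4)])
    qed
    also have "cell_mass f (pivot_cell ?n 0) (pivot_cell ?n (?n - 1)) = (\<integral>\<^sup>+z. f z \<partial>limit_law)"
      using pivot_cell_bounds(5,6)[of 1 ?n] 2 by (simp add: nn_integral_limit_law[OF f])
    also have "ennreal (real ?n * (real ?n - 1)) = of_nat ((?n - 1) * ?n)"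
      using 2 by (simp add: ennreal_of_nat_eq_real_of_nat of_nat_diff mult.commute)
    finally show ?thesis
      unfolding card_D by (simp add: mult_ac)
  next
    case 3
    let ?S = "S - {Min S}" and ?I = "\<integral>\<^sup>+z. f z \<partial>limit_law"
    define M where "M = card ?S"
    have S2: "2 \<le> card S" using 3 by simp
    have cS: "card S = Suc M" "47 \<le> M"
    proof -
      have "Min S \<in> S" by (rule Min_in[OF fin]) (use S2 in auto)
      then have "M = card S - 1" unfolding M_def by (rule card_Diff_singleton)
      then show "card S = Suc M" "47 \<le> M" using 3(1) by linarith+
    qed
    have finS': "finite ?S" using fin by simp
    have S'2: "2 \<le> card ?S" unfolding M_def[symmetric] using cS(2) by linarith
    interpret pivot_family ?S "nonmin_first ?S" by (rule pivot_family_nonmin[OF finS' S'2])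
    note lm = list_with_min_first[OF fin S2]
    have first: "(Min S # A) ! 0 = Min (set (Min S # A))" "48 \<le> length (Min S # A)"
      if A: "A \<in> permutations_of_set ?S" for A
      unfolding lm(4)[OF A] lm(6)[OF A] using 3(1) by (simp_all only: nth_Cons_0)
    have stop: "(\<integral>\<^sup>+z. f z \<partial>nu (Min S # A) 1) = ennreal (real M) * cell_mass f 0 (1 / real M)"
      if A: "A \<in> permutations_of_set ?S" for A
    proof -
      have "nu (Min S # A) 1 = refine limit_law 0 (min_cell (length (Min S # A) - 1) 0)"
        by (rule nu_stop[OF first(2)[OF A] first(1)[OF A]])
      also have "min_cell (length (Min S # A) - 1) 0 = 1 / real M"
        unfolding lm(6)[OF A] cS(1) using cS(2) min_cell_bounds(5)[of 1 M] by simp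
      finally have "(\<integral>\<^sup>+z. f z \<partial>nu (Min S # A) 1) = cell_mass f 0 (1 / real M) / ennreal (1 / real M - 0)"
        using cS by (simp add: nn_integral_refine_limit[OF _ f])
      also have "\<dots> = ennreal (real M) * cell_mass f 0 (1 / real M)"
        using cS by (simp add: divide_ennreal_def inverse_ennreal mult.commute)
      finally show ?thesis .
    qed
    have perm: "permutations_of_set ?S \<supseteq> arrangements ?S 0" "permutations_of_set ?S \<supseteq> nonmin_first ?S"
      unfolding arrangements_def nonmin_first_def by blast+
    have "(\<Sum>A\<in>arrangements S q. \<Sum>r=1..card S. \<integral>\<^sup>+z. f z \<partial>nu A r)
        = (\<Sum>A\<in>permutations_of_set ?S. (\<integral>\<^sup>+z. f z \<partial>nu (Min S # A) 1)
            + (\<Sum>r=1..M. \<integral>\<^sup>+z. f z \<partial>nu (Min S # A) (Suc r)))"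
      unfolding 3 sum_arrangements_0[OF fin S2]
    proof (intro sum.cong refl)
      fix A
      have "(\<Sum>r=1..card S. \<integral>\<^sup>+z. f z \<partial>nu (Min S # A) r) = (\<Sum>r=1..1. \<integral>\<^sup>+z. f z \<partial>nu (Min S # A) r)
          + (\<Sum>r=1..card S - 1. \<integral>\<^sup>+z. f z \<partial>nu (Min S # A) (1 + r))"
        using cS by (intro sum_split_rank) simp
      then show "(\<Sum>r=1..card S. \<integral>\<^sup>+z. f z \<partial>nu (Min S # A) r)
          = (\<integral>\<^sup>+z. f z \<partial>nu (Min S # A) 1) + (\<Sum>r=1..M. \<integral>\<^sup>+z. f z \<partial>nu (Min S # A) (Suc r))"
        using cS by simp
    qed
    also have "\<dots> = (\<Sum>A\<in>permutations_of_set ?S. \<integral>\<^sup>+z. f z \<partial>nu (Min S # A) 1)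
        + ((\<Sum>A\<in>arrangements ?S 0. \<Sum>r=1..M. \<integral>\<^sup>+z. f z \<partial>nu (Min S # A) (Suc r))
        + (\<Sum>A\<in>nonmin_first ?S. \<Sum>r=1..M. \<integral>\<^sup>+z. f z \<partial>nu (Min S # A) (Suc r)))"
      by (simp only: sum.distrib sum_permutations_split[of _ ?S])
    also have "(\<Sum>A\<in>permutations_of_set ?S. \<integral>\<^sup>+z. f z \<partial>nu (Min S # A) 1)
        = of_nat (fact M) * (ennreal (real M) * cell_mass f 0 (1 / real M))"
    proof -
      have "(\<Sum>A\<in>permutations_of_set ?S. \<integral>\<^sup>+z. f z \<partial>nu (Min S # A) 1)
          = (\<Sum>A\<in>permutations_of_set ?S. ennreal (real M) * cell_mass f 0 (1 / real M))"
        by (rule sum.cong[OF refl stop])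
      also have "\<dots> = of_nat (fact M) * (ennreal (real M) * cell_mass f 0 (1 / real M))"
        unfolding sum_constant card_permutations_of_set[OF finS'] M_def ..
      finally show ?thesis .
    qed
    also have "(\<Sum>A\<in>arrangements ?S 0. \<Sum>r=1..M. \<integral>\<^sup>+z. f z \<partial>nu (Min S # A) (Suc r))
        = (\<Sum>A\<in>arrangements ?S 0. \<Sum>r=1..M. \<integral>\<^sup>+z. f z \<partial>nu A r)"
    proof (intro sum.cong refl)
      fix A r assume A: "A \<in> arrangements ?S 0" and r: "r \<in> {1..M}"
      have A': "A \<in> permutations_of_set ?S" using A perm by blast
      have "nu (Min S # A) (Suc r) = nu (tl (Min S # A)) r"
        by (rule nu_lazy[OF first(2,1)[OF A']])
          (use A r lm(2)[OF A'] in \<open>auto simp: arrangements_def\<close>)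
      then show "(\<integral>\<^sup>+z. f z \<partial>nu (Min S # A) (Suc r)) = (\<integral>\<^sup>+z. f z \<partial>nu A r)" by simp
    qed
    also have "\<dots> = of_nat (fact (M - 1)) * (of_nat M * ?I)"
    proof -
      have "card ?S < card S" "0 < card ?S" unfolding M_def[symmetric] using cS by linarith+
      from less.hyps[OF this(1) finS' this(2) f] card_arrangements[OF finS' this(2)]
      show ?thesis unfolding M_def[symmetric] by simp
    qed
    also have "(\<Sum>A\<in>nonmin_first ?S. \<Sum>r=1..M. \<integral>\<^sup>+z. f z \<partial>nu (Min S # A) (Suc r))
        = (\<Sum>A\<in>nonmin_first ?S. \<Sum>r=1..card ?S. \<integral>\<^sup>+z. f z \<partial>descend (min_cell M) A r)"
      unfolding M_def[symmetric]
    proof (intro sum.cong refl)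
      fix A r assume A: "A \<in> nonmin_first ?S" and r: "r \<in> {1..M}"
      have A': "A \<in> permutations_of_set ?S" using A perm by blast
      have "nu (Min S # A) (Suc r) = descend (min_cell (length (tl (Min S # A)))) (tl (Min S # A)) r"
        by (rule nu_min[OF first(2,1)[OF A']])
          (use A r lm(2)[OF A'] in \<open>auto simp: nonmin_first_def\<close>)
      then show "(\<integral>\<^sup>+z. f z \<partial>nu (Min S # A) (Suc r)) = (\<integral>\<^sup>+z. f z \<partial>descend (min_cell M) A r)"
        using lm(1)[OF A'] cS by simp
    qed
    also have "\<dots> = of_nat c0 * (ennreal ((real M)\<^sup>2) * cell_mass f (min_cell M 0) (min_cell M (card ?S - 1)))"
    proof (rule family_integral[OF incseq_min_cell _ _ f])
      show "min_cell M k - min_cell M (k - 1) = 2 * real k / (real M)\<^sup>2"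
        if "1 \<le> k" "k < card ?S" for k using that min_cell_bounds(4) by (simp add: M_def)
      show "0 < (real M)\<^sup>2" using cS by simp
      show "(\<Sum>B\<in>arrangements P q. \<Sum>r=1..card P. \<integral>\<^sup>+z. g z \<partial>nu B r)
          = of_nat (card (arrangements P q)) * (of_nat (card P) * (\<integral>\<^sup>+z. g z \<partial>limit_law))"
        if "finite P" "card P < card ?S" "q < card P" "g \<in> borel_measurable borel"
        for P :: "'a set" and q g
        proof (rule less.hyps[OF _ that(1,3,4)])
          show "card P < card S" using that(2) cS(1) unfolding M_def[symmetric] by linarith
        qed
    qed
    also have "\<dots> = of_nat (fact (M - 1)) * (of_nat M * (of_nat M * cell_mass f (1 / real M) 1))"
    proof -
      have "c0 = fact (M - 1)" using card_nonmin(2)[OF finS' S'2] by (simp add: M_def)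
      moreover have "min_cell M 0 = 1 / real M" "min_cell M (M - 1) = 1"
        using min_cell_bounds(5,6)[of 1 M] cS by auto
      moreover have "ennreal ((real M)\<^sup>2) = of_nat M * of_nat M"
        by (simp add: power2_eq_square ennreal_mult ennreal_of_nat_eq_real_of_nat)
      ultimately show ?thesis by (simp add: M_def[symmetric] mult.assoc)
    qed
    also have "of_nat (fact M) * (ennreal (real M) * cell_mass f 0 (1 / real M))
        = of_nat (fact (M - 1)) * (of_nat M * (of_nat M * cell_mass f 0 (1 / real M)))"
    proof -
      have "fact M = M * fact (M - 1)" using cS by (simp add: fact_reduce)
      then have "(of_nat (fact M) :: ennreal) = of_nat (fact (M - 1)) * of_nat M"
        by (metis of_nat_mult mult.commute)
      then show ?thesis by (simp add: mult.assoc ennreal_of_nat_eq_real_of_nat)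
    qed
    \<comment> \<open>The cells (0, 1 / M] and (1 / M, 1] together give \<open>M\<close> copies of
      the limit integral and the repeated minimum gives one more, in total
      \<open>card S = M + 1\<close>.\<close>
    also have "of_nat (fact (M - 1)) * (of_nat M * (of_nat M * cell_mass f 0 (1 / real M)))
        + (of_nat (fact (M - 1)) * (of_nat M * ?I)
          + of_nat (fact (M - 1)) * (of_nat M * (of_nat M * cell_mass f (1 / real M) 1)))
        = of_nat (fact (M - 1)) * of_nat M * (of_nat M * (cell_mass f 0 (1 / real M)
            + cell_mass f (1 / real M) 1) + ?I)"
      by (simp add: distrib_left mult.assoc add_ac)
    also have "cell_mass f 0 (1 / real M) + cell_mass f (1 / real M) 1 = ?I"
      unfolding nn_integral_limit_law[OF f] using cS by (intro cell_mass_add f) auto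
    also have "of_nat (fact (M - 1)) * of_nat M * (of_nat M * ?I + ?I)
        = of_nat (card (arrangements S q)) * (of_nat (card S) * ?I)"
    proof -
      have "card (arrangements S q) = fact M"
        using card_arrangements[OF fin, of q] 3 cS by simp
      also have "\<dots> = fact (M - 1) * M" using cS by (simp add: fact_reduce)
      finally have "(of_nat (card (arrangements S q)) :: ennreal) = of_nat (fact (M - 1)) * of_nat M"
        by (metis of_nat_mult)
      moreover have "(of_nat (card S) :: ennreal) = of_nat M + 1" unfolding cS by simp
      ultimately show ?thesis by (simp add: distrib_right)
    qed
    finally show ?thesis .
  qed
qed

section \<open>Exponential moments of the coupling\<close>

definition moment_bound :: "real \<Rightarrow> nat \<Rightarrow> real" where
  "moment_bound s n = exp (s\<^sup>2 * real n / 8 + \<bar>s\<bar> * (69/10 * sqrt (real n)))"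

definition drift_err :: "real \<Rightarrow> real \<Rightarrow> real" where
  "drift_err n k = 1 + 21/10 * (sqrt n - sqrt k)"

lemma nu_facts:
  "prob_space (nu A r)" "sets (nu A r) = sets borel" "AE z in nu A r. 0 \<le> z \<and> z \<le> 1"
  using unit_law_nu[of A r] by (auto simp: unit_law_def)

lemma nth_in_set_take:
  assumes "distinct A" "i < length A" "n \<le> length A"
  shows "A ! i \<in> set (take n A) \<longleftrightarrow> i < n"
proof
  assume "A ! i \<in> set (take n A)"
  then obtain k where k: "k < n" "take n A ! k = A ! i"
    using assms(3) by (auto simp: in_set_conv_nth)
  then have "A ! k = A ! i" by simp
  then have "k = i" using assms k(1) nth_eq_iff_index_eq[OF assms(1), of k i] by simp
  then show "i < n" using k(1) by simp
next
  assume "i < n"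
  then have "take n A ! i \<in> set (take n A)" using assms by (intro nth_mem) simp
  then show "A ! i \<in> set (take n A)" using \<open>i < n\<close> by simp
qed

lemma scale_cancel:
  fixes c :: real
  shows "0 < c \<Longrightarrow> c * b * (w / c * x) = w * (b * x)"
  by simp

lemma two_ennreal: "0 \<le> x \<Longrightarrow> 2 * ennreal x = ennreal (2 * x)"
  by (simp add: ennreal_mult)

lemma moment_bound_nonneg: "0 \<le> moment_bound s n"
  by (simp add: moment_bound_def)

text \<open>The telescoping identity: the cost of a step plus the exponent for size \<open>k\<close>
  is the exponent for the larger size plus |s| times the drift. Here \<open>x\<close> is the number
  of keys charged for fluctuations.\<close>

lemma drift_err_step:
  "s\<^sup>2 * x / 8 + \<bar>s\<bar> * drift_err n (real k) + (s\<^sup>2 * real k / 8 + \<bar>s\<bar> * (69/10 * sqrt (real k)))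
    = (s\<^sup>2 * (x + real k) / 8 + \<bar>s\<bar> * (69/10 * sqrt n)) + \<bar>s\<bar> * drift n (real k)"
proof -
  have "s\<^sup>2 * (x + real k) / 8 = s\<^sup>2 * x / 8 + s\<^sup>2 * real k / 8"
    by (simp add: distrib_left add_divide_distrib)
  moreover have "drift n (real k) = 69/10 * sqrt (real k) - 69/10 * sqrt n + drift_err n (real k)"
    unfolding drift_def drift_err_def by (simp only: right_diff_distrib)
  then have "\<bar>s\<bar> * drift n (real k) = \<bar>s\<bar> * (69/10 * sqrt (real k)) - \<bar>s\<bar> * (69/10 * sqrt n)
      + \<bar>s\<bar> * drift_err n (real k)"
    by (simp only: distrib_left right_diff_distrib)
  ultimately show ?thesis by linarith
qed

lemma exp_step_pivot:
  assumes "k \<le> n"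
  shows "exp (s\<^sup>2 * real (n - k) / 8 + \<bar>s\<bar> * drift_err n k) * moment_bound s k
    = moment_bound s n * exp (\<bar>s\<bar> * drift n k)"
proof -
  have "real (n - k) + real k = real n" using assms by simp
  then show ?thesis
    using drift_err_step[of s "real (n - k)" "real n" k]
    by (simp add: moment_bound_def exp_add[symmetric])
qed

text \<open>Removing the minimum in front causes no fluctuation, so the exponent has s^2 / 8 to
  spare.\<close>

lemma exp_step_min:
  assumes "k \<le> m"
  shows "exp (s\<^sup>2 * real (m - k) / 8 + \<bar>s\<bar> * drift_err (Suc m) k) * moment_bound s k
    \<le> moment_bound s (Suc m) * exp (\<bar>s\<bar> * drift (Suc m) k)"
proof -
  have "exp (s\<^sup>2 * real (m - k) / 8 + \<bar>s\<bar> * drift_err (Suc m) k) * moment_bound s k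
      \<le> exp (s\<^sup>2 * real (Suc m - k) / 8 + \<bar>s\<bar> * drift_err (Suc m) k) * moment_bound s k"
    by (intro mult_right_mono moment_bound_nonneg)
      (simp add: divide_right_mono mult_left_mono)
  also have "\<dots> = moment_bound s (Suc m) * exp (\<bar>s\<bar> * drift (Suc m) k)"
    using assms by (intro exp_step_pivot) simp
  finally show ?thesis .
qed

lemma exp_moment_trivial:
  assumes "distinct A" "length A = n"
  shows "exp_moment s (real n) A r \<le> ennreal (exp (\<bar>s\<bar> * real n))"
proof -
  interpret prob_space "nu A r" by (rule nu_facts)
  have "exp_moment s (real n) A r \<le> (\<integral>\<^sup>+z. ennreal (exp (\<bar>s\<bar> * real n)) \<partial>nu A r)"
    unfolding exp_moment_def
  proof (rule nn_integral_mono_AE)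
    have "AE z in nu A r. 0 \<le> z \<and> z \<le> 1" by (rule nu_facts)
    then show "AE z in nu A r. ennreal (exp (s * (real (key_exchanges A r) - real n * z)))
        \<le> ennreal (exp (\<bar>s\<bar> * real n))"
    proof eventually_elim
      case (elim z)
      have "real (key_exchanges A r) \<le> real n" using key_exchanges_le[OF assms(1), of r] assms(2) by simp
      moreover have "0 \<le> real n * z" "real n * z \<le> real n * 1"
        using elim mult_left_mono[of z 1 "real n"] by auto
      ultimately have "\<bar>real (key_exchanges A r) - real n * z\<bar> \<le> real n" by (intro abs_leI) linarith+
      then have "\<bar>s\<bar> * \<bar>real (key_exchanges A r) - real n * z\<bar> \<le> \<bar>s\<bar> * real n"
        by (intro mult_left_mono) auto
      moreover have "s * (real (key_exchanges A r) - real n * z)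
          \<le> \<bar>s\<bar> * \<bar>real (key_exchanges A r) - real n * z\<bar>"
        by (metis abs_ge_self abs_mult)
      ultimately show ?case by (intro ennreal_leI) simp
    qed
  qed
  then show ?thesis using emeasure_space_1 by simp
qed

text \<open>Since 6.9^2 = 47.61, \<open>real n\<close> is at most \<open>69/10 * sqrt n\<close> up
  to 47. This fixes the threshold 48 of the kernel.\<close>

lemma moment_bound_small:
  assumes "n < 48"
  shows "exp (\<bar>s\<bar> * real n) \<le> moment_bound s n"
proof -
  have "real n \<le> 69/10 * sqrt (real n)"
  proof -
    have "sqrt (real n) \<le> 69/10" using assms by (intro real_le_lsqrt) (auto simp: power2_eq_square)
    then have "sqrt (real n) * sqrt (real n) \<le> 69/10 * sqrt (real n)" by (intro mult_right_mono) auto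
    then show ?thesis by simp
  qed
  then have "\<bar>s\<bar> * real n \<le> \<bar>s\<bar> * (69/10 * sqrt (real n))" by (intro mult_left_mono) auto
  also have "\<dots> \<le> s\<^sup>2 * real n / 8 + \<bar>s\<bar> * (69/10 * sqrt (real n))" by simp
  finally show ?thesis by (simp add: moment_bound_def)
qed

lemma sum_drift_pivot:
  assumes "48 \<le> n" "\<bar>s\<bar> \<le> 4"
  shows "2 * (\<Sum>k=1..<n. real k * (exp (s\<^sup>2 * real (n - k) / 8 + \<bar>s\<bar> * drift_err n k) * moment_bound s k))
    \<le> real n * (real n - 1) * moment_bound s n"
proof -
  let ?c = "real n * (real n - 1)"
  have c: "0 < ?c" using assms by simp
  have "2 * (\<Sum>k=1..<n. real k * (exp (s\<^sup>2 * real (n - k) / 8 + \<bar>s\<bar> * drift_err n k) * moment_bound s k))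
      = (\<Sum>k=1..<n. ?c * moment_bound s n * (2 * real k / ?c * exp (\<bar>s\<bar> * drift n k)))"
    unfolding sum_distrib_left
  proof (rule sum.cong[OF refl])
    fix k assume "k \<in> {1..<n}"
    then have e: "exp (s\<^sup>2 * real (n - k) / 8 + \<bar>s\<bar> * drift_err n k) * moment_bound s k
        = moment_bound s n * exp (\<bar>s\<bar> * drift n k)" by (intro exp_step_pivot) simp
    show "2 * (real k * (exp (s\<^sup>2 * real (n - k) / 8 + \<bar>s\<bar> * drift_err n k) * moment_bound s k))
        = ?c * moment_bound s n * (2 * real k / ?c * exp (\<bar>s\<bar> * drift n k))"
      unfolding e scale_cancel[OF c] by (simp only: mult.assoc)
  qed
  also have "\<dots> = ?c * moment_bound s n * (\<Sum>k=1..<n. 2 * real k / ?c * exp (\<bar>s\<bar> * drift n k))"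
    by (rule sum_distrib_left[symmetric])
  also have "\<dots> \<le> ?c * moment_bound s n * 1"
    using assms c drift_sum_pivot[of n "\<bar>s\<bar>"] moment_bound_nonneg[of s n] by (intro mult_left_mono) auto
  finally show ?thesis by simp
qed

text \<open>The three events for a minimum in front, with the common factor (m - 1)! of the counts
  removed: m! lists stop at rank 1, (m - 1)! lists with m ranks each repeat the minimum, and every
  size \<open>k\<close> is reached 2 k (m - 1)! times.\<close>

lemma sum_drift_min:
  assumes "47 \<le> m" "\<bar>s\<bar> \<le> 4"
  shows "real m * exp (\<bar>s\<bar> * (2 * real (Suc m) / sqrt (real m)))
      + real m * (exp \<bar>s\<bar> * moment_bound s m)
      + 2 * (\<Sum>k=1..<m. real k * (exp (s\<^sup>2 * real (m - k) / 8 + \<bar>s\<bar> * drift_err (Suc m) k) * moment_bound s k))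
    \<le> real m * real (Suc m) * moment_bound s (Suc m)"
proof -
  let ?n = "Suc m" and ?B = "moment_bound s (Suc m)"
  let ?c = "real ?n * real m"
  have c: "0 < ?c" using assms by simp
  have B: "0 \<le> ?B" by (rule moment_bound_nonneg)
  have a1: "exp (\<bar>s\<bar> * (2 * real ?n / sqrt (real m)))
      \<le> ?B * exp (\<bar>s\<bar> * (2 * real ?n / sqrt (real m) - 69/10 * sqrt (real ?n)))"
  proof -
    have "\<bar>s\<bar> * (2 * real ?n / sqrt (real m)) \<le> (s\<^sup>2 * real ?n / 8 + \<bar>s\<bar> * (69/10 * sqrt (real ?n)))
        + \<bar>s\<bar> * (2 * real ?n / sqrt (real m) - 69/10 * sqrt (real ?n))"
      by (simp add: right_diff_distrib)
    then show ?thesis unfolding moment_bound_def exp_add[symmetric] by (simp only: exp_le_cancel_iff)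
  qed
  have a2: "exp \<bar>s\<bar> * moment_bound s m
      \<le> ?B * exp (\<bar>s\<bar> * (69/10 * (sqrt (real m) - sqrt (real ?n)) + 1))"
  proof -
    have "s\<^sup>2 * real m / 8 \<le> s\<^sup>2 * real ?n / 8"
      by (intro divide_right_mono mult_left_mono) auto
    moreover have "\<bar>s\<bar> * (69/10 * (sqrt (real m) - sqrt (real ?n)) + 1)
        = \<bar>s\<bar> * (69/10 * sqrt (real m)) - \<bar>s\<bar> * (69/10 * sqrt (real ?n)) + \<bar>s\<bar>"
      by (simp only: distrib_left right_diff_distrib mult_1_right)
    ultimately have "\<bar>s\<bar> + (s\<^sup>2 * real m / 8 + \<bar>s\<bar> * (69/10 * sqrt (real m)))
        \<le> (s\<^sup>2 * real ?n / 8 + \<bar>s\<bar> * (69/10 * sqrt (real ?n)))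
          + \<bar>s\<bar> * (69/10 * (sqrt (real m) - sqrt (real ?n)) + 1)"
      by linarith
    then show ?thesis unfolding moment_bound_def exp_add[symmetric] by (simp only: exp_le_cancel_iff)
  qed
  have a3: "2 * (\<Sum>k=1..<m. real k * (exp (s\<^sup>2 * real (m - k) / 8 + \<bar>s\<bar> * drift_err ?n k) * moment_bound s k))
      \<le> ?c * ?B * (\<Sum>k=1..<m. 2 * real k / ?c * exp (\<bar>s\<bar> * drift ?n k))"
    unfolding sum_distrib_left
  proof (rule sum_mono)
    fix k assume k: "k \<in> {1..<m}"
    have "2 * (real k * (exp (s\<^sup>2 * real (m - k) / 8 + \<bar>s\<bar> * drift_err ?n k) * moment_bound s k))
        \<le> 2 * (real k * (?B * exp (\<bar>s\<bar> * drift ?n k)))"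
      using k by (intro mult_left_mono exp_step_min) auto
    also have "\<dots> = ?c * ?B * (2 * real k / ?c * exp (\<bar>s\<bar> * drift ?n k))"
      unfolding scale_cancel[OF c] by (simp only: mult.assoc)
    finally show "2 * (real k * (exp (s\<^sup>2 * real (m - k) / 8 + \<bar>s\<bar> * drift_err ?n k) * moment_bound s k))
        \<le> ?c * ?B * (2 * real k / ?c * exp (\<bar>s\<bar> * drift ?n k))" .
  qed
  have D: "exp (\<bar>s\<bar> * (69/10 * (sqrt (real m) - sqrt (real ?n)) + 1)) / real ?n
      + exp (\<bar>s\<bar> * (2 * real ?n / sqrt (real m) - 69/10 * sqrt (real ?n))) / real ?n
      + (\<Sum>k=1..<m. 2 * real k / ?c * exp (\<bar>s\<bar> * drift ?n k)) \<le> 1"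
    using drift_sum_min[of ?n "\<bar>s\<bar>"] assms by simp
  have "real m * exp (\<bar>s\<bar> * (2 * real ?n / sqrt (real m))) + real m * (exp \<bar>s\<bar> * moment_bound s m)
      + 2 * (\<Sum>k=1..<m. real k * (exp (s\<^sup>2 * real (m - k) / 8 + \<bar>s\<bar> * drift_err ?n k) * moment_bound s k))
    \<le> real m * (?B * exp (\<bar>s\<bar> * (2 * real ?n / sqrt (real m) - 69/10 * sqrt (real ?n))))
      + real m * (?B * exp (\<bar>s\<bar> * (69/10 * (sqrt (real m) - sqrt (real ?n)) + 1)))
      + ?c * ?B * (\<Sum>k=1..<m. 2 * real k / ?c * exp (\<bar>s\<bar> * drift ?n k))"
    using a1 a2 a3 by (intro add_mono mult_left_mono) auto
  also have "\<dots> = ?c * ?B * (exp (\<bar>s\<bar> * (69/10 * (sqrt (real m) - sqrt (real ?n)) + 1)) / real ?n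
      + exp (\<bar>s\<bar> * (2 * real ?n / sqrt (real m) - 69/10 * sqrt (real ?n))) / real ?n
      + (\<Sum>k=1..<m. 2 * real k / ?c * exp (\<bar>s\<bar> * drift ?n k)))"
  proof -
    have "?c * ?B * (x / real ?n) = real m * (?B * x)" for x by simp
    then show ?thesis by (simp only: distrib_left add_ac)
  qed
  also have "\<dots> \<le> ?c * ?B * 1" using D B c by (intro mult_left_mono) auto
  finally show ?thesis by (simp add: mult.commute mult.left_commute)
qed

context pivot_family
begin

text \<open>For pivot \<open>v\<close>, \<open>V v\<close> holds the shuffled keys and
  \<open>d a\<close> counts those among the first \<open>a\<close> places. This number must depend
  on \<open>v\<close> only through the size \<open>a\<close> of the left part, which is why the
  place of the minimum has to be the same throughout the family or the minimum has to be shuffled as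
  well.\<close>

lemma family_exp_moment:
  fixes s N :: real
  assumes tt: "\<And>k. 1 \<le> k \<Longrightarrow> k < card S \<Longrightarrow> t (k - 1) < t k"
    and V: "\<And>v. v \<in> S - {Min S} \<Longrightarrow> V v \<subseteq> S - {v} \<and> {x \<in> S. v < x} \<subseteq> V v"
    and closedV: "\<And>v \<sigma> A. v \<in> S - {Min S} \<Longrightarrow> \<sigma> permutes V v \<Longrightarrow> A \<in> cls v \<Longrightarrow> map \<sigma> A \<in> cls v"
    and d: "\<And>v A. v \<in> S - {Min S} \<Longrightarrow> A \<in> cls v \<Longrightarrow>
      card (V v \<inter> set (take (card {x \<in> S. x < v}) A)) = d (card {x \<in> S. x < v})"
    and cV: "\<And>v. v \<in> S - {Min S} \<Longrightarrow> card (V v) = nV"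
    and dle: "\<And>a. 1 \<le> a \<Longrightarrow> a < card S \<Longrightarrow> d a \<le> a" "\<And>a. 1 \<le> a \<Longrightarrow> a < card S \<Longrightarrow> nV - d a \<le> card S - a"
    and drift: "\<And>a k z u. 1 \<le> a \<Longrightarrow> a < card S \<Longrightarrow> k = a \<or> k = card S - a \<Longrightarrow> 0 \<le> z \<Longrightarrow> z \<le> 1 \<Longrightarrow>
      u \<in> {t (k - 1)<..t k} \<Longrightarrow>
      \<bar>1 + real (d a) * real (card S - a - 1) / real nV + real k * z - N * step z u\<bar> \<le> \<delta> k"
    and IH: "\<And>(P :: 'a set) q. finite P \<Longrightarrow> card P < card S \<Longrightarrow> q < card P \<Longrightarrow>
      (\<Sum>B\<in>arrangements P q. \<Sum>r=1..card P. exp_moment s (real (card P)) B r)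
      \<le> of_nat (card (arrangements P q)) * ennreal (real (card P) * moment_bound s (card P))"
  shows "(\<Sum>A\<in>\<D>. \<Sum>r=1..card S.
      \<integral>\<^sup>+z. ennreal (exp (s * (real (key_exchanges A r) - N * z))) \<partial>descend t A r)
    \<le> of_nat c0 * ennreal (2 * (\<Sum>k=1..<card S.
        real k * (exp (s\<^sup>2 * real (card S - k) / 8 + \<bar>s\<bar> * \<delta> k) * moment_bound s k)))"
proof -
  let ?g = "\<lambda>k. real k * (exp (s\<^sup>2 * real (card S - k) / 8 + \<bar>s\<bar> * \<delta> k) * moment_bound s k)"
  let ?J = "\<lambda>A r. \<integral>\<^sup>+z. ennreal (exp (s * (real (key_exchanges A r) - N * z))) \<partial>descend t A r"
  have g: "0 \<le> ?g k" for k by (intro mult_nonneg_nonneg moment_bound_nonneg) auto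
  have "(\<Sum>A\<in>\<D>. \<Sum>r=1..card S. ?J A r) \<le> of_nat c0 * (2 * (\<Sum>k=1..<card S. ennreal (?g k)))"
  proof (rule family_le)
    fix v assume v: "v \<in> S - {Min S}"
    interpret pivot_class S v "cls v" using v by (rule cls_pivot)
    note cs = class_sizes[OF v]
    have a: "1 \<le> card L" "card L < card S" using LR(8) card_R(2) by auto
    have "(\<Sum>A\<in>cls v. \<Sum>r=1..card S. ?J A r) \<le> of_nat (card (cls v)) * (ennreal (?g (card L)) + ennreal (?g (card R)))"
    proof (rule descend_exp_moment[where t = t and V = "V v" and d = "d (card L)" and b = "moment_bound s" and \<delta> = \<delta>])
      show "t (k - 1) < t k" if "1 \<le> k" "k < card S" for k using that by (rule tt)
      show "V v \<subseteq> S - {v}" "{x \<in> S. v < x} \<subseteq> V v" using V[OF v] by blast+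
      show "map \<sigma> A \<in> cls v" if "\<sigma> permutes V v" "A \<in> cls v" for \<sigma> A using v that by (rule closedV)
      show "card (V v \<inter> set (take (card L) A)) = d (card L)" if "A \<in> cls v" for A
        using d[OF v that] unfolding L_def .
      show "d (card L) \<le> card L" using a by (rule dle(1))
      show "card (V v) - d (card L) \<le> card R" unfolding cV[OF v] card_R(1) using a by (rule dle(2))
      show "\<bar>1 + real (d (card L)) * real (card {x \<in> S. v < x}) / real (card (V v)) + real k * z - N
          * step z u\<bar> \<le> \<delta> k"
        if "k = card L \<or> k = card R" "0 \<le> z" "z \<le> 1" "u \<in> {t (k - 1)<..t k}" for k z u
        using drift[OF a that(1)[unfolded card_R(1)] that(2-4)] unfolding cV[OF v] cs(4) L_def .
      show "(\<Sum>B\<in>arrangements P q. \<Sum>r=1..card P. exp_moment s (real (card P)) B r)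
          \<le> of_nat (card (arrangements P q)) * ennreal (real (card P) * moment_bound s (card P))"
        if "P = L \<or> P = R" "q < card P" for P q
      proof -
        have "finite P" "card P < card S" using that(1) LR(1,2) card_R(2,3) by auto
        then show ?thesis using that(2) by (rule IH)
      qed
    qed (rule moment_bound_nonneg)
    then show "(\<Sum>A\<in>cls v. \<Sum>r=1..card S. ?J A r)
        \<le> of_nat (card (cls v)) * (ennreal (?g (card {x \<in> S. x < v})) + ennreal (?g (card S - card {x \<in> S. x < v})))"
      unfolding cs(3) cs(1) .
  qed
  also have "(\<Sum>k=1..<card S. ennreal (?g k)) = ennreal (\<Sum>k=1..<card S. ?g k)"
    by (rule sum_ennreal) (rule g)
  also have "2 * ennreal (\<Sum>k=1..<card S. ?g k) = ennreal (2 * (\<Sum>k=1..<card S. ?g k))"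
    by (intro two_ennreal sum_nonneg g)
  finally show ?thesis .
qed

end

text \<open>Averaging over the rank as well as the list is essential, for the exponential drift is
  controlled only in the mean over the new size. Lists shorter than 48 use the trivial bound, the
  others the drift sums.\<close>

theorem nu_exp_moment:
  fixes S :: "'a::linorder set" and s :: real
  assumes "finite S" "q < card S" and s: "\<bar>s\<bar> \<le> 4"
  shows "(\<Sum>A\<in>arrangements S q. \<Sum>r=1..card S. exp_moment s (real (card S)) A r)
    \<le> of_nat (card (arrangements S q)) * ennreal (real (card S) * moment_bound s (card S))"
  using assms(1,2)
proof (induction "card S" arbitrary: S q rule: less_induct)
  case less
  note fin = less.prems(1)
  have arr: "length A = card S" "set A = S" "distinct A" "A ! q = Min S" if "A \<in> arrangements S q" for A
    using that by (auto simp: arrangements_def dest: perm_facts)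
  consider "card S < 48" | "48 \<le> card S" "1 \<le> q" | "48 \<le> card S" "q = 0" by linarith
  then show ?case
  proof cases
    case 1
    have "(\<Sum>A\<in>arrangements S q. \<Sum>r=1..card S. exp_moment s (real (card S)) A r)
        \<le> (\<Sum>A\<in>arrangements S q. \<Sum>r=1..card S. ennreal (moment_bound s (card S)))"
    proof (intro sum_mono)
      fix A r assume A: "A \<in> arrangements S q"
      have "exp_moment s (real (card S)) A r \<le> ennreal (exp (\<bar>s\<bar> * real (card S)))"
        using arr(3,1)[OF A] by (rule exp_moment_trivial)
      also have "\<dots> \<le> ennreal (moment_bound s (card S))"
        using moment_bound_small[OF 1] by (rule ennreal_leI)
      finally show "exp_moment s (real (card S)) A r \<le> ennreal (moment_bound s (card S))" .
    qed
    also have "\<dots> = of_nat (card (arrangements S q)) * ennreal (real (card S) * moment_bound s (card S))"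
      by (simp add: ennreal_mult moment_bound_nonneg ennreal_of_nat_eq_real_of_nat)
    finally show ?thesis .
  next
    case 2
    let ?n = "card S"
    interpret pivot_family S "arrangements S q"
      by (rule pivot_family_arrangements[OF fin _ 2(2) less.prems(2)]) (use 2(1) in simp)
    \<comment> \<open>The first \<open>a\<close> places hold the pivot and, if \<open>q < a\<close>,
      also the minimum; neither is shuffled.\<close>
    define d where "d a = (if q < a then a - 2 else a - 1)" for a
    have minS: "Min S \<in> S" using fin S_ne by (rule Min_in)
    have "(\<Sum>A\<in>arrangements S q. \<Sum>r=1..?n. exp_moment s (real ?n) A r)
        = (\<Sum>A\<in>arrangements S q. \<Sum>r=1..?n.
          \<integral>\<^sup>+z. ennreal (exp (s * (real (key_exchanges A r) - real ?n * z))) \<partial>descend (pivot_cell ?n) A r)"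
    proof (intro sum.cong refl)
      fix A r assume A: "A \<in> arrangements S q"
      have "nu A r = descend (pivot_cell (length A)) A r"
      proof (rule nu_pivot)
        show "48 \<le> length A" unfolding arr(1)[OF A] by (rule 2(1))
        show "A ! 0 \<noteq> Min (set A)" unfolding arr(2)[OF A] by (rule D_hd[OF A])
      qed
      then show "exp_moment s (real ?n) A r
          = (\<integral>\<^sup>+z. ennreal (exp (s * (real (key_exchanges A r) - real ?n * z))) \<partial>descend (pivot_cell ?n) A r)"
        unfolding arr(1)[OF A] exp_moment_def by simp
    qed
    also have "\<dots> \<le> of_nat c0 * ennreal (2 * (\<Sum>k=1..<?n.
        real k * (exp (s\<^sup>2 * real (?n - k) / 8 + \<bar>s\<bar> * drift_err ?n k) * moment_bound s k)))"
    proof (rule family_exp_moment[where V = "\<lambda>v. S - {v, Min S}" and d = d and nV = "?n - 2"])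
      show "pivot_cell ?n (k - 1) < pivot_cell ?n k" if "1 \<le> k" "k < ?n" for k
        using that by (rule pivot_cell_bounds(2))
      show "S - {v, Min S} \<subseteq> S - {v} \<and> {x \<in> S. v < x} \<subseteq> S - {v, Min S}" if "v \<in> S - {Min S}" for v
      proof -
        have "Min S \<le> v" using that fin by simp
        then have "\<not> v < Min S" by simp
        then show ?thesis by blast
      qed
      show "map \<sigma> A \<in> cls v" if v: "v \<in> S - {Min S}" "\<sigma> permutes S - {v, Min S}" "A \<in> cls v" for v \<sigma> A
        using pivot_class.closed[OF cls_pivot[OF v(1)] v(2,3)] .
      show "card (S - {v, Min S}) = ?n - 2" if "v \<in> S - {Min S}" for v
        using that fin minS by (simp add: card_Diff_subset)
      show "d a \<le> a" for a by (simp add: d_def)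
      show "?n - 2 - d a \<le> ?n - a" if "1 \<le> a" "a < ?n" for a using that by (auto simp: d_def)
      show "(\<Sum>B\<in>arrangements P q. \<Sum>r=1..card P. exp_moment s (real (card P)) B r)
          \<le> of_nat (card (arrangements P q)) * ennreal (real (card P) * moment_bound s (card P))"
        if "finite P" "card P < ?n" "q < card P" for P :: "'a set" and q
        by (rule less.hyps[OF that(2,1,3)])
      show "card ((S - {v, Min S}) \<inter> set (take (card {x \<in> S. x < v}) A)) = d (card {x \<in> S. x < v})"
        if v: "v \<in> S - {Min S}" and A: "A \<in> cls v" for v A
      proof -
        let ?I = "card {x \<in> S. x < v}"
        note cs = class_sizes[OF v]
        have A': "A \<in> arrangements S q" "A ! 0 = v" using A by (auto simp: cls_def)
        note arrA = arr[OF A'(1)]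
        have I: "1 \<le> ?I" "?I < length A" using cs(5,6) arrA(1) by auto
        have card_take: "card (set (take ?I A)) = ?I"
          using arrA(3) I by (simp add: distinct_card)
        have v_in: "v \<in> set (take ?I A)"
        proof -
          have "A ! 0 \<in> set (take ?I A) \<longleftrightarrow> 0 < ?I"
            by (rule nth_in_set_take[OF arrA(3)]) (use I in linarith)+
          then show ?thesis unfolding A'(2) using I(1) by linarith
        qed
        have min_in: "Min S \<in> set (take ?I A) \<longleftrightarrow> q < ?I"
        proof -
          have "A ! q \<in> set (take ?I A) \<longleftrightarrow> q < ?I"
            by (rule nth_in_set_take[OF arrA(3)]) (use I less.prems(2) arrA(1) in linarith)+
          then show ?thesis unfolding arrA(4) .
        qed
        have "(S - {v, Min S}) \<inter> set (take ?I A) = set (take ?I A) - {v, Min S}"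
          using arrA(2) by (auto dest: in_set_takeD)
        also have "card \<dots> = d ?I"
        proof (cases "q < ?I")
          case True
          then have "{v, Min S} \<subseteq> set (take ?I A)" using v_in min_in by simp
          moreover have "card {v, Min S} = 2" using v by simp
          ultimately show ?thesis using True card_take by (simp add: card_Diff_subset d_def)
        next
          case False
          then have "set (take ?I A) - {v, Min S} = set (take ?I A) - {v}" using min_in by auto
          then show ?thesis using False card_take v_in by (simp add: d_def)
        qed
        finally show ?thesis .
      qed
      show "\<bar>1 + real (d a) * real (?n - a - 1) / real (?n - 2) + real k * z - real ?n * step z u\<bar> \<le> drift_err ?n k"
        if a: "1 \<le> a" "a < ?n" and k: "k = a \<or> k = ?n - a" and z: "0 \<le> z" "z \<le> 1"
          and u: "u \<in> {pivot_cell ?n (k - 1)<..pivot_cell ?n k}" for a k z u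
      proof -
        have k1: "1 \<le> k" "k < ?n" using a k by auto
        define e :: real where "e = (if q < a then 1 else 0)"
        \<comment> \<open>The truncated subtraction is exact: \<open>1 \<le> q < a\<close> forces
          \<open>a \<ge> 2\<close>.\<close>
        have da: "real (d a) = real a - 1 - e"
          using a 2(2) by (auto simp: d_def e_def of_nat_diff)
        have r: "real (?n - a - 1) = real ?n - real a - 1" "real (?n - 2) = real ?n - 2"
          using a 2(1) by (auto simp: of_nat_diff)
        have n0: "0 < real ?n * (real ?n - 1)" using 2(1) by simp
        have u0: "0 \<le> u" using u pivot_cell_bounds(1)[OF k1] by auto
        have "\<bar>1 + (real a - 1 - e) * (real ?n - real a - 1) / (real ?n - 2) + real k * z
            - real ?n * (sqrt u * z + sqrt u * (1 - sqrt u))\<bar> \<le> 1 + 21/10 * (sqrt (real ?n) - sqrt (real k))"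
        proof (rule drift_error_pivot)
          show "real k * (real k - 1) \<le> real ?n * (real ?n - 1) * u"
            using u n0 unfolding pivot_cell_bounds(7)[OF k1] by (simp add: divide_less_eq mult.commute)
          show "real ?n * (real ?n - 1) * u \<le> real k * (real k + 1)"
            using u n0 unfolding pivot_cell_bounds(8)[OF k1] by (simp add: le_divide_eq mult.commute)
        qed (use a k k1 z u0 2(1) in \<open>auto simp: e_def of_nat_diff\<close>)
        then show ?thesis unfolding da r drift_err_def step_def .
      qed
    qed
    also have "\<dots> \<le> of_nat c0 * ennreal (real ?n * (real ?n - 1) * moment_bound s ?n)"
      using sum_drift_pivot[OF 2(1) s] by (intro mult_left_mono ennreal_leI) auto
    also have "\<dots> = of_nat (card (arrangements S q)) * ennreal (real ?n * moment_bound s ?n)"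
    proof -
      have n1: "(of_nat (?n - 1) :: ennreal) = ennreal (real ?n - 1)"
        using 2(1) by (simp add: ennreal_of_nat_eq_real_of_nat of_nat_diff)
      have "ennreal (real ?n * (real ?n - 1) * moment_bound s ?n)
          = ennreal (real ?n - 1) * ennreal (real ?n * moment_bound s ?n)"
        using 2(1) moment_bound_nonneg[of s ?n] by (subst ennreal_mult[symmetric]) (auto simp: mult_ac)
      then show ?thesis unfolding card_D of_nat_mult n1 by (simp add: mult_ac)
    qed
    finally show ?thesis .
  next
    case 3
    let ?S = "S - {Min S}" and ?n = "card S"
    define M where "M = card ?S"
    have S2: "2 \<le> card S" using 3 by simp
    have cS: "card S = Suc M" "47 \<le> M"
    proof -
      have "Min S \<in> S" by (rule Min_in[OF fin]) (use S2 in auto)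
      then have "M = card S - 1" unfolding M_def by (rule card_Diff_singleton)
      then show "card S = Suc M" "47 \<le> M" using 3(1) by linarith+
    qed
    have finS': "finite ?S" using fin by simp
    have S'2: "2 \<le> card ?S" unfolding M_def[symmetric] using cS(2) by linarith
    interpret pivot_family ?S "nonmin_first ?S" by (rule pivot_family_nonmin[OF finS' S'2])
    note lm = list_with_min_first[OF fin S2]
    have first: "(Min S # A) ! 0 = Min (set (Min S # A))" "48 \<le> length (Min S # A)"
      if A: "A \<in> permutations_of_set ?S" for A
      unfolding lm(4)[OF A] lm(6)[OF A] using 3(1) by (simp_all only: nth_Cons_0)
    have perm: "permutations_of_set ?S \<supseteq> arrangements ?S 0" "permutations_of_set ?S \<supseteq> nonmin_first ?S"
      unfolding arrangements_def nonmin_first_def by blast+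
    let ?E = "\<lambda>A r. exp_moment s (real ?n) (Min S # A) r"
    define st where "st = ennreal (exp (\<bar>s\<bar> * (2 * real (Suc M) / sqrt (real M))))"
    have stop: "?E A 1 \<le> st" if A: "A \<in> permutations_of_set ?S" for A
    proof -
      have nu1: "nu (Min S # A) 1 = refine limit_law 0 (1 / real M)"
      proof -
        have "nu (Min S # A) 1 = refine limit_law 0 (min_cell (length (Min S # A) - 1) 0)"
          by (rule nu_stop[OF first(2)[OF A] first(1)[OF A]])
        also have "min_cell (length (Min S # A) - 1) 0 = 1 / real M"
          unfolding lm(6)[OF A] cS(1) using cS(2) min_cell_bounds(5)[of 1 M] by simp
        finally show ?thesis .
      qed
      have M0: "0 < 1 / real M" "1 / real M \<le> 1" using cS(2) by auto
      \<comment> \<open>There are no exchanges and no recursive call, so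
        \<open>exp_refine_le\<close> is applied with \<open>m = 0\<close> and \<open>k = 0\<close>.
        On the stopping cell sqrt u is at most 1 / sqrt M, and \<open>step z u\<close> is at most 2
        sqrt u.\<close>
      have drift0: "\<bar>0 + 0 * z - real ?n * step z u\<bar> \<le> 2 * real (Suc M) / sqrt (real M)"
        if z: "0 \<le> z" "z \<le> 1" and u: "u \<in> {0<..1 / real M}" for z u
      proof -
        have uM: "0 \<le> u" "u \<le> 1 / real M" using u by auto
        have u01: "0 \<le> u" "u \<le> 1" using uM M0(2) by linarith+
        have su: "sqrt u \<le> 1 / sqrt (real M)"
          using real_sqrt_le_mono[OF uM(2)] by (simp only: real_sqrt_divide real_sqrt_one)
        have "step z u \<le> sqrt u * 1 + sqrt u * 1"
          unfolding step_def using z u01 by (intro add_mono mult_left_mono) auto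
        also have "\<dots> \<le> 2 / sqrt (real M)" using su by simp
        finally have "real ?n * step z u \<le> real ?n * (2 / sqrt (real M))" by (rule mult_left_mono) simp
        also have "real ?n * (2 / sqrt (real M)) = 2 * real (Suc M) / sqrt (real M)"
          unfolding cS(1) by simp
        finally have le: "real ?n * step z u \<le> 2 * real (Suc M) / sqrt (real M)" .
        have "0 \<le> real ?n * step z u" using step_range(1)[OF z u01] by simp
        moreover have "0 + 0 * z - real ?n * step z u = - (real ?n * step z u)" by simp
        ultimately show ?thesis using le by (simp only: abs_minus_cancel abs_of_nonneg)
      qed
      have "?E A 1 = (\<integral>\<^sup>+z. ennreal (exp (s * (0 + 0 - real ?n * z))) \<partial>refine limit_law 0 (1 / real M))"
        unfolding exp_moment_def lm(8)[OF A] nu1 by simp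
      also have "\<dots> \<le> ennreal (exp (s * (0 - 0))) * (ennreal (exp (\<bar>s\<bar> * (2 * real (Suc M) / sqrt (real M))))
          * (\<integral>\<^sup>+z. ennreal (exp (s * (0 - 0 * z))) \<partial>limit_law))"
        by (rule exp_refine_le[OF unit_law_limit M0(1) drift0])
      also have "\<dots> = st"
        using unit_law_limit prob_space.emeasure_space_1[of limit_law] by (simp add: unit_law_def st_def)
      finally show ?thesis .
    qed
    \<comment> \<open>The kernel is kept unchanged while the scaling factor drops from
      \<open>M + 1\<close> to \<open>M\<close>; with \<open>z\<close> in [0, 1] this shifts the
      exponent by at most |s|.\<close>
    have lazy: "?E A (Suc r) \<le> ennreal (exp \<bar>s\<bar>) * exp_moment s (real M) A r"
      if A: "A \<in> arrangements ?S 0" and r: "r \<in> {1..M}" for A r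
    proof -
      have A': "A \<in> permutations_of_set ?S" using A perm by blast
      have r1: "1 \<le> r" using r by simp
      have "nu (Min S # A) (Suc r) = nu (tl (Min S # A)) r"
        by (rule nu_lazy[OF first(2,1)[OF A'] _ r1])
          (use A lm(2)[OF A'] in \<open>auto simp: arrangements_def\<close>)
      then have nu1: "nu (Min S # A) (Suc r) = nu A r" by simp
      have [measurable_cong]: "sets (nu A r) = sets borel" by (rule nu_facts)
      have "?E A (Suc r) = (\<integral>\<^sup>+z. ennreal (exp (s * (real (key_exchanges A r) - real ?n * z))) \<partial>nu A r)"
        unfolding exp_moment_def lm(9)[OF A' r1] nu1 ..
      also have "\<dots> \<le> (\<integral>\<^sup>+z. ennreal (exp \<bar>s\<bar>) * ennreal (exp (s * (real (key_exchanges A r) - real M * z))) \<partial>nu A r)"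
      proof (rule nn_integral_mono_AE)
        have "AE z in nu A r. 0 \<le> z \<and> z \<le> 1" by (rule nu_facts)
        then show "AE z in nu A r. ennreal (exp (s * (real (key_exchanges A r) - real ?n * z)))
            \<le> ennreal (exp \<bar>s\<bar>) * ennreal (exp (s * (real (key_exchanges A r) - real M * z)))"
        proof eventually_elim
          case (elim z)
          have "- s * z \<le> \<bar>s\<bar> * 1"
            using elim by (intro mult_mono) auto
          then have "s * (real (key_exchanges A r) - real ?n * z)
              \<le> \<bar>s\<bar> + s * (real (key_exchanges A r) - real M * z)"
            unfolding cS(1) by (simp add: algebra_simps)
          then show ?case
            unfolding ennreal_mult'[symmetric, OF exp_ge_zero] exp_add[symmetric] by (intro ennreal_leI) simp
        qed
      qed
      also have "\<dots> = ennreal (exp \<bar>s\<bar>) * exp_moment s (real M) A r"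
        unfolding exp_moment_def by (rule nn_integral_cmult) measurable
      finally show ?thesis .
    qed
    have "(\<Sum>A\<in>arrangements S q. \<Sum>r=1..?n. exp_moment s (real ?n) A r)
        = (\<Sum>A\<in>permutations_of_set ?S. ?E A 1 + (\<Sum>r=1..M. ?E A (Suc r)))"
      unfolding 3(2) sum_arrangements_0[OF fin S2]
    proof (intro sum.cong refl)
      fix A
      have "(\<Sum>r=1..?n. ?E A r) = (\<Sum>r=1..1. ?E A r) + (\<Sum>r=1..?n - 1. ?E A (1 + r))"
        using cS by (intro sum_split_rank) simp
      then show "(\<Sum>r=1..?n. ?E A r) = ?E A 1 + (\<Sum>r=1..M. ?E A (Suc r))"
        using cS(1) by simp
    qed
    also have "\<dots> = (\<Sum>A\<in>permutations_of_set ?S. ?E A 1)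
        + ((\<Sum>A\<in>arrangements ?S 0. \<Sum>r=1..M. ?E A (Suc r)) + (\<Sum>A\<in>nonmin_first ?S. \<Sum>r=1..M. ?E A (Suc r)))"
      by (simp only: sum.distrib sum_permutations_split[of _ ?S])
    also have "\<dots> \<le> of_nat (fact M) * st
        + (ennreal (exp \<bar>s\<bar>) * (of_nat (fact (M - 1)) * ennreal (real M * moment_bound s M))
        + of_nat (fact (M - 1)) * ennreal (2 * (\<Sum>k=1..<M. real k * (exp (s\<^sup>2 * real (M - k) / 8
            + \<bar>s\<bar> * drift_err (Suc M) k) * moment_bound s k))))"
    proof (intro add_mono)
      have "(\<Sum>A\<in>permutations_of_set ?S. ?E A 1) \<le> (\<Sum>A\<in>permutations_of_set ?S. st)"
        by (rule sum_mono) (rule stop)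
      also have "\<dots> = of_nat (fact M) * st"
        unfolding sum_constant card_permutations_of_set[OF finS'] M_def ..
      finally show "(\<Sum>A\<in>permutations_of_set ?S. ?E A 1) \<le> of_nat (fact M) * st" .
    next
      have lt: "card ?S < card S" "0 < card ?S" unfolding M_def[symmetric] using cS by linarith+
      have "(\<Sum>A\<in>arrangements ?S 0. \<Sum>r=1..M. ?E A (Suc r))
          \<le> (\<Sum>A\<in>arrangements ?S 0. \<Sum>r=1..M. ennreal (exp \<bar>s\<bar>) * exp_moment s (real M) A r)"
        by (intro sum_mono lazy)
      also have "\<dots> = ennreal (exp \<bar>s\<bar>) * (\<Sum>A\<in>arrangements ?S 0. \<Sum>r=1..M. exp_moment s (real M) A r)"
        by (simp only: sum_distrib_left)
      also have "\<dots> \<le> ennreal (exp \<bar>s\<bar>) * (of_nat (fact (M - 1)) * ennreal (real M * moment_bound s M))"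
        using less.hyps[OF lt(1) finS' lt(2)] unfolding card_arrangements[OF finS' lt(2)] M_def[symmetric]
        by (rule mult_left_mono) simp
      finally show "(\<Sum>A\<in>arrangements ?S 0. \<Sum>r=1..M. ?E A (Suc r))
          \<le> ennreal (exp \<bar>s\<bar>) * (of_nat (fact (M - 1)) * ennreal (real M * moment_bound s M))" .
    next
      have "(\<Sum>A\<in>nonmin_first ?S. \<Sum>r=1..M. ?E A (Suc r)) = (\<Sum>A\<in>nonmin_first ?S. \<Sum>r=1..card ?S.
          \<integral>\<^sup>+z. ennreal (exp (s * (real (key_exchanges A r) - real ?n * z))) \<partial>descend (min_cell M) A r)"
        unfolding M_def[symmetric]
      proof (intro sum.cong refl)
        fix A r assume A: "A \<in> nonmin_first ?S" and r: "r \<in> {1..M}"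
        have A': "A \<in> permutations_of_set ?S" using A perm by blast
        have r1: "1 \<le> r" using r by simp
        have "nu (Min S # A) (Suc r) = descend (min_cell (length (tl (Min S # A)))) (tl (Min S # A)) r"
          by (rule nu_min[OF first(2,1)[OF A'] _ r1])
            (use A lm(2)[OF A'] in \<open>auto simp: nonmin_first_def\<close>)
        then have "nu (Min S # A) (Suc r) = descend (min_cell M) A r"
          using lm(1)[OF A'] cS(1) by simp
        then show "?E A (Suc r) = (\<integral>\<^sup>+z. ennreal (exp (s * (real (key_exchanges A r) - real ?n * z)))
            \<partial>descend (min_cell M) A r)"
          unfolding exp_moment_def lm(9)[OF A' r1] by simp
      qed
      also have "\<dots> \<le> of_nat c0 * ennreal (2 * (\<Sum>k=1..<card ?S. real k * (exp (s\<^sup>2 * real (card ?S - k) / 8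
            + \<bar>s\<bar> * drift_err (Suc M) k) * moment_bound s k)))"
      \<comment> \<open>The minimum of the tail may be anywhere behind the first place, so it is
        shuffled too: among the first \<open>a\<close> places only the pivot is fixed, and the draws
        come from \<open>M - 1\<close> keys.\<close>
      proof (rule family_exp_moment[where V = "\<lambda>v. ?S - {v}" and d = "\<lambda>a. a - 1" and nV = "card ?S - 1"])
        show "min_cell M (k - 1) < min_cell M k" if "1 \<le> k" "k < card ?S" for k
          using that unfolding M_def[symmetric] by (rule min_cell_bounds(2))
        show "?S - {v} \<subseteq> ?S - {v} \<and> {x \<in> ?S. v < x} \<subseteq> ?S - {v}" for v by auto
        show "map \<sigma> A \<in> cls v" if v: "v \<in> ?S - {Min ?S}" "\<sigma> permutes ?S - {v}" "A \<in> cls v" for v \<sigma> A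
        proof -
          have A: "A \<in> permutations_of_set ?S" "A ! 0 = v"
            using v(3) unfolding cls_def by (auto simp: nonmin_first_def)
          have p: "\<sigma> permutes ?S" by (rule permutes_subset[OF v(2)]) auto
          have "\<sigma> v = v" using v(2) by (simp add: permutes_def)
          moreover have "A \<noteq> []" using perm_facts(3)[OF A(1)] S'2 by auto
          ultimately have "map \<sigma> A ! 0 = v" using A(2) by simp
          moreover have "map \<sigma> A \<in> permutations_of_set ?S"
            using perm_facts(1,2)[OF A(1)] p
            by (intro permutations_of_setI) (simp_all add: permutes_image distinct_map permutes_inj_on)
          ultimately show ?thesis using v(1) unfolding cls_def by (simp add: nonmin_first_def)
        qed
        show "card (?S - {v}) = card ?S - 1" if "v \<in> ?S - {Min ?S}" for v
          using that by (intro card_Diff_singleton) blast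
        show "a - 1 \<le> a" for a :: nat by simp
        show "card ?S - 1 - (a - 1) \<le> card ?S - a" for a by simp
        show "(\<Sum>B\<in>arrangements P q. \<Sum>r=1..card P. exp_moment s (real (card P)) B r)
            \<le> of_nat (card (arrangements P q)) * ennreal (real (card P) * moment_bound s (card P))"
          if "finite P" "card P < card ?S" "q < card P" for P :: "'a set" and q
        proof (rule less.hyps[OF _ that(1,3)])
          show "card P < card S" using that(2) cS(1) unfolding M_def[symmetric] by linarith
        qed
        show "card ((?S - {v}) \<inter> set (take (card {x \<in> ?S. x < v}) A)) = card {x \<in> ?S. x < v} - 1"
          if v: "v \<in> ?S - {Min ?S}" and A: "A \<in> cls v" for v A
        proof -
          let ?I = "card {x \<in> ?S. x < v}"
          note cs = class_sizes[OF v]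
          have A': "A \<in> permutations_of_set ?S" "A ! 0 = v" using A unfolding cls_def by (auto simp: nonmin_first_def)
          note pf = perm_facts[OF A'(1)]
          have I: "1 \<le> ?I" "?I < length A" using cs(5,6) pf(3) by auto
          have card_take: "card (set (take ?I A)) = ?I"
            using pf(2) I by (simp add: distinct_card)
          have v_in: "v \<in> set (take ?I A)"
          proof -
            have "A ! 0 \<in> set (take ?I A) \<longleftrightarrow> 0 < ?I"
              by (rule nth_in_set_take[OF pf(2)]) (use I in linarith)+
            then show ?thesis unfolding A'(2) using I(1) by linarith
          qed
          have "(?S - {v}) \<inter> set (take ?I A) = set (take ?I A) - {v}"
            using pf(1) by (auto dest: in_set_takeD)
          then show ?thesis using card_take v_in by simp
        qed
        show "\<bar>1 + real (a - 1) * real (card ?S - a - 1) / real (card ?S - 1) + real k * z - real ?n * step z u\<bar>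
            \<le> drift_err (Suc M) k"
          if a: "1 \<le> a" "a < card ?S" and k: "k = a \<or> k = card ?S - a" and z: "0 \<le> z" "z \<le> 1"
            and u: "u \<in> {min_cell M (k - 1)<..min_cell M k}" for a k z u
        proof -
          have aM: "a < M" and kM: "k = a \<or> k = M - a" using a k unfolding M_def[symmetric] by auto
          have k1: "1 \<le> k" "k < M" using a(1) aM kM by auto
          have r: "real (a - 1) = real a - 1" "real (M - a - 1) = real M - real a - 1" "real (M - 1) = real M - 1"
            using a(1) aM by (auto simp: of_nat_diff)
          have n0: "0 < (real M)\<^sup>2" using cS(2) by simp
          have u0: "0 \<le> u" using u min_cell_bounds(1)[OF k1] by auto
          have "\<bar>1 + (real a - 1) * (real M - real a - 1) / (real M - 1) + real k * z
              - real (Suc M) * (sqrt u * z + sqrt u * (1 - sqrt u))\<bar> \<le> 1 + 21/10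
                  * (sqrt (real (Suc M)) - sqrt (real k))"
          proof (rule drift_error_min)
            show "(real k)\<^sup>2 - real k + real M \<le> (real M)\<^sup>2 * u"
              using u n0 unfolding min_cell_bounds(7)[OF k1] by (simp add: divide_less_eq mult.commute)
            show "(real M)\<^sup>2 * u \<le> (real k)\<^sup>2 + real k + real M"
              using u n0 unfolding min_cell_bounds(8)[OF k1] by (simp add: le_divide_eq mult.commute)
          qed (use a(1) aM kM k1 z u0 cS(2) in \<open>auto simp: of_nat_diff\<close>)
          then show ?thesis unfolding M_def[symmetric] r cS(1) drift_err_def step_def .
        qed
      qed
      finally show "(\<Sum>A\<in>nonmin_first ?S. \<Sum>r=1..M. ?E A (Suc r)) \<le> of_nat (fact (M - 1))
          * ennreal (2 * (\<Sum>k=1..<M. real k * (exp (s\<^sup>2 * real (M - k) / 8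
            + \<bar>s\<bar> * drift_err (Suc M) k) * moment_bound s k)))"
        unfolding card_nonmin(2)[OF finS' S'2] M_def[symmetric] .
    qed
    also have "\<dots> = of_nat (fact (M - 1)) * ennreal (real M * exp (\<bar>s\<bar> * (2 * real (Suc M) / sqrt (real M)))
      + real M * (exp \<bar>s\<bar> * moment_bound s M)
      + 2 * (\<Sum>k=1..<M. real k * (exp (s\<^sup>2 * real (M - k) / 8 + \<bar>s\<bar> * drift_err (Suc M) k) * moment_bound s k)))"
    proof -
      let ?x = "exp (\<bar>s\<bar> * (2 * real (Suc M) / sqrt (real M)))"
      let ?y = "exp \<bar>s\<bar> * moment_bound s M"
      let ?z = "2 * (\<Sum>k=1..<M. real k * (exp (s\<^sup>2 * real (M - k) / 8 + \<bar>s\<bar> * drift_err (Suc M) k)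
          * moment_bound s k))"
      have nn: "0 \<le> ?x" "0 \<le> ?y" "0 \<le> ?z" using moment_bound_nonneg by (auto intro!: sum_nonneg mult_nonneg_nonneg)
      have "fact M = M * fact (M - 1)" using cS by (simp add: fact_reduce)
      then have f: "(of_nat (fact M) :: ennreal) = of_nat (fact (M - 1)) * ennreal (real M)"
        by (metis of_nat_mult mult.commute ennreal_of_nat_eq_real_of_nat)
      have "ennreal (real M * ?x + real M * ?y + ?z) = ennreal (real M) * st
          + (ennreal (exp \<bar>s\<bar>) * ennreal (real M * moment_bound s M) + ennreal ?z)"
      proof -
        have e1: "ennreal (real M) * st = ennreal (real M * ?x)"
          unfolding st_def by (rule ennreal_mult[symmetric]) auto
        have e2: "ennreal (exp \<bar>s\<bar>) * ennreal (real M * moment_bound s M) = ennreal (real M * ?y)"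
          using moment_bound_nonneg[of s M] by (subst ennreal_mult[symmetric]) (auto simp: mult_ac)
        show ?thesis unfolding e1 e2 using nn by (simp add: add.assoc del: exp_ge_zero)
      qed
      then show ?thesis unfolding f by (simp only: distrib_left mult_ac)
    qed
    also have "\<dots> \<le> of_nat (fact (M - 1)) * ennreal (real M * real (Suc M) * moment_bound s (Suc M))"
      using sum_drift_min[OF cS(2) s] by (intro mult_left_mono ennreal_leI) auto
    also have "\<dots> = of_nat (card (arrangements S q)) * ennreal (real ?n * moment_bound s ?n)"
    proof -
      have "card (arrangements S q) = fact M"
        using card_arrangements[OF fin less.prems(2)] cS(1) by simp
      also have "\<dots> = fact (M - 1) * M" using cS by (simp add: fact_reduce)
      finally have c: "(of_nat (card (arrangements S q)) :: ennreal) = of_nat (fact (M - 1)) * ennreal (real M)"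
        by (metis of_nat_mult ennreal_of_nat_eq_real_of_nat)
      have "ennreal (real M * real (Suc M) * moment_bound s (Suc M))
          = ennreal (real M) * ennreal (real (Suc M) * moment_bound s (Suc M))"
        using moment_bound_nonneg[of s "Suc M"] by (subst ennreal_mult[symmetric]) (auto simp: mult.assoc)
      then show ?thesis unfolding c cS(1) by (simp only: mult.assoc)
    qed
    finally show ?thesis .
  qed
qed

section \<open>From exponential moments to the metric\<close>

text \<open>The Gamma integral is restricted to [y, \<infinity>), where t^y is at least y^y and exp
  (- t) integrates to exp (- y).\<close>

lemma Gamma_ge_powr:
  fixes y :: real
  assumes "y > 0"
  shows "(y / exp 1) powr y \<le> Gamma (y + 1)"
proof -
  have "((\<lambda>t. y powr y * exp (- 1 * t)) has_integral y powr y * (exp (- 1 * y) / 1)) {y..}"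
    by (intro has_integral_mult_right has_integral_exp_minus_to_infinity) simp
  then have 1: "((\<lambda>t. if t \<in> {y..} then y powr y * exp (- t) else 0) has_integral y powr y * exp (- y)) {0..}"
    using assms by (subst has_integral_restrict) auto
  have 2: "((\<lambda>t. t powr (y + 1 - 1) / exp t) has_integral Gamma (y + 1)) {0..}"
    using assms by (intro Gamma_integral_real) auto
  have "y powr y * exp (- y) \<le> Gamma (y + 1)"
    by (rule has_integral_le[OF 1 2])
      (use assms in \<open>auto simp: exp_minus field_simps intro!: powr_mono2\<close>)
  moreover have "(y / exp 1) powr y = y powr y * exp (- y)"
    using assms by (simp add: powr_divide exp_powr_real exp_minus field_simps)
  ultimately show ?thesis by simp
qed

text \<open>The summand 1/2 in \<open>tau\<close> is dropped and the Gamma bound is applied at p /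
  2.\<close>

lemma tau_ge:
  assumes "p \<ge> 1"
  shows "2 powr (- 1 / p) * sqrt (p / (4 * exp 1)) \<le> tau p"
proof -
  have "(p / (4 * exp 1)) powr (p / 2) = (p / 2 / exp 1) powr (p / 2) / 2 powr (p / 2)"
    using assms by (subst powr_divide[symmetric]) (auto simp: field_simps)
  also have "\<dots> \<le> Gamma (p / 2 + 1) / 2 powr (p / 2)"
    using Gamma_ge_powr[of "p / 2"] assms by (intro divide_right_mono) auto
  finally have g: "(p / (4 * exp 1)) powr (p / 2) / 2 \<le> Gamma (p / 2 + 1) / 2 powr (p / 2 + 1)"
    by (simp add: powr_add)
  have "2 powr (- 1 / p) * sqrt (p / (4 * exp 1)) = ((p / (4 * exp 1)) powr (p / 2) / 2) powr (1 / p)"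
  proof -
    define x where "x = p / (4 * exp 1)"
    have "(x powr (p / 2) / 2) powr (1 / p) = x powr (1 / 2) * 2 powr (- 1 / p)"
      using assms by (simp add: powr_divide powr_powr powr_minus_divide)
    then show ?thesis using assms unfolding x_def[symmetric] by (simp add: powr_half_sqrt x_def)
  qed
  also have "\<dots> \<le> tau p"
    unfolding tau_def using g assms by (intro powr_mono2) auto
  finally show ?thesis .
qed

text \<open>The left side has the factor 2^z, z = 1 / p, where the bound for \<open>tau\<close>
  offers only 2^(- z). The difference is of order z and is multiplied by something of order 1 / sqrt
  z, which leaves at most sqrt z. This is paid by 7 - 69/10 = 1/10 and by the term 14 z coming from
  (2 p + 3) / (2 p - 1) \<ge> 1 + 2 z times 7.\<close>

lemma kappa_ge:
  assumes "p \<ge> 1"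
  shows "69/10 + 2 powr (1 / p) * sqrt (p / (4 * exp 1)) \<le> kappa p"
proof -
  define z where "z = 1 / p"
  define q where "q = sqrt (p / (4 * exp 1))"
  have z: "0 < z" "z \<le> 1" using assms by (auto simp: z_def)
  have l2: "0 < ln (2::real)" "ln (2::real) \<le> 1" using ln_le_minus_one[of 2] by auto
  have t0: "0 \<le> tau p" unfolding tau_def by simp
  have zl: "0 \<le> z * ln 2" "z * ln 2 \<le> z"
    using z l2 by (auto intro: mult_right_le_one_le)
  have "2 powr z \<le> 1 + z * ln 2 + (z * ln 2)\<^sup>2"
    unfolding powr_def using exp_bound[OF zl(1)] zl z by simp
  also have "(z * ln 2)\<^sup>2 \<le> z"
    unfolding power2_eq_square using mult_mono[of "z * ln 2" 1 "z * ln 2" z] zl z by simp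
  finally have u: "2 powr z \<le> 1 + 2 * z" using zl by simp
  have "1 - z * ln 2 \<le> 2 powr (- z)" unfolding powr_def using exp_ge_add_one_self[of "- z * ln 2"] by simp
  then have "2 powr z - 2 powr (- z) \<le> 3 * z" using u zl by simp
  moreover have q: "q \<le> 1 / (3 * sqrt z)" "0 \<le> q"
  proof -
    have "(9::real) \<le> 4 * exp 1" using exp_lower_Taylor_quadratic[of 1] by simp
    then have "p / (4 * exp 1) \<le> p / 9" using assms by (intro divide_left_mono) auto
    then have "q \<le> sqrt (p / 9)" unfolding q_def by simp
    also have "\<dots> = 1 / (3 * sqrt z)" unfolding z_def by (simp add: real_sqrt_divide)
    finally show "q \<le> 1 / (3 * sqrt z)" .
    show "0 \<le> q" unfolding q_def using assms by simp
  qed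
  ultimately have "(2 powr z - 2 powr (- z)) * q \<le> 3 * z * (1 / (3 * sqrt z))"
    using z by (intro mult_mono) auto
  also have "\<dots> = sqrt z" using z by (simp add: field_simps real_sqrt_mult_self flip: real_sqrt_mult)
  \<comment> \<open>The square completes 14 z - sqrt z; the minimum is -1/56, well above
    -1/10.\<close>
  also have "\<dots> \<le> 1 / 10 + 14 * z"
  proof -
    have "sqrt z * sqrt z = z" using z by simp
    moreover have "0 \<le> (sqrt z - 1 / 28)\<^sup>2" by simp
    ultimately show ?thesis by (simp add: power2_eq_square algebra_simps)
  qed
  finally have "69/10 + 2 powr z * q \<le> 7 + 14 * z + 2 powr (- z) * q" by (simp add: algebra_simps)
  also have "\<dots> \<le> 7 + 14 * z + tau p"
    using tau_ge[OF assms] unfolding q_def z_def by simp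
  also have "\<dots> \<le> (1 + 2 * z) * (7 + tau p)" using t0 z by (simp add: algebra_simps)
  also have "\<dots> \<le> kappa p"
    unfolding kappa_def using assms t0
    by (intro mult_right_mono) (auto simp: z_def field_simps)
  finally show ?thesis unfolding z_def q_def .
qed

text \<open>With r = sqrt (p / n), this is the tangent bound for ln at t = r / 2: its slope,
  multiplied by p, is 2 r n = l n, and l^2 n / 8 = p / 2. So \<open>l\<close> is the optimal
  exponent as long as it does not exceed 4.\<close>

lemma powr_le_exp_mult:
  fixes t p n :: real
  assumes t: "0 < t" "t \<le> 1" and p: "p \<ge> 1" and n: "n > 0"
  defines "l \<equiv> min 4 (2 * sqrt (p / n))"
  shows "t powr p \<le> (p / (4 * exp 1 * n)) powr (p / 2) * exp (l * n * t - l\<^sup>2 * n / 8)"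
proof -
  have "p * ln t \<le> p / 2 * (ln (p / (4 * n)) - 1) + (l * n * t - l\<^sup>2 * n / 8)"
  proof (cases "p \<le> 4 * n")
    case True
    define r where "r = sqrt (p / n)"
    have r0: "r > 0" and r2: "r\<^sup>2 = p / n" using p n by (auto simp: r_def)
    have "r \<le> sqrt 4" unfolding r_def using True n by (intro real_sqrt_le_mono) (simp add: field_simps)
    then have l: "l = 2 * r" unfolding l_def r_def by simp
    have pn: "p = n * r\<^sup>2" using r2 n by simp
    have "ln (p / (4 * n)) = 2 * ln (r / 2)"
    proof -
      have "p / (4 * n) = (r / 2) ^ 2" using n unfolding pn by (simp add: power2_eq_square)
      then show ?thesis using r0 by (simp only: ln_realpow half_gt_zero_iff of_nat_numeral)
    qed
    moreover have "ln (2 * t / r) \<le> 2 * t / r - 1" using t r0 by (intro ln_le_minus_one) auto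
    then have "p * ln (2 * t / r) \<le> p * (2 * t / r - 1)" using p by (intro mult_left_mono) auto
    moreover have "p * (2 * t / r - 1) = l * n * t - p"
      unfolding l pn using r0 by (simp add: power2_eq_square field_simps)
    moreover have "l\<^sup>2 * n / 8 = p / 2" unfolding l pn by (simp add: power2_eq_square)
    moreover have "ln (2 * t / r) = ln t - ln (r / 2)" using t r0 by (simp add: ln_div ln_mult)
    then have "p * ln (2 * t / r) = p * ln t - p * ln (r / 2)" by (simp only: right_diff_distrib)
    ultimately show ?thesis by (simp add: algebra_simps)
  next
    \<comment> \<open>The tangent point would lie beyond 1, outside the range of \<open>t\<close>.
      The tangent at 1 is used instead, and its slope \<open>p\<close> may be lowered to
      \<open>4 * n\<close> because \<open>t - 1\<close> is not positive.\<close>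
    case False
    then have "1 < p / n / 4" using n by (simp add: field_simps)
    then have "sqrt 4 \<le> sqrt (p / n)" by (intro real_sqrt_le_mono) simp
    then have l: "l = 4" unfolding l_def by simp
    have r: "0 < 4 * n / p" using n p by simp
    have "p * ln t \<le> p * (t - 1)" using ln_le_minus_one[of t] t p by (intro mult_left_mono) auto
    also have "\<dots> \<le> 4 * n * (t - 1)" using False t by (intro mult_right_mono_neg) auto
    finally have a: "p * ln t \<le> 4 * n * (t - 1)" .
    have "p / 2 * ln (4 * n / p) \<le> p / 2 * (4 * n / p - 1)"
      using ln_le_minus_one[OF r] p by (intro mult_left_mono) auto
    also have "\<dots> = 2 * n - p / 2" using p by (simp add: field_simps)
    finally have "p / 2 * ln (4 * n / p) \<le> 2 * n - p / 2" .
    moreover have "ln (4 * n / p) = - ln (p / (4 * n))" using n p by (simp add: ln_div)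
    ultimately show ?thesis using a unfolding l by (simp add: algebra_simps)
  qed
  moreover have "ln (p / (4 * exp 1 * n)) = ln (p / (4 * n)) - 1"
    using p n by (simp add: ln_div ln_mult)
  ultimately have "p * ln t \<le> p / 2 * ln (p / (4 * exp 1 * n)) + (l * n * t - l\<^sup>2 * n / 8)" by simp
  then have "exp (p * ln t) \<le> exp (p / 2 * ln (p / (4 * exp 1 * n)) + (l * n * t - l\<^sup>2 * n / 8))" by simp
  then show ?thesis using t p n by (simp add: powr_def exp_add)
qed

text \<open>Convexity of the power with weights a / (a + b) and b / (a + b). It replaces Minkowski's
  inequality by a pointwise bound that is linear in w^p and can be integrated directly.\<close>

lemma powr_add_le:
  fixes a b w p :: real
  assumes "a > 0" "b > 0" "w \<ge> 0" "p \<ge> 1"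
  shows "(a + b * w) powr p \<le> (a + b) powr p * (a / (a + b) + b / (a + b) * w powr p)"
proof -
  define u where "u = a / (a + b)"
  define v where "v = b / (a + b)"
  have uv: "0 < u" "0 < v" "u + v = 1" using assms by (auto simp: u_def v_def add_divide_distrib[symmetric])
  have "(u + v * w) powr p \<le> u + v * w powr p"
  proof (cases "w = 0")
    case True
    have "u powr p \<le> u powr 1" using uv assms by (intro powr_mono') auto
    then show ?thesis using True uv by simp
  next
    case False
    have "(u *\<^sub>R 1 + v *\<^sub>R w) powr p \<le> u * 1 powr p + v * w powr p"
      using convex_onD[OF powr_convex[OF assms(4)], of v 1 w] uv False assms
      by (simp add: eq_diff_eq[symmetric])
    then show ?thesis by simp
  qed
  moreover have "a + b * w = (a + b) * (u + v * w)"
  proof -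
    have "(a + b) * u = a" "(a + b) * v = b" using assms by (simp_all add: u_def v_def)
    then show ?thesis by (simp add: distrib_left mult.assoc[symmetric])
  qed
  ultimately show ?thesis
    using assms uv unfolding u_def[symmetric] v_def[symmetric] by (simp add: powr_mult mult_left_mono)
qed

text \<open>\<open>a\<close> is the systematic part and \<open>w\<close> the excess over it in units
  of \<open>b\<close>. The denominator is twice the moment bound, one share for each sign of the
  exponent, and the factor 2^(1 / p) in \<open>b\<close> cancels this 2; thus the quotient averages
  to at most 1.\<close>

lemma powr_le_exp_average:
  fixes x a p n :: real
  assumes x: "0 \<le> x" "x \<le> 1" and a: "a > 0" and p: "p \<ge> 1" and n: "n > 0"
  defines "l \<equiv> min 4 (2 * sqrt (p / n))" and "b \<equiv> 2 powr (1 / p) * sqrt (p / (4 * exp 1 * n))"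
  shows "x powr p \<le> (a + b) powr p * (a / (a + b) + b / (a + b) * (exp (l * n * x) / (2 * exp (l\<^sup>2
      * n / 8 + l * (a * n)))))"
proof -
  have b: "b > 0" unfolding b_def using p n by simp
  define w where "w = max 0 (x - a) / b"
  have w: "w \<ge> 0" unfolding w_def using b by simp
  have "w powr p \<le> exp (l * n * x) / (2 * exp (l\<^sup>2 * n / 8 + l * (a * n)))"
  proof (cases "x \<le> a")
    case True
    then show ?thesis by (simp add: w_def)
  next
    case False
    have bp: "b powr p = 2 * (p / (4 * exp 1 * n)) powr (p / 2)"
      unfolding b_def using p n by (simp add: powr_mult powr_powr powr_half_sqrt[symmetric])
    have "(x - a) powr p \<le> b powr p / 2 * exp (l * n * (x - a) - l\<^sup>2 * n / 8)"
      unfolding bp l_def using powr_le_exp_mult[of "x - a" p n] False x a p n by simp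
    then have "w powr p \<le> exp (l * n * (x - a) - l\<^sup>2 * n / 8) / 2"
      using False b unfolding w_def by (simp add: powr_divide field_simps)
    also have "\<dots> = exp (l * n * x) / (2 * exp (l\<^sup>2 * n / 8 + l * (a * n)))"
      by (simp add: exp_diff exp_add algebra_simps)
    finally show ?thesis .
  qed
  then have "(a + b) powr p * (a / (a + b) + b / (a + b) * w powr p) \<le> (a + b) powr p * (a / (a + b)
      + b / (a + b) * (exp (l * n * x) / (2 * exp (l\<^sup>2 * n / 8 + l * (a * n)))))"
    using a b by (intro mult_left_mono add_left_mono) auto
  moreover have "x powr p \<le> (a + b * w) powr p"
    using x a b p by (intro powr_mono2) (auto simp: w_def)
  ultimately show ?thesis using powr_add_le[OF a b w p] by linarith
qed

lemma sum_permutations_of_set_eq: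
  fixes f :: "'a::linorder list \<Rightarrow> ennreal"
  assumes "finite S" "S \<noteq> {}"
  shows "(\<Sum>A\<in>permutations_of_set S. f A) = (\<Sum>q<card S. \<Sum>A\<in>arrangements S q. f A)"
proof -
  have "(\<Sum>q<card S. \<Sum>A\<in>arrangements S q. f A) = sum f (\<Union>q<card S. arrangements S q)"
  proof (rule sum.UNION_disjoint[symmetric])
    show "\<forall>q\<in>{..<card S}. finite (arrangements S q)"
      unfolding arrangements_def by simp
    show "\<forall>i\<in>{..<card S}. \<forall>j\<in>{..<card S}. i \<noteq> j \<longrightarrow> arrangements S i \<inter> arrangements S j = {}"
    proof (intro ballI impI, rule ccontr)
      fix i j assume ij: "i \<in> {..<card S}" "j \<in> {..<card S}" "i \<noteq> j" "arrangements S i \<inter> arrangements S j \<noteq> {}"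
      then obtain A where A: "A \<in> permutations_of_set S" "A ! i = Min S" "A ! j = Min S"
        unfolding arrangements_def by blast
      then have "A ! i = A ! j" by simp
      then show False using perm_facts[OF A(1)] ij(1-3) nth_eq_iff_index_eq[of A i j] by auto
    qed
  qed simp
  moreover have "(\<Union>q<card S. arrangements S q) = permutations_of_set S"
  proof
    show "(\<Union>q<card S. arrangements S q) \<subseteq> permutations_of_set S"
      unfolding arrangements_def by blast
    show "permutations_of_set S \<subseteq> (\<Union>q<card S. arrangements S q)"
    proof
      fix A assume A: "A \<in> permutations_of_set S"
      have "Min S \<in> set A" using perm_facts(1)[OF A] Min_in[OF assms] by simp
      then obtain q where "q < length A" "A ! q = Min S" unfolding in_set_conv_nth by blast
      then show "A \<in> (\<Union>q<card S. arrangements S q)"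
        using A perm_facts(3)[OF A] unfolding arrangements_def by auto
    qed
  qed
  ultimately show ?thesis by simp
qed

lemma sum_card_arrangements:
  assumes "finite S" "S \<noteq> {}"
  shows "(\<Sum>q<card S. of_nat (card (arrangements S q)) :: ennreal) = of_nat (fact (card S))"
proof -
  have "of_nat (card (permutations_of_set S)) = (\<Sum>q<card S. of_nat (card (arrangements S q)) :: ennreal)"
    using sum_permutations_of_set_eq[OF assms, of "\<lambda>_. 1"] by (simp only: sum_constant mult_1_right)
  then show ?thesis unfolding card_permutations_of_set[OF assms(1)] by (rule sym)
qed

section \<open>The coupling, its marginals and its moments\<close>

definition ranked_lists :: "'a::linorder set \<Rightarrow> ('a list \<times> nat) pmf" where
  "ranked_lists S = pair_pmf (pmf_of_set (permutations_of_set S)) (pmf_of_set {1..card S})"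

definition exchange_coupling :: "'a::linorder set \<Rightarrow> (real \<times> real) measure" where
  "exchange_coupling S = measure_pmf (ranked_lists S) \<bind>
     (\<lambda>(A, r). distr (nu A r) (borel \<Otimes>\<^sub>M borel) (\<lambda>z. (real (key_exchanges A r) / real (card S), z)))"

lemma nn_integral_ranked_lists:
  assumes "finite S" "S \<noteq> {}"
  shows "(\<integral>\<^sup>+x. f x \<partial>measure_pmf (ranked_lists S))
    = (\<Sum>A\<in>permutations_of_set S. \<Sum>r=1..card S. f (A, r)) / (of_nat (fact (card S)) * of_nat (card S))"
proof -
  have n: "card S \<noteq> 0" using assms by simp
  have "(\<integral>\<^sup>+x. f x \<partial>measure_pmf (ranked_lists S))
    = (\<Sum>A\<in>permutations_of_set S. (\<Sum>r=1..card S. f (A, r)) / of_nat (card S)) / of_nat (fact (card S))"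
  proof -
    have "(\<integral>\<^sup>+r. f (A, r) \<partial>measure_pmf (pmf_of_set {1..card S})) = (\<Sum>r=1..card S. f (A, r)) / of_nat (card S)" for A
      using nn_integral_pmf_of_set[of "{1..card S}" "\<lambda>r. f (A, r)"] n by (simp add: ennreal_of_nat_eq_real_of_nat)
    then show ?thesis
      unfolding ranked_lists_def nn_integral_pair_pmf' using assms
      by (subst nn_integral_pmf_of_set) (auto simp: ennreal_of_nat_eq_real_of_nat)
  qed
  also have "\<dots> = (\<Sum>A\<in>permutations_of_set S. \<Sum>r=1..card S. f (A, r)) * (inverse (of_nat (card S))
      * inverse (of_nat (fact (card S))))"
    unfolding divide_ennreal_def by (simp only: sum_distrib_right mult.assoc)
  also have "inverse (of_nat (card S)) * inverse (of_nat (fact (card S)))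
      = inverse (of_nat (fact (card S)) * of_nat (card S) :: ennreal)"
    using n by (subst ennreal_inverse_mult) (auto simp: mult.commute ennreal_of_nat_eq_real_of_nat)
  finally show ?thesis unfolding divide_ennreal_def .
qed

lemma
  fixes S :: "'a::linorder set"
  assumes "finite S" "S \<noteq> {}"
  shows prob_space_exchange_coupling: "prob_space (exchange_coupling S)"
    and sets_exchange_coupling: "sets (exchange_coupling S) = sets (borel \<Otimes>\<^sub>M borel)"
    and nn_integral_exchange_coupling: "\<And>f. f \<in> borel_measurable (borel \<Otimes>\<^sub>M borel) \<Longrightarrow>
      (\<integral>\<^sup>+x. f x \<partial>exchange_coupling S)
          = (\<integral>\<^sup>+(A, r). (\<integral>\<^sup>+z. f (real (key_exchanges A r) / real (card S), z) \<partial>nu A r)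
              \<partial>measure_pmf (ranked_lists S))"
proof -
  let ?B = "borel \<Otimes>\<^sub>M borel :: (real \<times> real) measure"
  define K :: "'a list \<times> nat \<Rightarrow> (real \<times> real) measure" where "K
      = (\<lambda>(A, r). distr (nu A r) ?B (\<lambda>z. (real (key_exchanges A r) / real (card S), z)))"
  have m: "(\<lambda>z. (c, z)) \<in> nu A r \<rightarrow>\<^sub>M ?B" for c A r
    by (subst measurable_cong_sets[OF nu_facts(2) refl]) measurable
  have Kp: "prob_space (K x)" for x
    unfolding K_def using nu_facts(1) by (auto split: prod.split intro!: prob_space.prob_space_distr m)
  have Ks: "sets (K x) = sets ?B" for x
    unfolding K_def by (auto split: prod.split)
  have Km: "K \<in> measurable (measure_pmf (ranked_lists S)) (subprob_algebra ?B)"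
    using Kp Ks by (auto simp: space_subprob_algebra prob_space_imp_subprob_space)
  have e: "exchange_coupling S = measure_pmf (ranked_lists S) \<bind> K"
    unfolding exchange_coupling_def K_def ..
  show "prob_space (exchange_coupling S)"
    unfolding e by (rule measure_pmf.prob_space_bind[OF _ Km]) (simp add: Kp)
  show "sets (exchange_coupling S) = sets ?B"
    unfolding e by (rule sets_bind) (simp_all add: Ks)
  show "(\<integral>\<^sup>+x. f x \<partial>exchange_coupling S)
      = (\<integral>\<^sup>+(A, r). (\<integral>\<^sup>+z. f (real (key_exchanges A r) / real (card S), z) \<partial>nu A r) \<partial>measure_pmf (ranked_lists S))"
    if f: "f \<in> borel_measurable ?B" for f
    unfolding e nn_integral_bind[OF f Km]
    by (intro nn_integral_cong) (auto simp: K_def f intro!: nn_integral_distr m)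
qed

text \<open>The first marginal holds by construction, every \<open>nu A r\<close> being a
  probability measure. For the second, the uniform list is split according to the place of its
  minimum and \<open>nu_integral\<close> applies to each place.\<close>

lemma exchange_coupling_in_couplings:
  assumes "finite S" "S \<noteq> {}"
  shows "exchange_coupling S \<in> couplings (scaled_exchanges_law S) limit_law"
proof -
  let ?G = "exchange_coupling S"
  note G = sets_exchange_coupling[OF assms] nn_integral_exchange_coupling[OF assms]
  have n0: "card S \<noteq> 0" using assms by simp
  have f1: "fst \<in> ?G \<rightarrow>\<^sub>M borel" and f2: "snd \<in> ?G \<rightarrow>\<^sub>M borel"
    unfolding measurable_cong_sets[OF G(1) refl] by measurable
  have "distr ?G borel fst = scaled_exchanges_law S"
  proof (rule measure_eqI)
    show "sets (distr ?G borel fst) = sets (scaled_exchanges_law S)"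
      by (simp add: scaled_exchanges_law_def)
    fix X :: "real set" assume "X \<in> sets (distr ?G borel fst)"
    then have X[measurable]: "X \<in> sets borel" by simp
    have "emeasure (distr ?G borel fst) X = (\<integral>\<^sup>+x. indicator X x \<partial>distr ?G borel fst)" by simp
    also have "\<dots> = (\<integral>\<^sup>+x. indicator X (fst x) \<partial>?G)"
      by (rule nn_integral_distr[OF f1]) simp
    also have "\<dots> = (\<integral>\<^sup>+(A, r). (\<integral>\<^sup>+z. indicator X (real (key_exchanges A r) / real (card S))
        \<partial>nu A r) \<partial>measure_pmf (ranked_lists S))"
      by (subst G(2)) auto
    also have "\<dots> = (\<integral>\<^sup>+(A, r). indicator X (real (key_exchanges A r) / real (card S)) \<partial>measure_pmf (ranked_lists S))"
      by (intro nn_integral_cong) (auto simp: prob_space.emeasure_space_1[OF nu_facts(1)])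
    also have "\<dots> = (\<integral>\<^sup>+x. indicator X x \<partial>scaled_exchanges_law S)"
      unfolding scaled_exchanges_law_def ranked_lists_def[symmetric]
      by (subst nn_integral_distr) (auto intro!: nn_integral_cong)
    also have "\<dots> = emeasure (scaled_exchanges_law S) X"
      by (rule nn_integral_indicator) (simp add: scaled_exchanges_law_def)
    finally show "emeasure (distr ?G borel fst) X = emeasure (scaled_exchanges_law S) X" .
  qed
  moreover have "distr ?G borel snd = limit_law"
  proof (rule measure_eqI)
    have L: "sets limit_law = sets borel" using unit_law_limit by (simp add: unit_law_def)
    show "sets (distr ?G borel snd) = sets limit_law" by (simp add: L)
    fix X :: "real set" assume "X \<in> sets (distr ?G borel snd)"
    then have X[measurable]: "X \<in> sets borel" by simp
    let ?I = "\<integral>\<^sup>+x. indicator X x \<partial>limit_law"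
    have "emeasure (distr ?G borel snd) X = (\<integral>\<^sup>+x. indicator X x \<partial>distr ?G borel snd)" by simp
    also have "\<dots> = (\<integral>\<^sup>+x. indicator X (snd x) \<partial>?G)"
      by (rule nn_integral_distr[OF f2]) simp
    also have "\<dots> = (\<integral>\<^sup>+(A, r). (\<integral>\<^sup>+z. indicator X z \<partial>nu A r) \<partial>measure_pmf (ranked_lists S))"
      by (subst G(2)) auto
    also have "\<dots> = (\<Sum>A\<in>permutations_of_set S. \<Sum>r=1..card S. \<integral>\<^sup>+z. indicator X z
        \<partial>nu A r) / (of_nat (fact (card S)) * of_nat (card S))"
      unfolding nn_integral_ranked_lists[OF assms] by simp
    also have "(\<Sum>A\<in>permutations_of_set S. \<Sum>r=1..card S. \<integral>\<^sup>+z. indicator X z \<partial>nu A r)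
      = (\<Sum>q<card S. of_nat (card (arrangements S q)) * (of_nat (card S) * ?I))"
      unfolding sum_permutations_of_set_eq[OF assms]
      by (intro sum.cong refl nu_integral) (auto simp: assms)
    also have "\<dots> = of_nat (fact (card S)) * of_nat (card S) * ?I"
      unfolding sum_distrib_right[symmetric] sum_card_arrangements[OF assms] by (simp only: mult.assoc)
    also have "\<dots> / (of_nat (fact (card S)) * of_nat (card S)) = ?I"
    proof -
      have "(of_nat (fact (card S)) * of_nat (card S) :: ennreal) = of_nat (fact (card S) * card S)" by simp
      then show ?thesis using n0
        by (metis ennreal_mult_divide_eq mult.commute of_nat_eq_0_iff mult_eq_0_iff fact_nonzero ennreal_of_nat_neq_top)
    qed
    also have "?I = emeasure limit_law X"
      by (rule nn_integral_indicator) (simp add: L)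
    finally show "emeasure (distr ?G borel snd) X = emeasure limit_law X" .
  qed
  ultimately show ?thesis
    unfolding couplings_def using prob_space_exchange_coupling[OF assms] G(1) by simp
qed

lemma exp_moment_exchange_coupling:
  assumes "finite S" "S \<noteq> {}" "\<bar>s\<bar> \<le> 4"
  shows "(\<integral>\<^sup>+(w, z). ennreal (exp (s * (real (card S) * (w - z)))) \<partial>exchange_coupling S)
      \<le> ennreal (moment_bound s (card S))"
proof -
  have n0: "card S \<noteq> 0" using assms by simp
  have [measurable]: "(\<lambda>(w, z). ennreal (exp (s * (real (card S) * (w - z))))) \<in> borel_measurable (borel \<Otimes>\<^sub>M borel)"
    by measurable
  have "(\<integral>\<^sup>+(w, z). ennreal (exp (s * (real (card S) * (w - z)))) \<partial>exchange_coupling S)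
    = (\<integral>\<^sup>+(A, r). exp_moment s (real (card S)) A r \<partial>measure_pmf (ranked_lists S))"
    unfolding exp_moment_def using n0
    by (subst nn_integral_exchange_coupling[OF assms(1,2)]) (auto intro!: nn_integral_cong simp: right_diff_distrib)
  also have "\<dots> = (\<Sum>A\<in>permutations_of_set S. \<Sum>r=1..card S. exp_moment s (real (card S)) A r) / (of_nat (fact (card S)) * of_nat (card S))"
    unfolding nn_integral_ranked_lists[OF assms(1,2)] by simp
  also have "\<dots> \<le> (of_nat (fact (card S)) * of_nat (card S)
      * ennreal (moment_bound s (card S))) / (of_nat (fact (card S)) * of_nat (card S))"
  proof (rule divide_right_mono_ennreal)
    have "(\<Sum>A\<in>permutations_of_set S. \<Sum>r=1..card S. exp_moment s (real (card S)) A r)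
      \<le> (\<Sum>q<card S. of_nat (card (arrangements S q)) * ennreal (real (card S) * moment_bound s (card S)))"
      unfolding sum_permutations_of_set_eq[OF assms(1,2)]
      by (intro sum_mono nu_exp_moment) (auto simp: assms)
    also have "\<dots> = of_nat (fact (card S)) * ennreal (real (card S) * moment_bound s (card S))"
      unfolding sum_distrib_right[symmetric] sum_card_arrangements[OF assms(1,2)] ..
    also have "\<dots> = of_nat (fact (card S)) * of_nat (card S) * ennreal (moment_bound s (card S))"
      using moment_bound_nonneg[of s "card S"]
          by (subst ennreal_mult) (auto simp: mult.assoc ennreal_of_nat_eq_real_of_nat)
    finally show "(\<Sum>A\<in>permutations_of_set S. \<Sum>r=1..card S. exp_moment s (real (card S)) A r) \<le> \<dots>" .
  qed
  also have "\<dots> = ennreal (moment_bound s (card S))"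
  proof -
    have "(of_nat (fact (card S)) * of_nat (card S) :: ennreal) = of_nat (fact (card S) * card S)" by simp
    then show ?thesis using n0
      by (metis ennreal_mult_divide_eq mult.commute of_nat_eq_0_iff mult_eq_0_iff fact_nonzero ennreal_of_nat_neq_top)
  qed
  finally show ?thesis .
qed

lemma AE_exchange_coupling:
  assumes "finite S" "S \<noteq> {}"
  shows "AE x in exchange_coupling S. \<bar>fst x - snd x\<bar> \<le> 1"
proof (rule AE_I)
  let ?X = "{x :: real \<times> real. \<not> \<bar>fst x - snd x\<bar> \<le> 1}"
  have "open ?X" unfolding not_le by (intro open_Collect_less continuous_intros)
  then have X: "?X \<in> sets (borel \<Otimes>\<^sub>M borel)" unfolding borel_prod by (rule borel_open)
  have sp: "space (exchange_coupling S) = UNIV"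
    using sets_eq_imp_space_eq[OF sets_exchange_coupling[OF assms]] by (simp add: space_pair_measure)
  show "{x \<in> space (exchange_coupling S). \<not> \<bar>fst x - snd x\<bar> \<le> 1} \<subseteq> ?X" by auto
  show "?X \<in> sets (exchange_coupling S)" using X sets_exchange_coupling[OF assms] by simp
  have "emeasure (exchange_coupling S) ?X = (\<integral>\<^sup>+x. indicator ?X x \<partial>exchange_coupling S)"
    using X sets_exchange_coupling[OF assms] by simp
  also have "\<dots> = (\<integral>\<^sup>+(A, r). (\<integral>\<^sup>+z. indicator ?X (real (key_exchanges A r) / real (card S), z)
      \<partial>nu A r) \<partial>measure_pmf (ranked_lists S))"
    by (rule nn_integral_exchange_coupling[OF assms]) (use X in simp)
  also have "\<dots> = (\<Sum>A\<in>permutations_of_set S. \<Sum>r=1..card S. \<integral>\<^sup>+z. indicator ?X (real (key_exchanges A r) / real (card S), z) \<partial>nu A r) / (of_nat (fact (card S)) * of_nat (card S))"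
    unfolding nn_integral_ranked_lists[OF assms] by simp
  also have "(\<Sum>A\<in>permutations_of_set S. \<Sum>r=1..card S. \<integral>\<^sup>+z. indicator ?X (real (key_exchanges A r) / real (card S), z) \<partial>nu A r) = 0"
  proof (intro sum.neutral ballI)
    fix A r assume A: "A \<in> permutations_of_set S"
    have n0: "card S > 0" using assms by (simp add: card_gt_0_iff)
    have "key_exchanges A r \<le> card S" using key_exchanges_le[OF perm_facts(2)[OF A], of r] perm_facts(3)[OF A] by simp
    then have k: "real (key_exchanges A r) / real (card S) \<le> 1" "0
        \<le> real (key_exchanges A r) / real (card S)" using n0 by simp_all
    have "(\<integral>\<^sup>+z. indicator ?X (real (key_exchanges A r) / real (card S), z) \<partial>nu A r) = (\<integral>\<^sup>+z. 0 \<partial>nu A r)"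
    proof (rule nn_integral_cong_AE)
      show "AE z in nu A r. indicator ?X (real (key_exchanges A r) / real (card S), z) = (0::ennreal)"
        using nu_facts(3)[of A r]
      proof eventually_elim
        case (elim z)
        then have "\<bar>real (key_exchanges A r) / real (card S) - z\<bar> \<le> 1" using k by linarith
        then show ?case by simp
      qed
    qed
    then show "(\<integral>\<^sup>+z. indicator ?X (real (key_exchanges A r) / real (card S), z) \<partial>nu A r) = 0" by simp
  qed
  finally show "emeasure (exchange_coupling S) ?X = 0" by simp
qed


text \<open>The exponential of the absolute difference is at most the sum of the exponentials with
  exponents \<open>l\<close> and \<open>- l\<close>, and each integrates to at most
  \<open>M\<close>, the moment bound at \<open>l\<close>. After division by 2 M both weights of the
  convex combination are met, which leaves the constant \<open>(a + b) powr p\<close>.\<close>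

lemma nn_integral_powr_exchange_coupling:
  fixes S :: "'a::linorder set" and p :: real
  assumes "finite S" "S \<noteq> {}" "p \<ge> 1"
  defines "a \<equiv> 69/10 / sqrt (real (card S))"
    and "b \<equiv> 2 powr (1 / p) * sqrt (p / (4 * exp 1 * real (card S)))"
  shows "(\<integral>\<^sup>+(w, z). ennreal (\<bar>w - z\<bar> powr p) \<partial>exchange_coupling S) \<le> ennreal ((a + b) powr p)"
proof -
  define n where "n = real (card S)"
  have n0: "n > 0" using assms by (simp add: n_def card_gt_0_iff)
  have a0: "a > 0" and b0: "b > 0" using n0 assms(3) unfolding a_def b_def n_def[symmetric] by simp_all
  define l where "l = min 4 (2 * sqrt (p / n))"
  have l: "0 \<le> l" "l \<le> 4" using assms(3) n0 by (auto simp: l_def)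
  define M where "M = exp (l\<^sup>2 * n / 8 + l * (a * n))"
  have M0: "M > 0" unfolding M_def by simp
  have "a * n = 69/10 * (n / sqrt n)" unfolding a_def n_def[symmetric] by simp
  then have "a * n = 69/10 * sqrt n" using n0 by (simp add: real_div_sqrt)
  then have mb: "moment_bound l (card S) = M" "moment_bound (- l) (card S) = M"
    using l by (simp_all add: moment_bound_def M_def n_def)
  define c where "c = (a + b) powr p"
  define u where "u = a / (a + b)"
  define v where "v = b / (a + b)"
  have cuv: "0 \<le> c" "0 \<le> u" "0 \<le> v" "u + v = 1"
    using a0 b0 by (auto simp: c_def u_def v_def add_divide_distrib[symmetric])
  have lin: "ennreal (h + k * (x + y)) = ennreal h + ennreal k * (ennreal x + ennreal y)"
    if "0 \<le> h" "0 \<le> k" "0 \<le> x" "0 \<le> y" for h k x y :: real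
    using that by (subst ennreal_plus[symmetric], simp, simp, subst ennreal_mult[symmetric], simp, simp)
      (subst ennreal_plus[symmetric], simp_all)
  define E where "E = (\<lambda>(s::real) (w::real, z::real). ennreal (exp (s * (n * (w - z)))))"
  have Em: "E s \<in> borel_measurable (exchange_coupling S)" for s
    unfolding measurable_cong_sets[OF sets_exchange_coupling[OF assms(1,2)] refl] E_def by measurable
  have Eb: "integral\<^sup>N (exchange_coupling S) (E s) \<le> ennreal (moment_bound s (card S))" if "\<bar>s\<bar> \<le> 4" for s
    using exp_moment_exchange_coupling[OF assms(1,2) that] unfolding E_def n_def .
  have "(\<integral>\<^sup>+(w, z). ennreal (\<bar>w - z\<bar> powr p) \<partial>exchange_coupling S)
    \<le> (\<integral>\<^sup>+x. ennreal (c * u) + ennreal (c * v / (2 * M)) * (E l x + E (- l) x) \<partial>exchange_coupling S)"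
  proof (rule nn_integral_mono_AE)
    show "AE x in exchange_coupling S. (case x of (w, z) \<Rightarrow> ennreal (\<bar>w - z\<bar> powr p))
      \<le> ennreal (c * u) + ennreal (c * v / (2 * M)) * (E l x + E (- l) x)"
      using AE_exchange_coupling[OF assms(1,2)]
    proof eventually_elim
      case (elim x)
      obtain w z where x: "x = (w, z)" by (cases x)
      let ?y = "exp (l * (n * (w - z))) + exp (- l * (n * (w - z)))"
      have "\<bar>w - z\<bar> powr p \<le> c * (u + v * (exp (l * n * \<bar>w - z\<bar>) / (2 * M)))"
        unfolding c_def u_def v_def M_def l_def b_def n_def[symmetric]
        by (rule powr_le_exp_average) (use elim x a0 n0 assms(3) in auto)
      also have "exp (l * n * \<bar>w - z\<bar>) \<le> ?y"
        by (cases "w \<ge> z") (simp_all add: mult.assoc right_diff_distrib)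
      then have "c * (u + v * (exp (l * n * \<bar>w - z\<bar>) / (2 * M))) \<le> c * (u + v * (?y / (2 * M)))"
        using cuv M0 by (intro mult_left_mono add_left_mono divide_right_mono) auto
      also have "c * (u + v * (y / (2 * M))) = c * u + c * v / (2 * M) * y" for y by (simp add: distrib_left)
      finally have "ennreal (\<bar>w - z\<bar> powr p) \<le> ennreal (c * u + c * v / (2 * M) * ?y)" by (rule ennreal_leI)
      also have "\<dots> = ennreal (c * u) + ennreal (c * v / (2 * M)) * (E l x + E (- l) x)"
      proof -
        have "0 \<le> c * u" "0 \<le> c * v / (2 * M)" using cuv M0 by simp_all
        then show ?thesis unfolding x E_def case_prod_conv by (intro lin) simp_all
      qed
      finally show ?case unfolding x by simp
    qed
  qed
  also have "\<dots> = ennreal (c * u) + ennreal (c * v / (2 * M))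
      * (integral\<^sup>N (exchange_coupling S) (E l) + integral\<^sup>N (exchange_coupling S) (E (- l)))"
    using Em prob_space.emeasure_space_1[OF prob_space_exchange_coupling[OF assms(1,2)]]
    by (simp add: nn_integral_add nn_integral_cmult)
  also have "\<dots> \<le> ennreal (c * u) + ennreal (c * v / (2 * M)) * (ennreal M + ennreal M)"
    using Eb[of l] Eb[of "- l"] l unfolding mb by (intro add_left_mono mult_left_mono add_mono) auto
  also have "\<dots> = ennreal (c * u + c * v / (2 * M) * (M + M))"
  proof -
    have "0 \<le> c * u" "0 \<le> c * v / (2 * M)" "0 \<le> M" using cuv M0 by simp_all
    then show ?thesis by (intro lin[symmetric])
  qed
  also have "c * u + c * v / (2 * M) * (M + M) = c * (u + v)" using M0 by (simp add: distrib_left)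
  finally show ?thesis unfolding c_def[symmetric] cuv(4) by simp
qed

theorem theorem3p3:
  fixes S :: "'a::linorder set" and n :: nat and p :: real
  assumes "finite S" and "card S = n" and "n \<ge> 1" and "p \<ge> 1"
  shows "ell p (scaled_exchanges_law S) limit_law \<le> ennreal (kappa p * real n powr (- 1 / 2))"
proof -
  have S: "S \<noteq> {}" using assms(2,3) by auto
  have n0: "real n > 0" using assms(3) by simp
  define d where "d = 69/10 / sqrt (real n) + 2 powr (1 / p) * sqrt (p / (4 * exp 1 * real n))"
  have d0: "d \<ge> 0" unfolding d_def using assms(4) by simp
  let ?I = "\<integral>\<^sup>+(w, z). ennreal (\<bar>w - z\<bar> powr p) \<partial>exchange_coupling S"
  have I: "?I \<le> ennreal (d powr p)"
    using nn_integral_powr_exchange_coupling[OF assms(1) S assms(4)] unfolding assms(2) d_def[symmetric] .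
  have fin: "?I \<noteq> \<infinity>" using I by (auto simp: top_unique)
  have "enn2real ?I powr (1 / p) \<le> (d powr p) powr (1 / p)"
    using I assms(4) by (intro powr_mono2 enn2real_leI) auto
  also have "\<dots> = d" using d0 assms(4) by (simp add: powr_powr)
  finally have e: "enn2real ?I powr (1 / p) \<le> d" .
  have "ell p (scaled_exchanges_law S) limit_law \<le> Lp_norm p (exchange_coupling S) (\<lambda>(w, z). w - z)"
    unfolding ell_def by (rule INF_lower) (rule exchange_coupling_in_couplings[OF assms(1) S])
  also have "\<dots> = ennreal (enn2real ?I powr (1 / p))"
    using fin unfolding Lp_norm_def by (simp add: case_prod_unfold Let_def)
  also have "\<dots> \<le> ennreal d" using e by (rule ennreal_leI)
  also have "d \<le> kappa p * real n powr (- 1 / 2)"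
  proof -
    have "d = (69/10 + 2 powr (1 / p) * sqrt (p / (4 * exp 1))) * (1 / sqrt (real n))"
    proof -
      have "sqrt (p / (4 * exp 1 * real n)) = sqrt (p / (4 * exp 1)) * (1 / sqrt (real n))"
        by (simp add: real_sqrt_divide real_sqrt_mult)
      then show ?thesis unfolding d_def by (simp add: add_divide_distrib)
    qed
    also have "\<dots> \<le> kappa p * (1 / sqrt (real n))"
      using kappa_ge[OF assms(4)] by (intro mult_right_mono) auto
    also have "1 / sqrt (real n) = real n powr (- 1 / 2)"
      using n0 by (simp add: powr_minus_divide powr_half_sqrt)
    finally show ?thesis .
  qed
  finally show ?thesis by (simp add: ennreal_leI)
qed

end
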